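(* The following are equivalent: (i) $(\mathcal A_L,S)$ is a Hopf algebroid. That is, $\mathcal A_L=(A,L,s_L,t_L,\gamma_L,\pi_L)$ is a left bialgebroid and $S$ is an anti-automorphism of the total ring $A$ such that $S\circ t_L=s_L$ and, for all $a\in A$, as elements of $A_L\otimes{}_LA$, $$S^{-1}(a_{(2)})_{(1')}\otimes S^{-1}(a_{(2)})_{(2')}a_{(1)}=S^{-1}(a)\otimes1_A,\qquad S(a_{(1)})_{(1')}a_{(2)}\otimes S(a_{(1)})_{(2')}=1_A\otimes S(a).$$ (ii) $\mathcal A_L=(A,L,s_L,t_L,\gamma_L,\pi_L)$ is a left bialgebroid and $S$ is an anti-automorphism of the total ring $A$ satisfying $S\circ t_L=s_L$, $\ S(a_{(1)})a_{(2)}=t_L\circ\pi_L\circ S(a)$ for all $a\in A$, and $$S_{A\otimes_LA}\circ\gamma_L\circ S^{-1}=S_{A\otimes_RA}^{-1}\circ\gamma_L\circ S,$$ $$(\gamma_L\otimes\mathrm{id}_A)\circ\gamma_R=(\mathrm{id}_A\otimes\gamma_R)\circ\gamma_L,\qquad(\gamma_R\otimes\mathrm{id}_A)\circ\gamma_L=(\mathrm{id}_A\otimes\gamma_L)\circ\gamma_R,$$ where the ring $R$, the $R$-$R$-bimodule ${}^RA^R$ and the maps $S_{A\otimes_LA}$, $S_{A\otimes_RA}$ are those described in the context under "Notation for (ii)", and $\gamma_R:=S_{A\otimes_LA}\circ\gamma_L\circ S^{-1}\equiv S_{A\otimes_RA}^{-1}\circ\gamma_L\circ S:A\to A^R\otimes{}^RA$.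 The last two equations are equalities of maps $A\to A_L\otimes{}_LA^R\otimes{}^RA$ and $A\to A^R\otimes{}^RA_L\otimes{}_LA$, respectively. (iii) $\mathcal A_L=(A,L,s_L,t_L,\gamma_L,\pi_L)$ is a left bialgebroid and $\mathcal A_R=(A,R,s_R,t_R,\gamma_R,\pi_R)$ is a right bialgebroid such that the base rings are related to each other via $R\simeq L^{op}$. $S$ is a bijection of additive groups, and (a) $s_L(L)=t_R(R)$ and $t_L(L)=s_R(R)$ as subrings of $A$; (b) $(\gamma_L\otimes\mathrm{id}_A)\circ\gamma_R=(\mathrm{id}_A\otimes\gamma_R)\circ\gamma_L$ and $(\gamma_R\otimes\mathrm{id}_A)\circ\gamma_L=(\mathrm{id}_A\otimes\gamma_L)\circ\gamma_R$; (c) $S(t_L(l)\,a\,t_L(l'))=s_L(l')S(a)s_L(l)$ and $S(t_R(r')\,a\,t_R(r))=s_R(r)S(a)s_R(r')$; (d) $S(a_{(1)})a_{(2)}=s_R\circ\pi_R(a)$ and $a^{(1)}S(a^{(2)})=s_L\circ\pi_L(a)$ hold true for all $l,l'\in L$, $r,r'\in R$ and $a\in A$. (iv) $\mathcal A_L$ is a left bialgebroid over $L$ and $\mathcal A_R$ is a right bialgebroid over $R$ (on the same total ring $A$) such that the base rings are related to each other via $R\simeq L^{op}$ and the equations (a) and (b) of (iii) hold true. Furthermore the maps of additive groups $$\alpha:A^R\otimes{}_RA\to A_L\otimes{}_LA,\ \ a\otimes b\mapsto a_{(1)}\otimes a_{(2)}b\qquad\text{and}\qquad\beta:A_R\otimes{}^RA\to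 A_L\otimes{}_LA,\ \ a\otimes b\mapsto b_{(1)}a\otimes b_{(2)}$$ are bijective.
   Context: All rings are associative and unital. A left bialgebroid $\mathcal A_L=(A,L,s_L,t_L,\gamma_L,\pi_L)$ consists of rings $A$ (total) and $L$ (base), ring homomorphisms $s_L:L\to A$, $t_L:L^{op}\to A$ with commuting images, making $A$ an $L$-$L$-bimodule via $l\cdot a\cdot l'=s_L(l)t_L(l')a$ (its left and right $L$-modules are denoted ${}_LA$ and $A_L$), and bimodule maps $\gamma_L:A\to A_L\otimes{}_LA$, $\gamma_L(a)=a_{(1)}\otimes a_{(2)}$, and $\pi_L:A\to L$ making $A$ a comonoid in the category of $L$-$L$-bimodules, such that $a_{(1)}t_L(l)\otimes a_{(2)}=a_{(1)}\otimes a_{(2)}s_L(l)$, $\gamma_L(1_A)=1_A\otimes1_A$, $\gamma_L(ab)=\gamma_L(a)\gamma_L(b)$, $\pi_L(1_A)=1_L$, $\pi_L(as_L(\pi_L(b)))=\pi_L(ab)=\pi_L(at_L(\pi_L(b)))$ for all $l\in L$, $a,b\in A$. A right bialgebroid $\mathcal A_R=(A,R,s_R,t_R,\gamma_R,\pi_R)$ consists of rings $A$, $R$, ring homomorphisms $s_R:R\to A$, $t_R:R^{op}\to A$ with commuting images, making $A$ an $R$-$R$-bimodule ${}^RA^R$ via $r\cdot a\cdot r'=as_R(r')t_R(r)$ (left and right modules denoted ${}^RA$, $A^R$), and bimodule maps $\gamma_R:A\to A^R\otimes{}^RA$, $\gamma_R(a)=a^{(1)}\otimes a^{(2)}$, $\pi_R:A\to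 R$ making $A$ a comonoid in the category of $R$-$R$-bimodules, such that $s_R(r)a^{(1)}\otimes a^{(2)}=a^{(1)}\otimes t_R(r)a^{(2)}$, $\gamma_R(1_A)=1_A\otimes1_A$, $\gamma_R(ab)=\gamma_R(a)\gamma_R(b)$, $\pi_R(1_A)=1_R$, $\pi_R(s_R(\pi_R(a))b)=\pi_R(ab)=\pi_R(t_R(\pi_R(a))b)$ for all $r\in R$, $a,b\in A$. In addition ${}_RA_R$ denotes $A$ with the $R$-$R$-bimodule structure $r\cdot a\cdot r'=s_R(r)t_R(r')a$ (left and right modules ${}_RA$, $A_R$). Marks on the factors of a tensor product indicate the module structures over which the tensor product is taken. Primed Sweedler indices, as in $S(a_{(1)})_{(1')}\otimes S(a_{(1)})_{(2')}$, denote a further application of $\gamma_L$. Notation for (ii): put $\theta_L:=\pi_L\circ S\circ s_L:L\to L$. By $S(a_{(1)})a_{(2)}=t_L\circ\pi_L\circ S(a)$ it satisfies $t_L\circ\theta_L=S\circ s_L$ and $\theta_L(l)\theta_L(l')=\theta_L(ll')$. $R$ is a ring isomorphic to $L^{op}$, $\mu:L^{op}\to R$ is a fixed isomorphism, and ${}^RA^R$ is $A$ with the $R$-$R$-bimodule structure $r\cdot a\cdot r'=a\,s_L(\theta_L^{-1}(\mu^{-1}(r)))\,t_L(\mu^{-1}(r'))$. The maps $S_{A\otimes_LA}:A_L\otimes{}_LA\to A^R\otimes{}^RA$ and $S_{A\otimes_RA}:A^R\otimes{}^RA\to A_L\otimes{}_LA$ are both given by $a\otimes b\mapsto S(b)\otimes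 S(a)$. *)

theory Defs
  imports "HOL-Library.Poly_Mapping" "HOL-Library.Set_Algebras"
begin

text \<open>
  Rings are types of sort \<open>{ring, monoid_mult}\<close>: associative and unital, not necessarily
  commutative, and, unlike for \<open>ring_1\<close>, the zero ring is allowed.
\<close>

definition ring_map :: "('a::{ring,monoid_mult} \<Rightarrow> 'b::{ring,monoid_mult}) \<Rightarrow> bool" where
  "ring_map f \<longleftrightarrow>
     (\<forall>x y. f (x + y) = f x + f y) \<and> (\<forall>x y. f (x * y) = f x * f y) \<and> f 1 = 1"

text \<open>Ring homomorphisms from the opposite ring.\<close>

definition ring_antimap :: "('a::{ring,monoid_mult} \<Rightarrow> 'b::{ring,monoid_mult}) \<Rightarrow> bool" where
  "ring_antimap f \<longleftrightarrow>
     (\<forall>x y. f (x + y) = f x + f y) \<and> (\<forall>x y. f (x * y) = f y * f x) \<and> f 1 = 1"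


section \<open>Tensor products over noncommutative rings\<close>

text \<open>
  The tensor product of a right module and a left module over a ring \<open>'k\<close> is the quotient of the
  free abelian group \<open>('m \<times> 'n) \<Rightarrow>\<^sub>0 int\<close> by the subgroup
  generated by the usual relations.  Its elements are cosets \<open>x +o N\<close> of that
  subgroup \<open>N\<close>, and the addition of cosets is that of \<open>Set_Algebras\<close>.
  Unbracketed threefold tensor products are formed in the same way from triples.
\<close>

inductive_set subgroup_gen :: "'g::ab_group_add set \<Rightarrow> 'g set" for X where
  zero: "0 \<in> subgroup_gen X"
| gen: "x \<in> X \<Longrightarrow> x \<in> subgroup_gen X"
| diff: "x \<in> subgroup_gen X \<Longrightarrow> y \<in> subgroup_gen X \<Longrightarrow> x - y \<in> subgroup_gen X"

definition tens2 ::
  "('m::ab_group_add \<Rightarrow> 'k \<Rightarrow> 'm) \<Rightarrow> ('k \<Rightarrow> 'n::ab_group_add \<Rightarrow> 'n) \<Rightarrow> (('m \<times> 'n) \<Rightarrow>\<^sub>0 int) set" where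
  "tens2 ra la = subgroup_gen
     ({frag_of (m + m', n) - frag_of (m, n) - frag_of (m', n) | m m' n. True} \<union>
      {frag_of (m, n + n') - frag_of (m, n) - frag_of (m, n') | m n n'. True} \<union>
      {frag_of (ra m k, n) - frag_of (m, la k n) | m k n. True})"

definition tens3 ::
  "('m::ab_group_add \<Rightarrow> 'k \<Rightarrow> 'm) \<Rightarrow> ('k \<Rightarrow> 'n::ab_group_add \<Rightarrow> 'n) \<Rightarrow>
   ('n \<Rightarrow> 'h \<Rightarrow> 'n) \<Rightarrow> ('h \<Rightarrow> 'p::ab_group_add \<Rightarrow> 'p) \<Rightarrow> (('m \<times> 'n \<times> 'p) \<Rightarrow>\<^sub>0 int) set" where
  "tens3 ra la ra' la' = subgroup_gen
     ({frag_of (m + m', n, p) - frag_of (m, n, p) - frag_of (m', n, p) | m m' n p. True} \<union>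
      {frag_of (m, n + n', p) - frag_of (m, n, p) - frag_of (m, n', p) | m n n' p. True} \<union>
      {frag_of (m, n, p + p') - frag_of (m, n, p) - frag_of (m, n, p') | m n p p'. True} \<union>
      {frag_of (ra m k, n, p) - frag_of (m, la k n, p) | m k n p. True} \<union>
      {frag_of (m, ra' n h, p) - frag_of (m, n, la' h p) | m n h p. True})"

definition tensor :: "('g \<Rightarrow>\<^sub>0 int) set \<Rightarrow> ('g \<Rightarrow>\<^sub>0 int) set set" where
  "tensor N = range (\<lambda>x. x +o N)"

text \<open>
  Sweedler notation: \<open>rep t\<close> is a formal sum of elementary tensors representing \<open>t\<close>.
  \<open>tmap N f\<close> is the map from a tensor product into the tensor product with relation
  subgroup \<open>N\<close> that is induced by \<open>f\<close> on elementary tensors, and \<open>tval f\<close> is the analogous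
  induced map into an abelian group.  They are independent of the chosen
  representatives whenever \<open>f\<close> is compatible with the tensor relations.
\<close>

definition rep :: "('g \<Rightarrow>\<^sub>0 int) set \<Rightarrow> ('g \<Rightarrow>\<^sub>0 int)" where
  "rep t = (SOME x. x \<in> t)"

definition tmap ::
  "('h \<Rightarrow>\<^sub>0 int) set \<Rightarrow> ('g \<Rightarrow> ('h \<Rightarrow>\<^sub>0 int)) \<Rightarrow> ('g \<Rightarrow>\<^sub>0 int) set \<Rightarrow> ('h \<Rightarrow>\<^sub>0 int) set" where
  "tmap N f t = frag_extend f (rep t) +o N"

definition int_mult :: "int \<Rightarrow> 'b::ab_group_add \<Rightarrow> 'b" where
  "int_mult n x = (\<Sum>i<nat n. x) - (\<Sum>i<nat (- n). x)"

definition tval :: "('g \<Rightarrow> 'b::ab_group_add) \<Rightarrow> ('g \<Rightarrow>\<^sub>0 int) set \<Rightarrow> 'b" where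
  "tval f t = (\<Sum>g\<in>Poly_Mapping.keys (rep t). int_mult (Poly_Mapping.lookup (rep t) g) (f g))"

definition tmap_left ::
  "(('a \<times> 'b \<times> 'c) \<Rightarrow>\<^sub>0 int) set \<Rightarrow> ('d \<Rightarrow> (('a \<times> 'b) \<Rightarrow>\<^sub>0 int) set) \<Rightarrow>
   (('d \<times> 'c) \<Rightarrow>\<^sub>0 int) set \<Rightarrow> (('a \<times> 'b \<times> 'c) \<Rightarrow>\<^sub>0 int) set" where \<comment> \<open>\<open>\<gamma> \<otimes> id\<close>\<close>
  "tmap_left N \<gamma> = tmap N (\<lambda>(x, y). frag_extend (\<lambda>(u, v). frag_of (u, v, y)) (rep (\<gamma> x)))"

definition tmap_right ::
  "(('a \<times> 'b \<times> 'c) \<Rightarrow>\<^sub>0 int) set \<Rightarrow> ('d \<Rightarrow> (('b \<times> 'c) \<Rightarrow>\<^sub>0 int) set) \<Rightarrow>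
   (('a \<times> 'd) \<Rightarrow>\<^sub>0 int) set \<Rightarrow> (('a \<times> 'b \<times> 'c) \<Rightarrow>\<^sub>0 int) set" where \<comment> \<open>\<open>id \<otimes> \<gamma>\<close>\<close>
  "tmap_right N \<gamma> = tmap N (\<lambda>(x, y). frag_extend (\<lambda>(u, v). frag_of (x, u, v)) (rep (\<gamma> y)))"

text \<open>The factorwise product, well defined when the left factor lies in the Takeuchi product.\<close>

definition tprod ::
  "(('a \<times> 'a) \<Rightarrow>\<^sub>0 int) set \<Rightarrow> (('a::times \<times> 'a) \<Rightarrow>\<^sub>0 int) set \<Rightarrow> (('a \<times> 'a) \<Rightarrow>\<^sub>0 int) set \<Rightarrow>
   (('a \<times> 'a) \<Rightarrow>\<^sub>0 int) set" where
  "tprod N t t' =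
     tmap N (\<lambda>(x, y). frag_extend (\<lambda>(u, v). frag_of (x * u, y * v)) (rep t')) t"


section \<open>Bialgebroids\<close>

text \<open>Module structures on a total ring obtained by multiplication with images of base ring elements.\<close>

definition left_by_left :: "('k \<Rightarrow> 'a::times) \<Rightarrow> 'k \<Rightarrow> 'a \<Rightarrow> 'a" where
  "left_by_left f k a = f k * a"

definition right_by_left :: "('k \<Rightarrow> 'a::times) \<Rightarrow> 'a \<Rightarrow> 'k \<Rightarrow> 'a" where
  "right_by_left f a k = f k * a"

definition left_by_right :: "('k \<Rightarrow> 'a::times) \<Rightarrow> 'k \<Rightarrow> 'a \<Rightarrow> 'a" where
  "left_by_right f k a = a * f k"

definition right_by_right :: "('k \<Rightarrow> 'a::times) \<Rightarrow> 'a \<Rightarrow> 'k \<Rightarrow> 'a" where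
  "right_by_right f a k = a * f k"

text \<open>
  With \<open>s = s\<^sub>L\<close> and \<open>t = t\<^sub>L\<close>, the modules \<open>\<^sub>LA\<close> and \<open>A\<^sub>L\<close> are
  \<open>left_by_left s\<close> and \<open>right_by_left t\<close>; with \<open>s = s\<^sub>R\<close> and \<open>t = t\<^sub>R\<close>, the modules
  \<open>\<^sup>RA\<close> and \<open>A\<^sup>R\<close> are \<open>left_by_right t\<close> and \<open>right_by_right s\<close>.
\<close>

definition LL :: "('l \<Rightarrow> 'a) \<Rightarrow> ('l \<Rightarrow> 'a) \<Rightarrow> (('a::{ring,monoid_mult} \<times> 'a) \<Rightarrow>\<^sub>0 int) set"
  where \<comment> \<open>\<open>A\<^sub>L \<otimes> \<^sub>LA\<close>\<close>
  "LL sL tL = tens2 (right_by_left tL) (left_by_left sL)"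

definition RR :: "('r \<Rightarrow> 'a) \<Rightarrow> ('r \<Rightarrow> 'a) \<Rightarrow> (('a::{ring,monoid_mult} \<times> 'a) \<Rightarrow>\<^sub>0 int) set"
  where \<comment> \<open>\<open>A\<^sup>R \<otimes> \<^sup>RA\<close>\<close>
  "RR sR tR = tens2 (right_by_right sR) (left_by_right tR)"

definition LLLL :: "('l \<Rightarrow> 'a) \<Rightarrow> ('l \<Rightarrow> 'a) \<Rightarrow> (('a::{ring,monoid_mult} \<times> 'a \<times> 'a) \<Rightarrow>\<^sub>0 int) set"
  where \<comment> \<open>\<open>A\<^sub>L \<otimes> \<^sub>LA\<^sub>L \<otimes> \<^sub>LA\<close>\<close>
  "LLLL sL tL =
     tens3 (right_by_left tL) (left_by_left sL) (right_by_left tL) (left_by_left sL)"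

definition RRRR :: "('r \<Rightarrow> 'a) \<Rightarrow> ('r \<Rightarrow> 'a) \<Rightarrow> (('a::{ring,monoid_mult} \<times> 'a \<times> 'a) \<Rightarrow>\<^sub>0 int) set"
  where \<comment> \<open>\<open>A\<^sup>R \<otimes> \<^sup>RA\<^sup>R \<otimes> \<^sup>RA\<close>\<close>
  "RRRR sR tR =
     tens3 (right_by_right sR) (left_by_right tR) (right_by_right sR) (left_by_right tR)"

definition LLRR ::
  "('l \<Rightarrow> 'a) \<Rightarrow> ('l \<Rightarrow> 'a) \<Rightarrow> ('r \<Rightarrow> 'a) \<Rightarrow> ('r \<Rightarrow> 'a) \<Rightarrow>
   (('a::{ring,monoid_mult} \<times> 'a \<times> 'a) \<Rightarrow>\<^sub>0 int) set"
  where \<comment> \<open>\<open>A\<^sub>L \<otimes> \<^sub>LA\<^sup>R \<otimes> \<^sup>RA\<close>\<close>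
  "LLRR sL tL sR tR =
     tens3 (right_by_left tL) (left_by_left sL) (right_by_right sR) (left_by_right tR)"

definition RRLL ::
  "('l \<Rightarrow> 'a) \<Rightarrow> ('l \<Rightarrow> 'a) \<Rightarrow> ('r \<Rightarrow> 'a) \<Rightarrow> ('r \<Rightarrow> 'a) \<Rightarrow>
   (('a::{ring,monoid_mult} \<times> 'a \<times> 'a) \<Rightarrow>\<^sub>0 int) set"
  where \<comment> \<open>\<open>A\<^sup>R \<otimes> \<^sup>RA\<^sub>L \<otimes> \<^sub>LA\<close>\<close>
  "RRLL sL tL sR tR =
     tens3 (right_by_right sR) (left_by_right tR) (right_by_left tL) (left_by_left sL)"

locale left_bialgebroid =
  fixes s t :: "'l::{ring,monoid_mult} \<Rightarrow> 'a::{ring,monoid_mult}"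
    and \<gamma> :: "'a \<Rightarrow> (('a \<times> 'a) \<Rightarrow>\<^sub>0 int) set"
    and \<pi> :: "'a \<Rightarrow> 'l"
  assumes source: "ring_map s"
    and target: "ring_antimap t"
    and commute: "s l * t l' = t l' * s l"
    and comult_in: "\<gamma> a \<in> tensor (LL s t)"
    and comult_add: "\<gamma> (a + b) = \<gamma> a + \<gamma> b"
    and comult_bimod:
      "\<gamma> (s l * t l' * a) = tmap (LL s t) (\<lambda>(x, y). frag_of (s l * x, t l' * y)) (\<gamma> a)"
    and counit_add: "\<pi> (a + b) = \<pi> a + \<pi> b"
    and counit_bimod: "\<pi> (s l * t l' * a) = l * \<pi> a * l'"
    and coassoc: "tmap_left (LLLL s t) \<gamma> (\<gamma> a) = tmap_right (LLLL s t) \<gamma> (\<gamma> a)"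
    and counit_left: "tval (\<lambda>(x, y). s (\<pi> x) * y) (\<gamma> a) = a"
    and counit_right: "tval (\<lambda>(x, y). t (\<pi> y) * x) (\<gamma> a) = a"
    and takeuchi:
      "tmap (LL s t) (\<lambda>(x, y). frag_of (x * t l, y)) (\<gamma> a)
       = tmap (LL s t) (\<lambda>(x, y). frag_of (x, y * s l)) (\<gamma> a)"
    and comult_one: "\<gamma> 1 = frag_of (1, 1) +o LL s t"
    and comult_mult: "\<gamma> (a * b) = tprod (LL s t) (\<gamma> a) (\<gamma> b)"
    and counit_one: "\<pi> 1 = 1"
    and counit_source: "\<pi> (a * s (\<pi> b)) = \<pi> (a * b)"
    and counit_target: "\<pi> (a * t (\<pi> b)) = \<pi> (a * b)"

locale right_bialgebroid =
  fixes s t :: "'r::{ring,monoid_mult} \<Rightarrow> 'a::{ring,monoid_mult}"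
    and \<gamma> :: "'a \<Rightarrow> (('a \<times> 'a) \<Rightarrow>\<^sub>0 int) set"
    and \<pi> :: "'a \<Rightarrow> 'r"
  assumes source: "ring_map s"
    and target: "ring_antimap t"
    and commute: "s r * t r' = t r' * s r"
    and comult_in: "\<gamma> a \<in> tensor (RR s t)"
    and comult_add: "\<gamma> (a + b) = \<gamma> a + \<gamma> b"
    and comult_bimod:
      "\<gamma> (a * s r' * t r) = tmap (RR s t) (\<lambda>(x, y). frag_of (x * t r, y * s r')) (\<gamma> a)"
    and counit_add: "\<pi> (a + b) = \<pi> a + \<pi> b"
    and counit_bimod: "\<pi> (a * s r' * t r) = r * \<pi> a * r'"
    and coassoc: "tmap_left (RRRR s t) \<gamma> (\<gamma> a) = tmap_right (RRRR s t) \<gamma> (\<gamma> a)"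
    and counit_left: "tval (\<lambda>(x, y). y * t (\<pi> x)) (\<gamma> a) = a"
    and counit_right: "tval (\<lambda>(x, y). x * s (\<pi> y)) (\<gamma> a) = a"
    and takeuchi:
      "tmap (RR s t) (\<lambda>(x, y). frag_of (s r * x, y)) (\<gamma> a)
       = tmap (RR s t) (\<lambda>(x, y). frag_of (x, t r * y)) (\<gamma> a)"
    and comult_one: "\<gamma> 1 = frag_of (1, 1) +o RR s t"
    and comult_mult: "\<gamma> (a * b) = tprod (RR s t) (\<gamma> a) (\<gamma> b)"
    and counit_one: "\<pi> 1 = 1"
    and counit_source: "\<pi> (s (\<pi> a) * b) = \<pi> (a * b)"
    and counit_target: "\<pi> (t (\<pi> a) * b) = \<pi> (a * b)"


section \<open>The four descriptions of a Hopf algebroid\<close>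

definition hopf_algebroid ::
  "('l::{ring,monoid_mult} \<Rightarrow> 'a::{ring,monoid_mult}) \<Rightarrow> ('l \<Rightarrow> 'a) \<Rightarrow>
   ('a \<Rightarrow> (('a \<times> 'a) \<Rightarrow>\<^sub>0 int) set) \<Rightarrow> ('a \<Rightarrow> 'l) \<Rightarrow> ('a \<Rightarrow> 'a) \<Rightarrow> bool" where
  "hopf_algebroid sL tL \<gamma>L \<pi>L S \<longleftrightarrow>
     left_bialgebroid sL tL \<gamma>L \<pi>L \<and>
     bij S \<and> ring_antimap S \<and>
     S \<circ> tL = sL \<and>
     (\<forall>a. tmap (LL sL tL)
            (\<lambda>(x, y). frag_extend (\<lambda>(u, v). frag_of (u, v * x)) (rep (\<gamma>L (inv S y)))) (\<gamma>L a)
          = frag_of (inv S a, 1) +o LL sL tL) \<and>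
     (\<forall>a. tmap (LL sL tL)
            (\<lambda>(x, y). frag_extend (\<lambda>(u, v). frag_of (u * y, v)) (rep (\<gamma>L (S x)))) (\<gamma>L a)
          = frag_of (1, S a) +o LL sL tL)"

text \<open>Mixed coassociativity.\<close>

definition comults_compatible ::
  "('l \<Rightarrow> 'a) \<Rightarrow> ('l \<Rightarrow> 'a) \<Rightarrow> ('a::{ring,monoid_mult} \<Rightarrow> (('a \<times> 'a) \<Rightarrow>\<^sub>0 int) set) \<Rightarrow>
   ('r \<Rightarrow> 'a) \<Rightarrow> ('r \<Rightarrow> 'a) \<Rightarrow> ('a \<Rightarrow> (('a \<times> 'a) \<Rightarrow>\<^sub>0 int) set) \<Rightarrow> bool" where
  "comults_compatible sL tL \<gamma>L sR tR \<gamma>R \<longleftrightarrow>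
     tmap_left (LLRR sL tL sR tR) \<gamma>L \<circ> \<gamma>R = tmap_right (LLRR sL tL sR tR) \<gamma>R \<circ> \<gamma>L \<and>
     tmap_left (RRLL sL tL sR tR) \<gamma>R \<circ> \<gamma>L = tmap_right (RRLL sL tL sR tR) \<gamma>L \<circ> \<gamma>R"

definition swap_antipode ::
  "(('a \<times> 'a) \<Rightarrow>\<^sub>0 int) set \<Rightarrow> ('a \<Rightarrow> 'a) \<Rightarrow> (('a \<times> 'a) \<Rightarrow>\<^sub>0 int) set \<Rightarrow> (('a \<times> 'a) \<Rightarrow>\<^sub>0 int) set"
  where
  "swap_antipode N S = tmap N (\<lambda>(x, y). frag_of (S y, S x))"

text \<open>
  The bimodule \<open>\<^sup>RA\<^sup>R\<close> below is the one obtained from the maps \<open>sR\<close> and \<open>tR\<close> in the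
  let-bindings.  That \<open>\<theta>\<close> is bijective is a presupposition of the notation \<open>\<theta>\<^sup>-\<^sup>1\<close>, and it
  is stated explicitly because \<open>inv\<close> is total; without it \<open>SR\<close> would not be well defined.  \<open>SL\<close> and \<open>SR\<close> are the maps
  \<open>A\<^sub>L \<otimes> \<^sub>LA \<rightarrow> A\<^sup>R \<otimes> \<^sup>RA\<close> and \<open>A\<^sup>R \<otimes> \<^sup>RA \<rightarrow> A\<^sub>L \<otimes> \<^sub>LA\<close>.
\<close>

definition hopf_via_twist ::
  "('l::{ring,monoid_mult} \<Rightarrow> 'a::{ring,monoid_mult}) \<Rightarrow> ('l \<Rightarrow> 'a) \<Rightarrow>
   ('a \<Rightarrow> (('a \<times> 'a) \<Rightarrow>\<^sub>0 int) set) \<Rightarrow> ('a \<Rightarrow> 'l) \<Rightarrow> ('l \<Rightarrow> 'r) \<Rightarrow> ('a \<Rightarrow> 'a) \<Rightarrow> bool" where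
  "hopf_via_twist sL tL \<gamma>L \<pi>L \<mu> S \<longleftrightarrow>
     left_bialgebroid sL tL \<gamma>L \<pi>L \<and>
     bij S \<and> ring_antimap S \<and>
     S \<circ> tL = sL \<and>
     (\<forall>a. tval (\<lambda>(x, y). S x * y) (\<gamma>L a) = tL (\<pi>L (S a))) \<and>
     (let \<theta> = \<pi>L \<circ> S \<circ> sL;
          sR = tL \<circ> inv \<mu>;
          tR = sL \<circ> inv \<theta> \<circ> inv \<mu>;
          SL = swap_antipode (RR sR tR) S;
          SR = swap_antipode (LL sL tL) S;
          \<gamma>R = SL \<circ> \<gamma>L \<circ> inv S
      in bij \<theta> \<and>
         SL \<circ> \<gamma>L \<circ> inv S = inv_into (tensor (RR sR tR)) SR \<circ> \<gamma>L \<circ> S \<and>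
         comults_compatible sL tL \<gamma>L sR tR \<gamma>R)"

definition base_opposite :: "('l::{ring,monoid_mult} \<Rightarrow> 'r::{ring,monoid_mult}) \<Rightarrow> bool" where
  "base_opposite \<mu> \<longleftrightarrow> bij \<mu> \<and> ring_antimap \<mu>"

definition paired_bialgebroids ::
  "('l::{ring,monoid_mult} \<Rightarrow> 'a::{ring,monoid_mult}) \<Rightarrow> ('l \<Rightarrow> 'a) \<Rightarrow>
   ('a \<Rightarrow> (('a \<times> 'a) \<Rightarrow>\<^sub>0 int) set) \<Rightarrow> ('a \<Rightarrow> 'l) \<Rightarrow>
   ('r::{ring,monoid_mult} \<Rightarrow> 'a) \<Rightarrow> ('r \<Rightarrow> 'a) \<Rightarrow>
   ('a \<Rightarrow> (('a \<times> 'a) \<Rightarrow>\<^sub>0 int) set) \<Rightarrow> ('a \<Rightarrow> 'r) \<Rightarrow> bool" where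
  "paired_bialgebroids sL tL \<gamma>L \<pi>L sR tR \<gamma>R \<pi>R \<longleftrightarrow>
     left_bialgebroid sL tL \<gamma>L \<pi>L \<and>
     right_bialgebroid sR tR \<gamma>R \<pi>R \<and>
     (\<exists>\<nu> :: 'l \<Rightarrow> 'r. base_opposite \<nu>) \<and>
     range sL = range tR \<and> range tL = range sR \<and>
     comults_compatible sL tL \<gamma>L sR tR \<gamma>R"

definition hopf_via_pair ::
  "('l::{ring,monoid_mult} \<Rightarrow> 'a::{ring,monoid_mult}) \<Rightarrow> ('l \<Rightarrow> 'a) \<Rightarrow>
   ('a \<Rightarrow> (('a \<times> 'a) \<Rightarrow>\<^sub>0 int) set) \<Rightarrow> ('a \<Rightarrow> 'l) \<Rightarrow>
   ('r::{ring,monoid_mult} \<Rightarrow> 'a) \<Rightarrow> ('r \<Rightarrow> 'a) \<Rightarrow>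
   ('a \<Rightarrow> (('a \<times> 'a) \<Rightarrow>\<^sub>0 int) set) \<Rightarrow> ('a \<Rightarrow> 'r) \<Rightarrow> ('a \<Rightarrow> 'a) \<Rightarrow> bool" where
  "hopf_via_pair sL tL \<gamma>L \<pi>L sR tR \<gamma>R \<pi>R S \<longleftrightarrow>
     paired_bialgebroids sL tL \<gamma>L \<pi>L sR tR \<gamma>R \<pi>R \<and>
     bij S \<and> (\<forall>a b. S (a + b) = S a + S b) \<and>
     (\<forall>l l' a. S (tL l * a * tL l') = sL l' * S a * sL l) \<and>
     (\<forall>r r' a. S (tR r' * a * tR r) = sR r * S a * sR r') \<and>
     (\<forall>a. tval (\<lambda>(x, y). S x * y) (\<gamma>L a) = sR (\<pi>R a)) \<and>
     (\<forall>a. tval (\<lambda>(x, y). x * S y) (\<gamma>R a) = sL (\<pi>L a))"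

definition galois_alpha ::
  "('l \<Rightarrow> 'a) \<Rightarrow> ('l \<Rightarrow> 'a) \<Rightarrow> ('a \<Rightarrow> (('a::{ring,monoid_mult} \<times> 'a) \<Rightarrow>\<^sub>0 int) set) \<Rightarrow>
   (('a \<times> 'a) \<Rightarrow>\<^sub>0 int) set \<Rightarrow> (('a \<times> 'a) \<Rightarrow>\<^sub>0 int) set" where
  "galois_alpha sL tL \<gamma>L =
     tmap (LL sL tL) (\<lambda>(a, b). frag_extend (\<lambda>(u, v). frag_of (u, v * b)) (rep (\<gamma>L a)))"

definition galois_beta ::
  "('l \<Rightarrow> 'a) \<Rightarrow> ('l \<Rightarrow> 'a) \<Rightarrow> ('a \<Rightarrow> (('a::{ring,monoid_mult} \<times> 'a) \<Rightarrow>\<^sub>0 int) set) \<Rightarrow>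
   (('a \<times> 'a) \<Rightarrow>\<^sub>0 int) set \<Rightarrow> (('a \<times> 'a) \<Rightarrow>\<^sub>0 int) set" where
  "galois_beta sL tL \<gamma>L =
     tmap (LL sL tL) (\<lambda>(a, b). frag_extend (\<lambda>(u, v). frag_of (u * a, v)) (rep (\<gamma>L b)))"

text \<open>
  The domains of the two Galois maps are \<open>A\<^sup>R \<otimes> \<^sub>RA\<close> and \<open>A\<^sub>R \<otimes> \<^sup>RA\<close>, where
  \<open>\<^sub>RA\<^sub>R\<close> carries the bimodule structure \<open>r \<cdot> a \<cdot> r' = sR r * tR r' * a\<close>.
\<close>

definition galois_pair ::
  "('l::{ring,monoid_mult} \<Rightarrow> 'a::{ring,monoid_mult}) \<Rightarrow> ('l \<Rightarrow> 'a) \<Rightarrow>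
   ('a \<Rightarrow> (('a \<times> 'a) \<Rightarrow>\<^sub>0 int) set) \<Rightarrow> ('a \<Rightarrow> 'l) \<Rightarrow>
   ('r::{ring,monoid_mult} \<Rightarrow> 'a) \<Rightarrow> ('r \<Rightarrow> 'a) \<Rightarrow>
   ('a \<Rightarrow> (('a \<times> 'a) \<Rightarrow>\<^sub>0 int) set) \<Rightarrow> ('a \<Rightarrow> 'r) \<Rightarrow> bool" where
  "galois_pair sL tL \<gamma>L \<pi>L sR tR \<gamma>R \<pi>R \<longleftrightarrow>
     paired_bialgebroids sL tL \<gamma>L \<pi>L sR tR \<gamma>R \<pi>R \<and>
     bij_betw (galois_alpha sL tL \<gamma>L)
       (tensor (tens2 (right_by_right sR) (left_by_left sR))) (tensor (LL sL tL)) \<and>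
     bij_betw (galois_beta sL tL \<gamma>L)
       (tensor (tens2 (right_by_left tR) (left_by_right tR))) (tensor (LL sL tL))"

end

theory Submission
  imports Defs "HOL.Modules"
begin

text \<open>
  Every condition is tested on balanced maps \<open>f\<close>, that is, written as an identity between
  Sweedler sums \<open>\<Sum> f a\<^sub>1 a\<^sub>2\<close>.  With upper indices for \<open>\<gamma>\<^sub>R\<close>, the implications rest on the
  following computations.

  (iii) to (i): \<open>S\<close> is antimultiplicative, because
  \<open>S(a\<^sub>1b\<^sub>1) a\<^sub>2\<^sup>1 b\<^sub>2\<^sup>1 S(b\<^sub>2\<^sup>2) S(a\<^sub>2\<^sup>2)\<close> equals \<open>S(ab)\<close> as it stands and \<open>S(b)S(a)\<close> after mixed
  coassociativity.  The two axioms of (i) follow by writing \<open>a \<otimes> 1\<close> as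
  \<open>\<gamma>\<^sub>L(a\<^sup>1)(1 \<otimes> S(a\<^sup>2))\<close> and \<open>1 \<otimes> a\<close> as \<open>\<gamma>\<^sub>L(a\<^sup>2)(S\<^sup>-\<^sup>1(a\<^sup>1) \<otimes> 1)\<close>, which also says that \<open>\<alpha>\<close> and \<open>\<beta>\<close>
  are inverted by \<open>a \<otimes> b \<mapsto> a\<^sup>1 \<otimes> S(a\<^sup>2)b\<close> and \<open>a \<otimes> b \<mapsto> S\<^sup>-\<^sup>1(b\<^sup>1)a \<otimes> b\<^sup>2\<close>.

  (iv) to (iii): \<open>S(a)\<close> is the image of \<open>\<alpha>\<^sup>-\<^sup>1(a \<otimes> 1)\<close> under \<open>x \<otimes> y \<mapsto> s\<^sub>R(\<pi>\<^sub>R(x))y\<close>, and its inverse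
  comes from \<open>\<beta>\<^sup>-\<^sup>1(1 \<otimes> a)\<close> in the same way.

  (i) to (ii): the two axioms of (i) say how \<open>\<alpha>\<close> is inverted by
  \<open>\<gamma>' = (S\<^sup>-\<^sup>1 \<otimes> S\<^sup>-\<^sup>1)\<gamma>\<^sub>L\<^sup>o\<^sup>pS\<close> and \<open>\<beta>\<close> by \<open>\<gamma>\<^sub>R = (S \<otimes> S)\<gamma>\<^sub>L\<^sup>o\<^sup>pS\<^sup>-\<^sup>1\<close>.  Coassociativity of \<open>\<gamma>\<^sub>L\<close> then
  gives one mixed identity for \<open>\<gamma>\<^sub>R\<close>, which \<open>S\<close> carries over to \<open>\<gamma>'\<close>; with it \<open>\<gamma>'\<close> inverts \<open>\<beta>\<close> as
  well, so that \<open>\<gamma>' = \<gamma>\<^sub>R\<close>.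

  (ii) to (iii): \<open>\<gamma>'\<close> is \<open>\<gamma>\<^sub>L\<close> transported along the anti-automorphism \<open>S\<^sup>-\<^sup>1\<close>.
\<close>

section \<open>Tensor products inside an abelian group\<close>

lemma int_mult_0 [simp]: "int_mult 0 x = 0"
  by (simp add: int_mult_def)

lemma int_mult_1 [simp]: "int_mult 1 x = x"
  by (simp add: int_mult_def)

lemma int_mult_succ: "int_mult (n + 1) x = int_mult n x + x"
proof (cases "n \<ge> 0")
  case True
  then have "nat (n + 1) = Suc (nat n)" "nat (- n) = 0" "nat (- (n + 1)) = 0" by auto
  then show ?thesis by (simp add: int_mult_def)
next
  case False
  then have "nat (- n) = Suc (nat (- (n + 1)))" "nat n = 0" "nat (n + 1) = 0" by auto
  then show ?thesis by (simp add: int_mult_def)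
qed

lemma int_mult_diff: "int_mult (m - n) x = int_mult m x - int_mult n x"
proof -
  have "int_mult (m + n) x = int_mult m x + int_mult n x" for m n
  proof (induction n rule: int_induct[where k = 0])
    case (step1 i)
    then show ?case using int_mult_succ[of "m + i" x] int_mult_succ[of i x] by (simp add: add_ac)
  next
    case (step2 i)
    then show ?case using int_mult_succ[of "m + i - 1" x] int_mult_succ[of "i - 1" x]
      by (simp add: algebra_simps)
  qed simp
  from this[of "m - n" n] show ?thesis by (simp add: algebra_simps)
qed

lemma int_mult_additive:
  assumes "additive h"
  shows "h (int_mult n x) = int_mult n (h x)"
proof -
  interpret additive h by fact
  show ?thesis by (simp add: int_mult_def diff sum)
qed

text \<open>The additive extension of \<open>f\<close> from generators to formal sums. In contrast
  to \<open>frag_extend\<close>, the values may lie in any abelian group, so that balanced maps of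
  every kind can serve as test maps.\<close>

definition frag_sum :: "('g \<Rightarrow> 'b::ab_group_add) \<Rightarrow> ('g \<Rightarrow>\<^sub>0 int) \<Rightarrow> 'b" where
  "frag_sum f x = (\<Sum>g\<in>Poly_Mapping.keys x. int_mult (Poly_Mapping.lookup x g) (f g))"

lemma tval_ext: "tval f t = frag_sum f (rep t)"
  by (simp add: tval_def frag_sum_def)

lemma frag_sum_superset:
  assumes "finite K" "Poly_Mapping.keys x \<subseteq> K"
  shows "frag_sum f x = (\<Sum>g\<in>K. int_mult (Poly_Mapping.lookup x g) (f g))"
  unfolding frag_sum_def using assms by (intro sum.mono_neutral_left) (auto simp: in_keys_iff)

lemma frag_sum_0 [simp]: "frag_sum f 0 = 0"
  by (simp add: frag_sum_def)

lemma frag_sum_frag_of [simp]: "frag_sum f (frag_of g) = f g"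
  by (simp add: frag_sum_def)

lemma frag_sum_diff: "frag_sum f (x - y) = frag_sum f x - frag_sum f y"
proof -
  let ?K = "Poly_Mapping.keys x \<union> Poly_Mapping.keys y"
  have "Poly_Mapping.keys (x - y) \<subseteq> ?K" by (auto simp: in_keys_iff lookup_minus)
  then show ?thesis
    using frag_sum_superset[of ?K x f] frag_sum_superset[of ?K y f] frag_sum_superset[of ?K "x - y" f]
    by (simp add: lookup_minus int_mult_diff sum_subtractf)
qed

lemma frag_sum_add: "frag_sum f (x + y) = frag_sum f x + frag_sum f y"
  using frag_sum_diff[of f "x + y" y] by simp

lemma additive_frag_sum: "additive (frag_sum f)"
  by (simp add: additive_def frag_sum_add)

lemma additive_frag_sum_comp:
  assumes "additive h"
  shows "h (frag_sum f x) = frag_sum (\<lambda>g. h (f g)) x"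
proof -
  interpret additive h by fact
  show ?thesis by (simp add: frag_sum_def sum int_mult_additive[OF assms])
qed

lemma frag_extend_ext: "frag_extend f = frag_sum f"
proof
  fix x
  show "frag_extend f x = frag_sum f x"
    by (rule frag_induction[of x UNIV]) (simp_all add: frag_extend_diff frag_sum_diff)
qed

lemma frag_sum_frag_extend: "frag_sum f (frag_extend h x) = frag_sum (\<lambda>g. frag_sum f (h g)) x"
  by (simp add: frag_extend_ext additive_frag_sum_comp[OF additive_frag_sum])

lemma frag_sum_fun_add: "frag_sum (\<lambda>g. f g + h g) x = frag_sum f x + frag_sum h x"
  by (rule frag_induction[of x UNIV]) (simp_all add: frag_sum_diff)

lemma frag_sum_fun_diff: "frag_sum (\<lambda>g. f g - h g) x = frag_sum f x - frag_sum h x"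
  by (rule frag_induction[of x UNIV]) (simp_all add: frag_sum_diff)

lemma frag_sum_fun_0: "frag_sum (\<lambda>g. 0) x = 0"
  by (rule frag_induction[of x UNIV]) (simp_all add: frag_sum_diff)

lemma frag_sum_swap: "frag_sum (\<lambda>g. frag_sum (\<lambda>h. f g h) y) x = frag_sum (\<lambda>h. frag_sum (\<lambda>g. f g h) x) y"
  by (rule frag_induction[of x UNIV]) (simp_all add: frag_sum_diff frag_sum_fun_diff frag_sum_fun_0)

section \<open>Subgroups, cosets and their representatives\<close>

definition subgroup :: "'g::ab_group_add set \<Rightarrow> bool" where
  "subgroup N \<longleftrightarrow> 0 \<in> N \<and> (\<forall>x\<in>N. \<forall>y\<in>N. x - y \<in> N)"

lemma subgroup_subgroup_gen [simp]: "subgroup (subgroup_gen X)"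
  by (auto simp: subgroup_def intro: subgroup_gen.intros)

lemma subgroup_tens2 [simp]: "subgroup (tens2 ra la)"
  by (simp add: tens2_def)

lemma subgroup_tens3 [simp]: "subgroup (tens3 ra la ra' la')"
  by (simp add: tens3_def)

lemma subgroup_minus: "subgroup N \<Longrightarrow> x \<in> N \<Longrightarrow> - x \<in> N"
  unfolding subgroup_def by (metis diff_0)

lemma subgroup_add: "subgroup N \<Longrightarrow> x \<in> N \<Longrightarrow> y \<in> N \<Longrightarrow> x + y \<in> N"
  using subgroup_minus[of N y] unfolding subgroup_def by (metis diff_minus_eq_add)

lemma subgroup_diff_sym: "subgroup N \<Longrightarrow> x - y \<in> N \<Longrightarrow> y - x \<in> N"
  using subgroup_minus[of N "x - y"] by simp

lemma subgroup_diff_trans: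
  assumes "subgroup N" "x - y \<in> N" "y - z \<in> N"
  shows "x - z \<in> N"
proof -
  have "x - z = (x - y) + (y - z)" by simp
  then show ?thesis using subgroup_add assms by metis
qed

lemma subgroup_diff_cong:
  assumes "subgroup N" "a - a' \<in> N"
  shows "b - b' \<in> N \<Longrightarrow> a + b - (a' + b') \<in> N"
    and "b - b' \<in> N \<Longrightarrow> a - b - (a' - b') \<in> N"
    and "- a - - a' \<in> N"
proof -
  have eqs: "a + b - (a' + b') = (a - a') + (b - b')" "a - b - (a' - b') = (a - a') - (b - b')"
    "- a - - a' = - (a - a')" by simp_all
  show "b - b' \<in> N \<Longrightarrow> a + b - (a' + b') \<in> N"
    unfolding eqs(1) using assms subgroup_add by blast
  show "b - b' \<in> N \<Longrightarrow> a - b - (a' - b') \<in> N"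
    unfolding eqs(2) using assms unfolding subgroup_def by blast
  show "- a - - a' \<in> N"
    unfolding eqs(3) using assms subgroup_minus by blast
qed

lemma coset_eq_iff:
  assumes "subgroup N"
  shows "x +o N = y +o N \<longleftrightarrow> x - y \<in> N"
proof
  assume "x +o N = y +o N"
  moreover have "x \<in> x +o N" using assms by (auto simp: subgroup_def elt_set_plus_def)
  ultimately show "x - y \<in> N" by (simp add: set_plus_imp_minus)
next
  assume xy: "x - y \<in> N"
  show "x +o N = y +o N"
  proof (intro set_eqI)
    fix z
    have "z - x \<in> N \<longleftrightarrow> z - y \<in> N"
      using xy subgroup_diff_sym[OF assms] subgroup_diff_trans[OF assms] by blast
    then show "z \<in> x +o N \<longleftrightarrow> z \<in> y +o N" by (simp add: set_minus_plus)
  qed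
qed

lemma rep_coset:
  assumes "subgroup N"
  shows "rep (x +o N) - x \<in> N"
proof -
  have "x \<in> x +o N" using assms by (auto simp: subgroup_def elt_set_plus_def)
  then have "rep (x +o N) \<in> x +o N" unfolding rep_def by (rule someI)
  then show ?thesis by (rule set_plus_imp_minus)
qed

lemma coset_rep: "subgroup N \<Longrightarrow> t \<in> tensor N \<Longrightarrow> rep t +o N = t"
  using rep_coset coset_eq_iff unfolding tensor_def by blast

lemma coset_in_tensor [simp]: "x +o N \<in> tensor N"
  by (simp add: tensor_def)

lemma tmap_in_tensor [simp]: "tmap N f t \<in> tensor N"
  by (simp add: tmap_def)

lemma coset_plus_coset:
  assumes "subgroup N"
  shows "(x +o N) + (y +o N) = (x + y) +o N"
proof -
  have "N + N = N"
    using assms subgroup_add[OF assms] by (force simp: set_plus_def subgroup_def)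
  then show ?thesis by (simp add: set_plus_rearrange)
qed

text \<open>
  No type depends on \<open>N\<close>, so the quotients of the free abelian group on \<open>'g\<close> cannot be made
  into types one by one.  The product of all of them is a type, and it is an abelian group
  that contains each of them.
\<close>

quotient_type 'g quots = "('g \<Rightarrow>\<^sub>0 int) set \<Rightarrow> ('g \<Rightarrow>\<^sub>0 int)" /
  "\<lambda>h h'. \<forall>N. subgroup N \<longrightarrow> h N - h' N \<in> N"
proof (rule equivpI)
  show "reflp (\<lambda>h h' :: ('g \<Rightarrow>\<^sub>0 int) set \<Rightarrow> ('g \<Rightarrow>\<^sub>0 int). \<forall>N. subgroup N \<longrightarrow> h N - h' N \<in> N)"
    by (auto simp: reflp_def subgroup_def)
  show "symp (\<lambda>h h' :: ('g \<Rightarrow>\<^sub>0 int) set \<Rightarrow> ('g \<Rightarrow>\<^sub>0 int). \<forall>N. subgroup N \<longrightarrow> h N - h' N \<in> N)"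
    unfolding symp_def using subgroup_diff_sym by blast
  show "transp (\<lambda>h h' :: ('g \<Rightarrow>\<^sub>0 int) set \<Rightarrow> ('g \<Rightarrow>\<^sub>0 int). \<forall>N. subgroup N \<longrightarrow> h N - h' N \<in> N)"
    unfolding transp_def using subgroup_diff_trans by blast
qed

instantiation quots :: (type) ab_group_add
begin

lift_definition zero_quots :: "'a quots" is "\<lambda>N. 0" .

lift_definition plus_quots :: "'a quots \<Rightarrow> 'a quots \<Rightarrow> 'a quots" is "\<lambda>h h' N. h N + h' N"
  by (intro allI impI subgroup_diff_cong) simp_all

lift_definition uminus_quots :: "'a quots \<Rightarrow> 'a quots" is "\<lambda>h N. - h N"
  by (intro allI impI subgroup_diff_cong) simp_all

lift_definition minus_quots :: "'a quots \<Rightarrow> 'a quots \<Rightarrow> 'a quots" is "\<lambda>h h' N. h N - h' N"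
  by (intro allI impI subgroup_diff_cong) simp_all

instance
  by standard (transfer; simp add: subgroup_def add_ac)+

end

text \<open>The coset of \<open>x\<close> in the factor that belongs to \<open>N\<close>, with 0 in
  all other factors of the product. For a subgroup \<open>N\<close> this is an additive map with
  kernel \<open>N\<close>.\<close>

definition qclass :: "('g \<Rightarrow>\<^sub>0 int) set \<Rightarrow> ('g \<Rightarrow>\<^sub>0 int) \<Rightarrow> 'g quots" where
  "qclass N x = abs_quots (\<lambda>M. if M = N then x else 0)"

lemma qclass_eq_iff: "subgroup N \<Longrightarrow> qclass N x = qclass N y \<longleftrightarrow> x - y \<in> N"
  by (auto simp: qclass_def quots.abs_eq_iff subgroup_def)

lemma additive_qclass: "additive (qclass N)"
  by (auto simp: additive_def qclass_def plus_quots.abs_eq quots.abs_eq_iff subgroup_def)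

lemma qclass_frag_extend: "qclass N (frag_extend f x) = frag_sum (\<lambda>g. qclass N (f g)) x"
  by (simp add: frag_extend_ext additive_frag_sum_comp[OF additive_qclass])

lemma coset_eq_iff_qclass:
  assumes "subgroup N"
  shows "x +o N = y +o N \<longleftrightarrow> qclass N x = qclass N y"
  by (simp add: coset_eq_iff[OF assms] qclass_eq_iff[OF assms])

text \<open>Cosets are compared inside the abelian group \<open>quots\<close>, where additivity of
  \<open>qclass\<close> turns the induced map into a plain sum. Through this step the coset-valued
  conditions become identities between Sweedler sums.\<close>

lemma tmap_eq_iff:
  assumes "subgroup N"
  shows "tmap N f t = tmap N f' t' \<longleftrightarrow> tval (\<lambda>p. qclass N (f p)) t = tval (\<lambda>p. qclass N (f' p)) t'"
  by (simp add: tmap_def tval_ext coset_eq_iff_qclass[OF assms] qclass_frag_extend)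

lemma tmap_eq_coset_iff:
  assumes "subgroup N"
  shows "tmap N f t = x +o N \<longleftrightarrow> tval (\<lambda>p. qclass N (f p)) t = qclass N x"
  by (simp add: tmap_def tval_ext coset_eq_iff_qclass[OF assms] qclass_frag_extend)

section \<open>Maps that descend to a quotient\<close>

definition kills :: "('g \<Rightarrow> 'b::ab_group_add) \<Rightarrow> ('g \<Rightarrow>\<^sub>0 int) set \<Rightarrow> bool" where
  "kills f N \<longleftrightarrow> (\<forall>x\<in>N. frag_sum f x = 0)"

lemma kills_subgroup_gen:
  assumes "\<And>x. x \<in> X \<Longrightarrow> frag_sum f x = 0"
  shows "kills f (subgroup_gen X)"
proof -
  have "frag_sum f x = 0" if "x \<in> subgroup_gen X" for x
    using that by induction (simp_all add: assms frag_sum_diff)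
  then show ?thesis by (simp add: kills_def)
qed

text \<open>The representative chosen by \<open>rep\<close> differs from \<open>x\<close> by an
  element of \<open>N\<close>, on which the extension of \<open>f\<close> vanishes.\<close>

lemma tval_coset:
  assumes "subgroup N" "kills f N"
  shows "tval f (x +o N) = frag_sum f x"
  using rep_coset[OF assms(1), of x] assms(2) by (force simp: tval_ext kills_def frag_sum_diff)

lemma tval_tmap:
  assumes "subgroup N" "kills f N"
  shows "tval f (tmap N h t) = tval (\<lambda>p. frag_sum f (h p)) t"
  by (simp add: tmap_def tval_coset[OF assms] frag_sum_frag_extend) (simp add: tval_ext)

lemma tval_plus:
  assumes "subgroup N" "kills f N" "t \<in> tensor N" "t' \<in> tensor N"
  shows "tval f (t + t') = tval f t + tval f t'"
  using assms by (auto simp: tensor_def coset_plus_coset tval_coset frag_sum_add)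

text \<open>The class of a formal sum is the sum of the classes of its generators, so this one test
  map separates the cosets of \<open>N\<close>.\<close>

lemma tensor_eqI:
  assumes "subgroup N" "t \<in> tensor N" "t' \<in> tensor N"
    and "tval (\<lambda>p. qclass N (frag_of p)) t = tval (\<lambda>p. qclass N (frag_of p)) t'"
  shows "t = t'"
proof -
  have "qclass N (rep t) = qclass N (rep t')"
    using assms(4) unfolding tval_ext qclass_frag_extend[symmetric] frag_expansion[symmetric] .
  then show ?thesis using coset_rep assms coset_eq_iff_qclass by metis
qed

text \<open>\<open>ssum (\<gamma> a) f\<close> is the Sweedler sum \<open>\<Sum> f a\<^sub>1 a\<^sub>2\<close>.\<close>

abbreviation ssum :: "(('m \<times> 'n) \<Rightarrow>\<^sub>0 int) set \<Rightarrow> ('m \<Rightarrow> 'n \<Rightarrow> 'b::ab_group_add) \<Rightarrow> 'b" where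
  "ssum t f \<equiv> tval (\<lambda>(x, y). f x y) t"

section \<open>Balanced maps as test maps\<close>

definition balanced ::
  "('m::ab_group_add \<Rightarrow> 'k \<Rightarrow> 'm) \<Rightarrow> ('k \<Rightarrow> 'n::ab_group_add \<Rightarrow> 'n) \<Rightarrow>
   ('m \<Rightarrow> 'n \<Rightarrow> 'b::ab_group_add) \<Rightarrow> bool" where
  "balanced ra la f \<longleftrightarrow>
     (\<forall>m m' n. f (m + m') n = f m n + f m' n) \<and>
     (\<forall>m n n'. f m (n + n') = f m n + f m n') \<and>
     (\<forall>m k n. f (ra m k) n = f m (la k n))"

definition balanced3 ::
  "('m::ab_group_add \<Rightarrow> 'k \<Rightarrow> 'm) \<Rightarrow> ('k \<Rightarrow> 'n::ab_group_add \<Rightarrow> 'n) \<Rightarrow>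
   ('n \<Rightarrow> 'h \<Rightarrow> 'n) \<Rightarrow> ('h \<Rightarrow> 'p::ab_group_add \<Rightarrow> 'p) \<Rightarrow>
   ('m \<Rightarrow> 'n \<Rightarrow> 'p \<Rightarrow> 'b::ab_group_add) \<Rightarrow> bool" where
  "balanced3 ra la ra' la' f \<longleftrightarrow>
     (\<forall>m m' n p. f (m + m') n p = f m n p + f m' n p) \<and>
     (\<forall>m n n' p. f m (n + n') p = f m n p + f m n' p) \<and>
     (\<forall>m n p p'. f m n (p + p') = f m n p + f m n p') \<and>
     (\<forall>m k n p. f (ra m k) n p = f m (la k n) p) \<and>
     (\<forall>m n h p. f m (ra' n h) p = f m n (la' h p))"

lemma balanced_kills: "balanced ra la f \<Longrightarrow> kills (\<lambda>(x, y). f x y) (tens2 ra la)"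
  unfolding tens2_def by (rule kills_subgroup_gen) (auto simp: balanced_def frag_sum_diff)

lemma balanced3_kills: "balanced3 ra la ra' la' f \<Longrightarrow> kills (\<lambda>(x, y, z). f x y z) (tens3 ra la ra' la')"
  unfolding tens3_def by (rule kills_subgroup_gen) (auto simp: balanced3_def frag_sum_diff)

abbreviation elem :: "(('m \<times> 'n) \<Rightarrow>\<^sub>0 int) set \<Rightarrow> 'm \<Rightarrow> 'n \<Rightarrow> ('m \<times> 'n) quots" where
  "elem N x y \<equiv> qclass N (frag_of (x, y))"

abbreviation elem3 ::
  "(('m \<times> 'n \<times> 'p) \<Rightarrow>\<^sub>0 int) set \<Rightarrow> 'm \<Rightarrow> 'n \<Rightarrow> 'p \<Rightarrow> ('m \<times> 'n \<times> 'p) quots" where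
  "elem3 N x y z \<equiv> qclass N (frag_of (x, y, z))"

lemma qclass_add: "qclass N (x + y) = qclass N x + qclass N y"
  using additive_qclass[of N] by (simp add: additive_def)

lemma qclass_diff3_eq:
  assumes "subgroup N" "x - y - z \<in> N"
  shows "qclass N x = qclass N y + qclass N z"
  unfolding qclass_add[symmetric] using assms by (simp add: qclass_eq_iff diff_diff_add)

text \<open>The elementary tensor is the universal balanced map: a Sweedler identity proved for all
  balanced \<open>f\<close> is specialised to \<open>elem\<close> in order to obtain an equality of
  tensors.\<close>

lemma balanced_elem: "balanced ra la (elem (tens2 ra la))"
  unfolding balanced_def
proof (intro conjI allI)
  fix m m' n n' k
  let ?N = "tens2 ra la"
  show "elem ?N (m + m') n = elem ?N m n + elem ?N m' n"
    by (rule qclass_diff3_eq, simp, unfold tens2_def, rule subgroup_gen.gen) blast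
  show "elem ?N m (n + n') = elem ?N m n + elem ?N m n'"
    by (rule qclass_diff3_eq, simp, unfold tens2_def, rule subgroup_gen.gen) blast
  show "elem ?N (ra m k) n = elem ?N m (la k n)"
    by (subst qclass_eq_iff, simp, unfold tens2_def, rule subgroup_gen.gen) blast
qed

lemma balanced3_elem3: "balanced3 ra la ra' la' (elem3 (tens3 ra la ra' la'))"
  unfolding balanced3_def
proof (intro conjI allI)
  fix m m' n n' p p' k h
  let ?N = "tens3 ra la ra' la'"
  show "elem3 ?N (m + m') n p = elem3 ?N m n p + elem3 ?N m' n p"
    by (rule qclass_diff3_eq, simp, unfold tens3_def, rule subgroup_gen.gen) blast
  show "elem3 ?N m (n + n') p = elem3 ?N m n p + elem3 ?N m n' p"
    by (rule qclass_diff3_eq, simp, unfold tens3_def, rule subgroup_gen.gen) blast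
  show "elem3 ?N m n (p + p') = elem3 ?N m n p + elem3 ?N m n p'"
    by (rule qclass_diff3_eq, simp, unfold tens3_def, rule subgroup_gen.gen) blast
  show "elem3 ?N (ra m k) n p = elem3 ?N m (la k n) p"
    by (subst qclass_eq_iff, simp, unfold tens3_def, rule subgroup_gen.gen) blast
  show "elem3 ?N m (ra' n h) p = elem3 ?N m n (la' h p)"
    by (subst qclass_eq_iff, simp, unfold tens3_def, rule subgroup_gen.gen) blast
qed

lemma additive_tval: "additive h \<Longrightarrow> h (tval f t) = tval (\<lambda>p. h (f p)) t"
  unfolding tval_ext by (rule additive_frag_sum_comp)

lemma additive_ssum: "additive h \<Longrightarrow> h (ssum t f) = ssum t (\<lambda>x y. h (f x y))"
  by (simp add: additive_tval prod.case_distrib)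

lemma ssum_fun_add: "ssum t (\<lambda>x y. f x y + g x y) = ssum t f + ssum t g"
  by (simp add: tval_ext frag_sum_fun_add[symmetric] case_prod_unfold)

lemma ssum_fun_diff: "ssum t (\<lambda>x y. f x y - g x y) = ssum t f - ssum t g"
  by (simp add: tval_ext frag_sum_fun_diff[symmetric] case_prod_unfold)

lemma ssum_fun_0: "ssum t (\<lambda>x y. 0) = 0"
  by (simp add: tval_ext frag_sum_fun_0 case_prod_unfold)

lemma ssum_mult_left:
  fixes c :: "'a::ring"
  shows "c * ssum t f = ssum t (\<lambda>x y. c * f x y)"
  by (rule additive_ssum) (simp add: additive_def distrib_left)

lemma ssum_mult_right:
  fixes c :: "'a::ring"
  shows "ssum t f * c = ssum t (\<lambda>x y. f x y * c)"
  by (rule additive_ssum) (simp add: additive_def distrib_right)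

text \<open>Both sums run over fixed representatives, so two finite sums are exchanged and
  \<open>f\<close> may be arbitrary.\<close>

lemma ssum_swap: "ssum t (\<lambda>x y. ssum t' (\<lambda>u v. f x y u v)) = ssum t' (\<lambda>u v. ssum t (\<lambda>x y. f x y u v))"
  unfolding tval_ext case_prod_unfold by (rule frag_sum_swap)

lemma ssum_tmap_balanced:
  assumes "balanced ra la f"
  shows "ssum (tmap (tens2 ra la) h t) f = tval (\<lambda>p. frag_sum (\<lambda>(x, y). f x y) (h p)) t"
  by (rule tval_tmap[OF subgroup_tens2 balanced_kills[OF assms]])

lemma ssum_plus_balanced:
  assumes "balanced ra la f" "t \<in> tensor (tens2 ra la)" "t' \<in> tensor (tens2 ra la)"
  shows "ssum (t + t') f = ssum t f + ssum t' f"
  by (rule tval_plus[OF subgroup_tens2 balanced_kills[OF assms(1)] assms(2,3)])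

lemma ssum_coset_balanced:
  assumes "balanced ra la f"
  shows "ssum (x +o tens2 ra la) f = frag_sum (\<lambda>(x, y). f x y) x"
  by (rule tval_coset[OF subgroup_tens2 balanced_kills[OF assms]])

lemma tmap_eqD:
  assumes "subgroup N" "kills f N" "tmap N h t = tmap N h' t'"
  shows "tval (\<lambda>p. frag_sum f (h p)) t = tval (\<lambda>p. frag_sum f (h' p)) t'"
  using tval_tmap[OF assms(1,2), of h t] tval_tmap[OF assms(1,2), of h' t'] assms(3) by simp

lemma frag_sum_case: "frag_sum f (case p of (x, y) \<Rightarrow> h x y) = (case p of (x, y) \<Rightarrow> frag_sum f (h x y))"
  by (simp add: case_prod_unfold)

lemma frag_sum_frag_extend_rep: "frag_sum f (frag_extend h (rep t)) = tval (\<lambda>p. frag_sum f (h p)) t"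
  by (simp add: frag_sum_frag_extend tval_ext)

lemma qclass_case: "qclass N (case p of (x, y) \<Rightarrow> h x y) = (case p of (x, y) \<Rightarrow> qclass N (h x y))"
  by (simp add: case_prod_unfold)

lemma qclass_frag_extend_rep: "qclass N (frag_extend h (rep t)) = tval (\<lambda>p. qclass N (h p)) t"
  by (simp add: qclass_frag_extend tval_ext)

lemmas frag_sum_norm = frag_sum_case frag_sum_frag_extend_rep frag_sum_frag_of prod.case
lemmas qclass_norm = qclass_case qclass_frag_extend_rep prod.case

section \<open>Sweedler calculus\<close>

text \<open>\<open>balanced\<close> for \<open>LL s t\<close>, with the module actions written out
  as products so that the ring laws apply directly.\<close>

definition left_balanced ::
  "('l \<Rightarrow> 'a::{ring,monoid_mult}) \<Rightarrow> ('l \<Rightarrow> 'a) \<Rightarrow> ('a \<Rightarrow> 'a \<Rightarrow> 'b::ab_group_add) \<Rightarrow> bool" where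
  "left_balanced s t f \<longleftrightarrow>
     (\<forall>x x' y. f (x + x') y = f x y + f x' y) \<and>
     (\<forall>x y y'. f x (y + y') = f x y + f x y') \<and>
     (\<forall>l x y. f (t l * x) y = f x (s l * y))"

definition right_balanced ::
  "('r \<Rightarrow> 'a::{ring,monoid_mult}) \<Rightarrow> ('r \<Rightarrow> 'a) \<Rightarrow> ('a \<Rightarrow> 'a \<Rightarrow> 'b::ab_group_add) \<Rightarrow> bool" where
  "right_balanced s t f \<longleftrightarrow>
     (\<forall>x x' y. f (x + x') y = f x y + f x' y) \<and>
     (\<forall>x y y'. f x (y + y') = f x y + f x y') \<and>
     (\<forall>r x y. f (x * s r) y = f x (y * t r))"

lemma left_balanced_iff:
  "left_balanced s t f \<longleftrightarrow> balanced (right_by_left t) (left_by_left s) f"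
  by (auto simp: left_balanced_def balanced_def right_by_left_def left_by_left_def)

lemma right_balanced_iff:
  "right_balanced s t f \<longleftrightarrow> balanced (right_by_right s) (left_by_right t) f"
  by (auto simp: right_balanced_def balanced_def right_by_right_def left_by_right_def)

lemma left_balanced_elem: "left_balanced s t (elem (LL s t))"
  unfolding left_balanced_iff LL_def by (rule balanced_elem)

lemma right_balanced_elem: "right_balanced s t (elem (RR s t))"
  unfolding right_balanced_iff RR_def by (rule balanced_elem)

lemma left_balanced_kills: "left_balanced s t f \<Longrightarrow> kills (\<lambda>(x, y). f x y) (LL s t)"
  unfolding left_balanced_iff LL_def by (rule balanced_kills)

lemma right_balanced_kills: "right_balanced s t f \<Longrightarrow> kills (\<lambda>(x, y). f x y) (RR s t)"
  unfolding right_balanced_iff RR_def by (rule balanced_kills)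

lemma subgroup_LL [simp]: "subgroup (LL s t)" and subgroup_RR [simp]: "subgroup (RR s t)"
  by (simp_all add: LL_def RR_def)

text \<open>The part of \<open>balanced3\<close> common to the four threefold tensor products
  \<open>LLLL\<close>, \<open>RRRR\<close>, \<open>LLRR\<close> and \<open>RRLL\<close>; only the
  two scalar relations vary among them.\<close>

definition additive3 ::
  "('a::ab_group_add \<Rightarrow> 'a \<Rightarrow> 'a \<Rightarrow> 'b::ab_group_add) \<Rightarrow> bool" where
  "additive3 f \<longleftrightarrow>
     (\<forall>x x' y z. f (x + x') y z = f x y z + f x' y z) \<and>
     (\<forall>x y y' z. f x (y + y') z = f x y z + f x y' z) \<and>
     (\<forall>x y z z'. f x y (z + z') = f x y z + f x y z')"

lemma balanced3_additive3: "balanced3 ra la ra' la' f \<longleftrightarrow> additive3 f \<and>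
     (\<forall>m k n p. f (ra m k) n p = f m (la k n) p) \<and>
     (\<forall>m n h p. f m (ra' n h) p = f m n (la' h p))"
  by (auto simp: balanced3_def additive3_def)

lemma tmap_left_eqD:
  assumes "tmap_left N \<gamma> T = tmap_right N \<gamma>' T'" "subgroup N" "kills (\<lambda>(x, y, z). f x y z) N"
  shows "ssum T (\<lambda>x y. ssum (\<gamma> x) (\<lambda>u v. f u v y)) = ssum T' (\<lambda>x y. ssum (\<gamma>' y) (\<lambda>u v. f x u v))"
  using tmap_eqD[OF assms(2,3) assms(1)[unfolded tmap_left_def tmap_right_def]]
  by (simp add: frag_sum_norm)

lemma tmap_left_right_eq_iff:
  assumes "subgroup N"
  shows "tmap_left N \<gamma> T = tmap_right N \<gamma>' T' \<longleftrightarrow>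
    ssum T (\<lambda>x y. ssum (\<gamma> x) (\<lambda>u v. elem3 N u v y)) = ssum T' (\<lambda>x y. ssum (\<gamma>' y) (\<lambda>u v. elem3 N x u v))"
  unfolding tmap_left_def tmap_right_def tmap_eq_iff[OF assms] by (simp only: qclass_norm)

section \<open>Axioms of a left bialgebroid as rules for Sweedler sums\<close>

context left_bialgebroid
begin

lemma s_add: "s (x + y) = s x + s y" and s_mult: "s (x * y) = s x * s y" and s_1: "s 1 = 1"
  and t_add: "t (x + y) = t x + t y" and t_mult: "t (x * y) = t y * t x" and t_1: "t 1 = 1"
  using source target by (simp_all add: ring_map_def ring_antimap_def)

lemma t_s_mult: "t l' * (s l * x) = s l * (t l' * x)"
  by (metis commute mult.assoc)

lemma counit_s: "\<pi> (s l * a) = l * \<pi> a" and counit_t: "\<pi> (t l * a) = \<pi> a * l"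
  using counit_bimod[of l 1 a] counit_bimod[of 1 l a] by (simp_all add: s_1 t_1)

lemma counit_s': "\<pi> (s l) = l" and counit_t': "\<pi> (t l) = l"
  using counit_s[of l 1] counit_t[of l 1] by (simp_all add: counit_one)

lemma left_balanced_sum_add:
  assumes "left_balanced s t f"
  shows "ssum (\<gamma> (a + b)) f = ssum (\<gamma> a) f + ssum (\<gamma> b) f"
  unfolding comult_add
  by (rule ssum_plus_balanced[OF assms[unfolded left_balanced_iff]])
    (use comult_in in \<open>simp_all add: LL_def\<close>)

lemma left_balanced_sum_bimod:
  assumes "left_balanced s t f"
  shows "ssum (\<gamma> (s l * t l' * a)) f = ssum (\<gamma> a) (\<lambda>x y. f (s l * x) (t l' * y))"
  unfolding comult_bimod LL_def ssum_tmap_balanced[OF assms[unfolded left_balanced_iff]]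
  by (simp add: frag_sum_norm)

lemma left_balanced_sum_s:
  assumes "left_balanced s t f"
  shows "ssum (\<gamma> (s l * a)) f = ssum (\<gamma> a) (\<lambda>x y. f (s l * x) y)"
  using left_balanced_sum_bimod[OF assms, of l 1 a] by (simp add: t_1)

lemma left_balanced_sum_t:
  assumes "left_balanced s t f"
  shows "ssum (\<gamma> (t l * a)) f = ssum (\<gamma> a) (\<lambda>x y. f x (t l * y))"
  using left_balanced_sum_bimod[OF assms, of 1 l a] by (simp add: s_1)

lemma left_balanced_sum_1:
  assumes "left_balanced s t f"
  shows "ssum (\<gamma> 1) f = f 1 1"
  unfolding comult_one LL_def ssum_coset_balanced[OF assms[unfolded left_balanced_iff]]
  by (simp add: frag_sum_norm)

lemma left_balanced_sum_mult:
  assumes "left_balanced s t f"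
  shows "ssum (\<gamma> (a * b)) f = ssum (\<gamma> a) (\<lambda>x y. ssum (\<gamma> b) (\<lambda>u v. f (x * u) (y * v)))"
  unfolding comult_mult LL_def tprod_def ssum_tmap_balanced[OF assms[unfolded left_balanced_iff]]
  by (simp add: frag_sum_norm)

lemma left_balanced_sum_takeuchi:
  assumes "left_balanced s t f"
  shows "ssum (\<gamma> a) (\<lambda>x y. f (x * t l) y) = ssum (\<gamma> a) (\<lambda>x y. f x (y * s l))"
  using tmap_eqD[OF _ left_balanced_kills[OF assms] takeuchi] by (simp add: frag_sum_norm)

lemma left_balanced_sum_coassoc:
  assumes "additive3 f" "\<And>l x y z. f (t l * x) y z = f x (s l * y) z"
    "\<And>l x y z. f x (t l * y) z = f x y (s l * z)"
  shows "ssum (\<gamma> a) (\<lambda>x y. ssum (\<gamma> x) (\<lambda>u v. f u v y)) = ssum (\<gamma> a) (\<lambda>x y. ssum (\<gamma> y) (\<lambda>u v. f x u v))"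
  by (rule tmap_left_eqD[OF coassoc], unfold LLLL_def, rule subgroup_tens3, rule balanced3_kills)
    (use assms in \<open>simp add: balanced3_additive3 left_by_left_def right_by_left_def\<close>)

lemma sum_counit_left:
  assumes "additive h"
  shows "ssum (\<gamma> a) (\<lambda>x y. h (s (\<pi> x) * y)) = h a"
  using arg_cong[OF counit_left, of h a] by (simp add: additive_ssum[OF assms])

lemma sum_counit_right:
  assumes "additive h"
  shows "ssum (\<gamma> a) (\<lambda>x y. h (t (\<pi> y) * x)) = h a"
  using arg_cong[OF counit_right, of h a] by (simp add: additive_ssum[OF assms])

end

section \<open>Axioms of a right bialgebroid as rules for Sweedler sums\<close>

context right_bialgebroid
begin

lemma s_add: "s (x + y) = s x + s y" and s_mult: "s (x * y) = s x * s y" and s_1: "s 1 = 1"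
  and t_add: "t (x + y) = t x + t y" and t_mult: "t (x * y) = t y * t x" and t_1: "t 1 = 1"
  using source target by (simp_all add: ring_map_def ring_antimap_def)

lemma counit_s: "\<pi> (a * s r) = \<pi> a * r" and counit_t: "\<pi> (a * t r) = r * \<pi> a"
  using counit_bimod[of a r 1] counit_bimod[of a 1 r] by (simp_all add: s_1 t_1)

lemma counit_s': "\<pi> (s r) = r" and counit_t': "\<pi> (t r) = r"
  using counit_s[of 1 r] counit_t[of 1 r] by (simp_all add: counit_one)

lemma right_balanced_sum_add:
  assumes "right_balanced s t f"
  shows "ssum (\<gamma> (a + b)) f = ssum (\<gamma> a) f + ssum (\<gamma> b) f"
  unfolding comult_add
  by (rule ssum_plus_balanced[OF assms[unfolded right_balanced_iff]])
    (use comult_in in \<open>simp_all add: RR_def\<close>)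

lemma right_balanced_sum_1:
  assumes "right_balanced s t f"
  shows "ssum (\<gamma> 1) f = f 1 1"
  unfolding comult_one RR_def ssum_coset_balanced[OF assms[unfolded right_balanced_iff]]
  by (simp add: frag_sum_norm)

lemma right_balanced_sum_bimod:
  assumes "right_balanced s t f"
  shows "ssum (\<gamma> (a * s r' * t r)) f = ssum (\<gamma> a) (\<lambda>x y. f (x * t r) (y * s r'))"
  unfolding comult_bimod RR_def ssum_tmap_balanced[OF assms[unfolded right_balanced_iff]]
  by (simp add: frag_sum_norm)

lemma right_balanced_sum_s:
  assumes "right_balanced s t f"
  shows "ssum (\<gamma> (a * s r)) f = ssum (\<gamma> a) (\<lambda>x y. f x (y * s r))"
  using right_balanced_sum_bimod[OF assms, of a r 1] by (simp add: t_1)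

lemma right_balanced_sum_t:
  assumes "right_balanced s t f"
  shows "ssum (\<gamma> (a * t r)) f = ssum (\<gamma> a) (\<lambda>x y. f (x * t r) y)"
  using right_balanced_sum_bimod[OF assms, of a 1 r] by (simp add: s_1)

lemma right_balanced_sum_mult:
  assumes "right_balanced s t f"
  shows "ssum (\<gamma> (a * b)) f = ssum (\<gamma> a) (\<lambda>x y. ssum (\<gamma> b) (\<lambda>u v. f (x * u) (y * v)))"
  unfolding comult_mult RR_def tprod_def ssum_tmap_balanced[OF assms[unfolded right_balanced_iff]]
  by (simp add: frag_sum_norm)

lemma right_balanced_sum_takeuchi:
  assumes "right_balanced s t f"
  shows "ssum (\<gamma> a) (\<lambda>x y. f (s r * x) y) = ssum (\<gamma> a) (\<lambda>x y. f x (t r * y))"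
  using tmap_eqD[OF _ right_balanced_kills[OF assms] takeuchi] by (simp add: frag_sum_norm)

lemma sum_counit_left:
  assumes "additive h"
  shows "ssum (\<gamma> a) (\<lambda>x y. h (y * t (\<pi> x))) = h a"
  using arg_cong[OF counit_left, of h a] by (simp add: additive_ssum[OF assms])

lemma sum_counit_right:
  assumes "additive h"
  shows "ssum (\<gamma> a) (\<lambda>x y. h (x * s (\<pi> y))) = h a"
  using arg_cong[OF counit_right, of h a] by (simp add: additive_ssum[OF assms])

end

lemma left_balancedI:
  assumes "\<And>x x' y. f (x + x') y = f x y + f x' y" "\<And>x y y'. f x (y + y') = f x y + f x y'"
    "\<And>l x y. f (t l * x) y = f x (s l * y)"
  shows "left_balanced s t f"
  using assms by (simp add: left_balanced_def)

lemma right_balancedI: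
  assumes "\<And>x x' y. f (x + x') y = f x y + f x' y" "\<And>x y y'. f x (y + y') = f x y + f x y'"
    "\<And>r x y. f (x * s r) y = f x (y * t r)"
  shows "right_balanced s t f"
  using assms by (simp add: right_balanced_def)

lemma left_balancedD:
  assumes "left_balanced s t f"
  shows "f (x + x') y = f x y + f x' y" "f x (y + y') = f x y + f x y'" "f (t l * x) y = f x (s l * y)"
  using assms by (auto simp: left_balanced_def)

lemma right_balancedD:
  assumes "right_balanced s t f"
  shows "f (x + x') y = f x y + f x' y" "f x (y + y') = f x y + f x y'" "f (x * s r) y = f x (y * t r)"
  using assms by (auto simp: right_balanced_def)

lemma additive3I:
  assumes "\<And>x x' y z. f (x + x') y z = f x y z + f x' y z"
    "\<And>x y y' z. f x (y + y') z = f x y z + f x y' z"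
    "\<And>x y z z'. f x y (z + z') = f x y z + f x y z'"
  shows "additive3 f"
  using assms by (simp add: additive3_def)

lemma additiveI: "(\<And>x y. f (x + y) = f x + f y) \<Longrightarrow> additive f"
  by (simp add: additive_def)

lemma ssum_additive: "additive h \<Longrightarrow> ssum t (\<lambda>x y. h (f x y)) = h (ssum t f)"
  by (rule additive_ssum[symmetric])

lemma left_balanced_additive:
  assumes "left_balanced s t f"
  shows "additive (\<lambda>x. f x y)" "additive (f x)"
  using left_balancedD[OF assms] by (auto simp: additive_def)

section \<open>Comultiplication of products with base ring elements\<close>

context left_bialgebroid
begin

lemma left_balanced_sum_additive:
  assumes "left_balanced s t f"
  shows "additive (\<lambda>a. ssum (\<gamma> a) f)"
  by (rule additiveI) (rule left_balanced_sum_add[OF assms])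

text \<open>
  The next two lemmas need the outer sum: for fixed \<open>x\<close> and \<open>y\<close> the map
  \<open>\<lambda>u v. f (x * u) (y * v)\<close> is not balanced.
\<close>

lemma left_balanced_sum_shift:
  assumes f: "left_balanced s t f"
  shows "left_balanced s t (\<lambda>u v. ssum (\<gamma> a) (\<lambda>x y. f (x * u) (y * v)))"
proof (rule left_balancedI)
  note [simp] = left_balancedD[OF f] distrib_left ssum_fun_add
  fix l u v
  have "left_balanced s t (\<lambda>x y. f (x * u) (y * v))"
    by (rule left_balancedI) (simp_all add: distrib_right mult.assoc)
  from left_balanced_sum_takeuchi[OF this, where a = a and l = l]
  show "ssum (\<gamma> a) (\<lambda>x y. f (x * (t l * u)) (y * v)) = ssum (\<gamma> a) (\<lambda>x y. f (x * u) (y * (s l * v)))"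
    by (simp add: mult.assoc)
qed (simp_all add: left_balancedD[OF f] distrib_left ssum_fun_add)

lemma left_balanced_sum_mult':
  assumes "left_balanced s t f"
  shows "ssum (\<gamma> (a * b)) f = ssum (\<gamma> b) (\<lambda>u v. ssum (\<gamma> a) (\<lambda>x y. f (x * u) (y * v)))"
  unfolding left_balanced_sum_mult[OF assms] by (rule ssum_swap)

text \<open>Bilinearity of \<open>\<gamma>\<close> applied to \<open>s l * 1\<close>. The shifted
  test map stays balanced because the images of \<open>s\<close> and \<open>t\<close>
  commute.\<close>

lemma left_balanced_sum_of_s:
  assumes f: "left_balanced s t f"
  shows "ssum (\<gamma> (s l)) f = f (s l) 1"
proof -
  note [simp] = left_balancedD[OF f]
  have "left_balanced s t (\<lambda>x y. f (s l * x) y)"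
    by (rule left_balancedI) (simp_all add: distrib_left flip: t_s_mult)
  from left_balanced_sum_1[OF this] left_balanced_sum_s[OF f, of l 1]
  show ?thesis by simp
qed

lemma left_balanced_sum_of_t:
  assumes f: "left_balanced s t f"
  shows "ssum (\<gamma> (t l)) f = f 1 (t l)"
proof -
  note [simp] = left_balancedD[OF f]
  have "left_balanced s t (\<lambda>x y. f x (t l * y))"
    by (rule left_balancedI) (simp_all add: distrib_left t_s_mult)
  from left_balanced_sum_1[OF this] left_balanced_sum_t[OF f, of l 1]
  show ?thesis by simp
qed

text \<open>The bimodule axiom covers multiplication by \<open>s l\<close> from the left only. From
  the right, multiplicativity is combined with
  \<open>\<gamma> (s l) = s l \<otimes> 1\<close>.\<close>

lemma left_balanced_sum_mult_s:
  assumes f: "left_balanced s t f"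
  shows "ssum (\<gamma> (a * s l)) f = ssum (\<gamma> a) (\<lambda>x y. f (x * s l) y)"
  using left_balanced_sum_of_s[OF left_balanced_sum_shift[OF f]]
  by (simp add: left_balanced_sum_mult'[OF f])

lemma left_balanced_sum_mult_t:
  assumes f: "left_balanced s t f"
  shows "ssum (\<gamma> (a * t l)) f = ssum (\<gamma> a) (\<lambda>x y. f x (y * t l))"
  using left_balanced_sum_of_t[OF left_balanced_sum_shift[OF f]]
  by (simp add: left_balanced_sum_mult'[OF f])

end

context right_bialgebroid
begin

text \<open>Mirror image of \<open>left_balanced_sum_shift\<close>: the Takeuchi condition of a
  right bialgebroid concerns multiplication from the left, so here the sum over
  \<open>\<gamma> a\<close> stands in the right factor.\<close>

lemma right_balanced_sum_unshift:
  assumes f: "right_balanced s t f"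
  shows "right_balanced s t (\<lambda>u v. ssum (\<gamma> a) (\<lambda>x y. f (u * x) (v * y)))"
proof (rule right_balancedI)
  note [simp] = right_balancedD[OF f] distrib_left ssum_fun_add
  fix r u v
  have "right_balanced s t (\<lambda>x y. f (u * x) (v * y))"
    by (rule right_balancedI) (simp_all flip: mult.assoc)
  from right_balanced_sum_takeuchi[OF this, where a = a and r = r]
  show "ssum (\<gamma> a) (\<lambda>x y. f (u * s r * x) (v * y)) = ssum (\<gamma> a) (\<lambda>x y. f (u * x) (v * t r * y))"
    by (simp add: mult.assoc)
qed (simp_all add: right_balancedD[OF f] distrib_right ssum_fun_add)

lemma right_balanced_sum_of_s:
  assumes f: "right_balanced s t f"
  shows "ssum (\<gamma> (s r)) f = f 1 (s r)"
proof -
  have c: "y * t k * s r = y * s r * t k" for k y by (simp add: commute mult.assoc)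
  have "right_balanced s t (\<lambda>x y. f x (y * s r))"
    by (rule right_balancedI) (simp_all add: c right_balancedD[OF f] distrib_right)
  from right_balanced_sum_1[OF this] right_balanced_sum_s[OF f, of 1 r]
  show ?thesis by simp
qed

lemma right_balanced_sum_of_t:
  assumes f: "right_balanced s t f"
  shows "ssum (\<gamma> (t r)) f = f (t r) 1"
proof -
  have c: "y * s k * t r = y * t r * s k" for k y by (simp add: commute mult.assoc)
  have "right_balanced s t (\<lambda>x y. f (x * t r) y)"
    by (rule right_balancedI) (simp_all add: c right_balancedD[OF f] distrib_right)
  from right_balanced_sum_1[OF this] right_balanced_sum_t[OF f, of 1 r]
  show ?thesis by simp
qed

lemma right_balanced_sum_s_mult:
  assumes f: "right_balanced s t f"
  shows "ssum (\<gamma> (s r * a)) f = ssum (\<gamma> a) (\<lambda>x y. f x (s r * y))"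
  using right_balanced_sum_of_s[OF right_balanced_sum_unshift[OF f]]
  by (simp add: right_balanced_sum_mult[OF f])

lemma right_balanced_sum_t_mult:
  assumes f: "right_balanced s t f"
  shows "ssum (\<gamma> (t r * a)) f = ssum (\<gamma> a) (\<lambda>x y. f (t r * x) y)"
  using right_balanced_sum_of_t[OF right_balanced_sum_unshift[OF f]]
  by (simp add: right_balanced_sum_mult[OF f])

end

section \<open>Pairs of bialgebroids with an antipode\<close>

text \<open>Conditions (a) and (b), the common ground of (iii) and (iv).\<close>

locale mixed_pair =
  L: left_bialgebroid sL tL \<gamma>L \<pi>L + R: right_bialgebroid sR tR \<gamma>R \<pi>R
  for sL tL :: "'l::{ring,monoid_mult} \<Rightarrow> 'a::{ring,monoid_mult}"
    and \<gamma>L \<pi>L and sR tR :: "'r::{ring,monoid_mult} \<Rightarrow> 'a" and \<gamma>R \<pi>R +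
  assumes range_sL: "range sL = range tR" and range_tL: "range tL = range sR"
    and compatible: "comults_compatible sL tL \<gamma>L sR tR \<gamma>R"
begin

abbreviation SL :: "'a \<Rightarrow> ('a \<Rightarrow> 'a \<Rightarrow> 'b::ab_group_add) \<Rightarrow> 'b" where
  "SL a f \<equiv> ssum (\<gamma>L a) f"

abbreviation SR :: "'a \<Rightarrow> ('a \<Rightarrow> 'a \<Rightarrow> 'b::ab_group_add) \<Rightarrow> 'b" where
  "SR a f \<equiv> ssum (\<gamma>R a) f"

abbreviation "balL \<equiv> left_balanced sL tL"
abbreviation "balR \<equiv> right_balanced sR tR"

lemma obtain_sR: obtains l where "sR r = tL l"
  using range_tL by (metis rangeI rangeE)

lemma obtain_tR: obtains l where "tR r = sL l"
  using range_sL by (metis rangeI rangeE)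

lemma obtain_sL: obtains r where "sL l = tR r"
  using range_sL by (metis rangeI rangeE)

lemma obtain_tL: obtains r where "tL l = sR r"
  using range_tL by (metis rangeI rangeE)

lemma sL_sR: "sL l * sR r = sR r * sL l" and tL_tR: "tL l * tR r = tR r * tL l"
  by (metis L.commute obtain_sR, metis L.commute obtain_tR)

lemma sR_sL_mult: "sR r * (sL l * x) = sL l * (sR r * x)"
  by (metis sL_sR mult.assoc)

lemma mixed_coassoc_left:
  assumes "additive3 f" "\<And>l x y z. f (tL l * x) y z = f x (sL l * y) z"
    "\<And>r x y z. f x (y * sR r) z = f x y (z * tR r)"
  shows "SR a (\<lambda>x y. SL x (\<lambda>u v. f u v y)) = SL a (\<lambda>x y. SR y (\<lambda>u v. f x u v))"
proof -
  have *: "tmap_left (LLRR sL tL sR tR) \<gamma>L (\<gamma>R a) = tmap_right (LLRR sL tL sR tR) \<gamma>R (\<gamma>L a)"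
    using compatible unfolding comults_compatible_def by (metis comp_apply)
  show ?thesis
    by (rule tmap_left_eqD[OF *], unfold LLRR_def, rule subgroup_tens3, rule balanced3_kills)
      (use assms in \<open>simp add: balanced3_additive3 left_by_left_def right_by_left_def
         left_by_right_def right_by_right_def\<close>)
qed

lemma mixed_coassoc_right:
  assumes "additive3 f" "\<And>r x y z. f (x * sR r) y z = f x (y * tR r) z"
    "\<And>l x y z. f x (tL l * y) z = f x y (sL l * z)"
  shows "SL a (\<lambda>x y. SR x (\<lambda>u v. f u v y)) = SR a (\<lambda>x y. SL y (\<lambda>u v. f x u v))"
proof -
  have *: "tmap_left (RRLL sL tL sR tR) \<gamma>R (\<gamma>L a) = tmap_right (RRLL sL tL sR tR) \<gamma>L (\<gamma>R a)"
    using compatible unfolding comults_compatible_def by (metis comp_apply)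
  show ?thesis
    by (rule tmap_left_eqD[OF *], unfold RRLL_def, rule subgroup_tens3, rule balanced3_kills)
      (use assms in \<open>simp add: balanced3_additive3 left_by_left_def right_by_left_def
         left_by_right_def right_by_right_def\<close>)
qed

text \<open>By (a), \<open>sR r\<close> is some \<open>tL l\<close>, so the rules of
  \<open>\<gamma>L\<close> for its own base ring also govern scalars from \<open>R\<close>. The
  lemmas that follow are of the same kind.\<close>

lemma SL_mult_sR:
  assumes f: "balL f"
  shows "SL (a * sR r) f = SL a (\<lambda>x y. f x (y * sR r))"
  by (metis L.left_balanced_sum_mult_t[OF f] obtain_sR)

lemma SL_mult_tR:
  assumes f: "balL f"
  shows "SL (a * tR r) f = SL a (\<lambda>x y. f (x * tR r) y)"
  by (metis L.left_balanced_sum_mult_s[OF f] obtain_tR)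

lemma SL_sR: "balL f \<Longrightarrow> SL (sR r) f = f 1 (sR r)"
  by (metis L.left_balanced_sum_of_t obtain_sR)

lemma SL_tR: "balL f \<Longrightarrow> SL (tR r) f = f (tR r) 1"
  by (metis L.left_balanced_sum_of_s obtain_tR)

lemma SR_mult_sL:
  assumes f: "balR f"
  shows "SR (a * sL l) f = SR a (\<lambda>x y. f (x * sL l) y)"
  by (metis R.right_balanced_sum_t[OF f] obtain_sL)

lemma SR_tL_mult:
  assumes f: "balR f"
  shows "SR (tL l * a) f = SR a (\<lambda>x y. f x (tL l * y))"
  by (metis R.right_balanced_sum_s_mult[OF f] obtain_tL)

lemma SR_sL_mult:
  assumes f: "balR f"
  shows "SR (sL l * a) f = SR a (\<lambda>x y. f (sL l * x) y)"
  by (metis R.right_balanced_sum_t_mult[OF f] obtain_sL)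

end

text \<open>Conditions (c) and (d), with bijectivity of \<open>S\<close> kept separate: the map
  built from the Galois maps is first shown to be an antipode in this sense and only then to be
  invertible.\<close>

locale antipode = mixed_pair sL tL \<gamma>L \<pi>L sR tR \<gamma>R \<pi>R
  for sL tL :: "'l::{ring,monoid_mult} \<Rightarrow> 'a::{ring,monoid_mult}"
    and \<gamma>L \<pi>L and sR tR :: "'r::{ring,monoid_mult} \<Rightarrow> 'a" and \<gamma>R \<pi>R +
  fixes S :: "'a \<Rightarrow> 'a"
  assumes S_add: "S (a + b) = S a + S b"
    and S_tL: "S (tL l * a * tL l') = sL l' * S a * sL l"
    and S_tR: "S (tR r' * a * tR r) = sR r * S a * sR r'"
    and S_left: "SL a (\<lambda>x y. S x * y) = sR (\<pi>R a)"
    and S_right: "SR a (\<lambda>x y. x * S y) = sL (\<pi>L a)"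
begin

lemma additive_S: "additive S"
  by (rule additiveI) (rule S_add)

lemma S_tL_mult: "S (tL l * a) = S a * sL l" and S_mult_tL: "S (a * tL l) = sL l * S a"
  using S_tL[of l a 1] S_tL[of 1 a l] by (simp_all add: L.t_1 L.s_1)

lemma S_tR_mult: "S (tR r * a) = S a * sR r" and S_mult_tR: "S (a * tR r) = sR r * S a"
  using S_tR[of r a 1] S_tR[of 1 a r] by (simp_all add: R.t_1 R.s_1)

lemma balL_S: "balL (\<lambda>x y. S x * y)"
  by (rule left_balancedI) (simp_all add: S_add S_tL_mult algebra_simps)

lemma balR_S: "balR (\<lambda>x y. x * S y)"
  by (rule right_balancedI) (simp_all add: S_add S_mult_tR algebra_simps)

lemma S_1: "S 1 = 1"
  using S_left[of 1] L.left_balanced_sum_1[OF balL_S] by (simp add: R.counit_one R.s_1)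

lemma S_of_tL: "S (tL l) = sL l" and S_of_tR: "S (tR r) = sR r"
  using S_tL_mult[of l 1] S_tR_mult[of r 1] by (simp_all add: S_1)

lemma sum_S_left:
  assumes "additive h"
  shows "SL a (\<lambda>x y. h (S x * y)) = h (sR (\<pi>R a))"
  by (simp add: ssum_additive[OF assms] S_left)

lemma sum_S_right:
  assumes "additive h"
  shows "SR a (\<lambda>x y. h (x * S y)) = h (sL (\<pi>L a))"
  by (simp add: ssum_additive[OF assms] S_right)

text \<open>Apply \<open>S\<close> to the counit identity
  \<open>a = t\<^sub>L(\<pi>\<^sub>L(a\<^sub>2)) a\<^sub>1\<close>.\<close>

lemma S_eq_sum_L: "S a = SL a (\<lambda>x y. S x * sL (\<pi>L y))"
  using L.sum_counit_right[OF additive_S, of a] by (simp add: S_tL_mult)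

lemma S_eq_sum_R: "S a = SR a (\<lambda>x y. sR (\<pi>R x) * S y)"
  using R.sum_counit_left[OF additive_S, of a] by (simp add: S_mult_tR)

lemma balL_S_counit: "balL (\<lambda>x y. S x * sL (\<pi>L y))"
  by (rule left_balancedI)
    (simp_all add: S_add S_tL_mult L.counit_add L.s_add L.counit_s L.s_mult distrib_left distrib_right mult.assoc)

lemma balR_S_counit: "balR (\<lambda>x y. sR (\<pi>R x) * S y)"
  by (rule right_balancedI)
    (simp_all add: S_add S_mult_tR R.counit_add R.s_add R.counit_s R.s_mult distrib_left distrib_right mult.assoc)

text \<open>Replace \<open>b\<close> by \<open>s\<^sub>L(\<pi>\<^sub>L(b))\<close> under the counit,
  use the second equation of (d), and note that \<open>\<gamma>R\<close> puts a right factor from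
  \<open>sL\<close> into its first leg.\<close>

lemma sL_counit_mult: "sL (\<pi>L (a * b)) = SR a (\<lambda>x y. x * sL (\<pi>L b) * S y)"
  using S_right[of "a * sL (\<pi>L b)"] by (simp add: L.counit_source SR_mult_sL[OF balR_S])

text \<open>Expand \<open>s\<^sub>L(\<pi>\<^sub>L(b\<^sub>2))\<close> as
  \<open>b\<^sub>2\<^sup>1 S(b\<^sub>2\<^sup>2)\<close>. Mixed coassociativity in \<open>b\<close>
  then produces \<open>S((a b\<^sup>1)\<^sub>1) (a b\<^sup>1)\<^sub>2\<close>, which collapses to
  \<open>s\<^sub>R(\<pi>\<^sub>R(a b\<^sup>1))\<close>.\<close>

lemma S_mult_inner:
  "SL a (\<lambda>x y. SL b (\<lambda>u v. S (x * u) * y * sL (\<pi>L v))) = S b * sR (\<pi>R a)"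
proof -
  \<comment> \<open>The sum over \<open>a\<close> must be kept inside \<open>H\<close>: the scalar
    relation between \<open>u\<close> and \<open>m\<close> holds only after summation, by the
    Takeuchi axiom.\<close>
  define H where "H u m n = SL a (\<lambda>x y. S (x * u) * (y * m)) * S n" for u m n
  note sum_adds = S_add distrib_left distrib_right ssum_fun_add
  have "SL a (\<lambda>x y. SL b (\<lambda>u v. S (x * u) * y * sL (\<pi>L v)))
      = SL a (\<lambda>x y. SL b (\<lambda>u v. SR v (\<lambda>m n. S (x * u) * (y * m) * S n)))"
    by (simp add: ssum_mult_left mult.assoc flip: S_right)
  also have "\<dots> = SL b (\<lambda>u v. SR v (\<lambda>m n. SL a (\<lambda>x y. S (x * u) * (y * m) * S n)))"
    by (subst ssum_swap) (subst (2) ssum_swap, rule refl)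
  also have "\<dots> = SL b (\<lambda>u v. SR v (\<lambda>m n. H u m n))"
    by (simp add: H_def ssum_mult_right)
  also have "\<dots> = SR b (\<lambda>w n. SL w (\<lambda>u m. H u m n))"
  proof (rule mixed_coassoc_left[symmetric])
    show "additive3 H"
      by (rule additive3I) (simp_all add: H_def sum_adds)
    show "H (tL l * u) m n = H u (sL l * m) n" for l u m n
      using left_balancedD(3)[OF L.left_balanced_sum_shift[OF balL_S]] by (simp add: H_def)
    show "H u (m * sR r) n = H u m (n * tR r)" for r u m n
      by (simp add: H_def S_mult_tR ssum_mult_right flip: mult.assoc)
  qed
  also have "\<dots> = SR b (\<lambda>w n. SL (a * w) (\<lambda>x y. S x * y) * S n)"
    by (simp add: H_def L.left_balanced_sum_mult'[OF balL_S] ssum_mult_right)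
  also have "\<dots> = SR b (\<lambda>w n. sR (\<pi>R (sR (\<pi>R a) * w)) * S n)"
    by (simp add: S_left R.counit_source)
  \<comment> \<open>The Takeuchi axiom carries the scalar to the second leg, where \<open>S\<close>
    releases it on the right end of the product.\<close>
  also have "\<dots> = SR b (\<lambda>w n. sR (\<pi>R w) * S (tR (\<pi>R a) * n))"
    by (rule R.right_balanced_sum_takeuchi[OF balR_S_counit])
  also have "\<dots> = S b * sR (\<pi>R a)"
    by (subst S_eq_sum_R[of b]) (simp add: S_tR_mult ssum_mult_right mult.assoc)
  finally show ?thesis .
qed

text \<open>In \<open>S(a\<^sub>1b\<^sub>1) s\<^sub>L(\<pi>\<^sub>L(a\<^sub>2b\<^sub>2))\<close> the
  second factor is expanded along \<open>a\<^sub>2\<close>. After mixed coassociativity in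
  \<open>a\<close>, the sum over \<open>b\<close> is the one evaluated in
  \<open>S_mult_inner\<close>.\<close>

lemma S_mult: "S (a * b) = S b * S a"
proof -
  define F where "F x p q = SL b (\<lambda>u v. S (x * u) * p * sL (\<pi>L v) * S q)" for x p q
  note sum_adds = S_add distrib_left distrib_right ssum_fun_add
  have "S (a * b) = SL a (\<lambda>x y. SL b (\<lambda>u v. S (x * u) * sL (\<pi>L (y * v))))"
    by (subst S_eq_sum_L) (rule L.left_balanced_sum_mult[OF balL_S_counit])
  also have "\<dots> = SL a (\<lambda>x y. SL b (\<lambda>u v. SR y (\<lambda>p q. S (x * u) * p * sL (\<pi>L v) * S q)))"
    by (simp add: sL_counit_mult ssum_mult_left mult.assoc)
  also have "\<dots> = SL a (\<lambda>x y. SR y (\<lambda>p q. F x p q))"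
    unfolding F_def by (subst (2) ssum_swap) (rule refl)
  also have "\<dots> = SR a (\<lambda>x q. SL x (\<lambda>z p. F z p q))"
  proof (rule mixed_coassoc_left[symmetric])
    show "additive3 F"
      by (rule additive3I) (simp_all add: F_def sum_adds)
    show "F (tL l * x) p q = F x (sL l * p) q" for l x p q
      by (simp add: F_def S_tL_mult mult.assoc)
    show "F x (p * sR r) q = F x p (q * tR r)" for r x p q
      by (simp add: F_def S_mult_tR mult.assoc sR_sL_mult)
  qed
  also have "\<dots> = SR a (\<lambda>x q. SL x (\<lambda>z p. SL b (\<lambda>u v. S (z * u) * p * sL (\<pi>L v))) * S q)"
    by (simp add: F_def ssum_mult_right)
  also have "\<dots> = S b * SR a (\<lambda>x q. sR (\<pi>R x) * S q)"
    by (simp only: S_mult_inner) (simp add: ssum_mult_left mult.assoc)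
  also have "\<dots> = S b * S a"
    by (simp flip: S_eq_sum_R)
  finally show ?thesis .
qed

text \<open>This says \<open>\<gamma>\<^sub>L(b\<^sup>1)(1 \<otimes> S(b\<^sup>2)) = b \<otimes>
  1\<close>. Mixed coassociativity brings out \<open>b\<^sub>2\<^sup>1 S(b\<^sub>2\<^sup>2) =
  s\<^sub>L(\<pi>\<^sub>L(b\<^sub>2))\<close>, and the counit removes it.\<close>

lemma sum_comult_S:
  assumes f: "balL f"
  shows "SR b (\<lambda>x y. SL x (\<lambda>u v. f u (v * S y))) = f b 1"
proof -
  note [simp] = left_balancedD[OF f]
  have "SR b (\<lambda>x y. SL x (\<lambda>u v. f u (v * S y))) = SL b (\<lambda>x y. SR y (\<lambda>u v. f x (u * S v)))"
    by (rule mixed_coassoc_left)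
      (simp_all add: additive3_def S_add S_mult_tR distrib_left distrib_right mult.assoc)
  also have "\<dots> = SL b (\<lambda>x y. f (tL (\<pi>L y) * x) 1)"
    by (simp add: sum_S_right[OF left_balanced_additive(2)[OF f]])
  also have "\<dots> = f b 1"
    by (rule L.sum_counit_right[OF left_balanced_additive(1)[OF f]])
  finally show ?thesis .
qed

text \<open>With \<open>y \<otimes> 1 = \<gamma>\<^sub>L(y\<^sup>1)(1 \<otimes>
  S(y\<^sup>2))\<close>, multiplicativity merges the two comultiplications into
  \<open>\<gamma>\<^sub>L(S(x) y\<^sup>1)\<close>. Mixed coassociativity makes the argument a value
  of \<open>s\<^sub>R\<close>, whose comultiplication is known.\<close>

lemma antipode_identity_S:
  assumes f: "balL f"
  shows "SL a (\<lambda>x y. SL (S x) (\<lambda>u v. f (u * y) v)) = f 1 (S a)"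
proof -
  note fD = left_balancedD[OF f]
  have f': "balL (\<lambda>u v. f u (v * c))" for c
    by (rule left_balancedI) (simp_all add: fD distrib_right mult.assoc)
  define F where "F x p q = SL (S x * p) (\<lambda>u v. f u (v * S q))" for x p q
  have F_add: "F (x + x') p q = F x p q + F x' p q" "F x (p + p') q = F x p q + F x p' q"
    "F x p (q + q') = F x p q + F x p q'" for x x' p p' q q'
    by (simp_all add: F_def S_add distrib_left distrib_right fD ssum_fun_add L.left_balanced_sum_add[OF f'])
  have "SL a (\<lambda>x y. SL (S x) (\<lambda>u v. f (u * y) v)) = SL a (\<lambda>x y. SR y (\<lambda>p q. F x p q))"
  proof -
    have "SL (S x) (\<lambda>u v. f (u * y) v) = SR y (\<lambda>p q. F x p q)" for x y
      using sum_comult_S[OF L.left_balanced_sum_shift[OF f, of "S x"], of y]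
      by (simp add: F_def L.left_balanced_sum_mult'[OF f'] mult.assoc)
    then show ?thesis by simp
  qed
  also have "\<dots> = SR a (\<lambda>x q. SL x (\<lambda>z p. F z p q))"
  proof (rule mixed_coassoc_left[symmetric])
    show "additive3 F"
      by (rule additive3I) (rule F_add)+
    show "F (tL l * x) p q = F x (sL l * p) q" for l x p q
      by (simp add: F_def S_tL_mult mult.assoc)
    show "F x (p * sR r) q = F x p (q * tR r)" for r x p q
      by (simp add: F_def S_mult_tR mult.assoc SL_mult_sR[OF f', where a = "S x * p", unfolded mult.assoc])
  qed
  also have "\<dots> = SR a (\<lambda>x q. f 1 (sR (\<pi>R x) * S q))"
    unfolding F_def by (simp add: sum_S_left[OF L.left_balanced_sum_additive[OF f']] SL_sR[OF f'])
  also have "\<dots> = f 1 (S a)"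
    by (subst (2) S_eq_sum_R) (rule ssum_additive[OF left_balanced_additive(2)[OF f]])
  finally show ?thesis .
qed

end

section \<open>Bijective antipodes and the passage from (iii) to (i)\<close>

locale bijective_antipode = antipode sL tL \<gamma>L \<pi>L sR tR \<gamma>R \<pi>R S
  for sL tL :: "'l::{ring,monoid_mult} \<Rightarrow> 'a::{ring,monoid_mult}"
    and \<gamma>L \<pi>L and sR tR :: "'r::{ring,monoid_mult} \<Rightarrow> 'a" and \<gamma>R \<pi>R S +
  assumes bij_S: "bij S"
begin

abbreviation S' where "S' \<equiv> inv S"

lemma S_S' [simp]: "S (S' a) = a" and S'_S [simp]: "S' (S a) = a"
  using bij_S by (simp_all add: bij_is_surj bij_is_inj surj_f_inv_f)

lemma S'_eqI: "S b = a \<Longrightarrow> S' a = b"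
  by auto

lemma S'_add: "S' (a + b) = S' a + S' b" and S'_mult: "S' (a * b) = S' b * S' a" and S'_1: "S' 1 = 1"
  by (simp_all add: S'_eqI S_add S_mult S_1)

lemma S'_sL: "S' (sL l) = tL l" and S'_sR: "S' (sR r) = tR r"
  by (simp_all add: S'_eqI S_of_tL S_of_tR)

lemma S'_right: "SR a (\<lambda>x y. y * S' x) = tL (\<pi>L a)"
proof -
  have "S (SR a (\<lambda>x y. y * S' x)) = S (tL (\<pi>L a))"
    by (simp add: additive_ssum[OF additive_S] S_mult S_right S_of_tL)
  then show ?thesis by (metis S'_S)
qed

lemma S'_left: "SL a (\<lambda>x y. S' y * x) = tR (\<pi>R a)"
proof -
  have "S (SL a (\<lambda>x y. S' y * x)) = S (tR (\<pi>R a))"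
    by (simp add: additive_ssum[OF additive_S] S_mult S_left S_of_tR)
  then show ?thesis by (metis S'_S)
qed

lemma sum_S'_left:
  assumes "additive h"
  shows "SL a (\<lambda>x y. h (S' y * x)) = h (tR (\<pi>R a))"
  by (simp add: ssum_additive[OF assms] S'_left)

text \<open>This says \<open>\<gamma>\<^sub>L(b\<^sup>2)(S\<^sup>-\<^sup>1(b\<^sup>1) \<otimes> 1) =
  1 \<otimes> b\<close>. The other mixed identity yields
  \<open>t\<^sub>L(\<pi>\<^sub>L(b\<^sub>1))\<close> in the first leg, which is moved to the second
  and absorbed by the counit.\<close>

lemma sum_comult_S':
  assumes f: "balL f"
  shows "SR b (\<lambda>x y. SL y (\<lambda>u v. f (u * S' x) v)) = f 1 b"
proof -
  note [simp] = left_balancedD[OF f]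
  have "SR b (\<lambda>x y. SL y (\<lambda>u v. f (u * S' x) v)) = SL b (\<lambda>x y. SR x (\<lambda>u v. f (v * S' u) y))"
    by (rule mixed_coassoc_right[symmetric])
      (simp_all add: additive3_def S'_add S'_mult S'_sR distrib_left distrib_right mult.assoc)
  also have "\<dots> = SL b (\<lambda>x y. f 1 (sL (\<pi>L x) * y))"
    by (simp add: ssum_additive[OF left_balanced_additive(1)[OF f]] S'_right
        flip: left_balancedD(3)[OF f])
  also have "\<dots> = f 1 b"
    by (rule L.sum_counit_left[OF left_balanced_additive(2)[OF f]])
  finally show ?thesis .
qed

text \<open>As in \<open>antipode_identity_S\<close>, now with \<open>1 \<otimes> x\<close> written
  as \<open>\<gamma>\<^sub>L(x\<^sup>2)(S\<^sup>-\<^sup>1(x\<^sup>1) \<otimes> 1)\<close> and the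
  second mixed identity.\<close>

lemma antipode_identity_S':
  assumes f: "balL f"
  shows "SL a (\<lambda>x y. SL (S' y) (\<lambda>u v. f u (v * x))) = f (S' a) 1"
proof -
  note fD = left_balancedD[OF f]
  have f': "balL (\<lambda>u v. f (u * c) v)" for c
    by (rule left_balancedI) (simp_all add: fD distrib_right mult.assoc)
  define F where "F p q y = SL (S' y * q) (\<lambda>u v. f (u * S' p) v)" for p q y
  have F_add: "F (p + p') q y = F p q y + F p' q y" "F p (q + q') y = F p q y + F p q' y"
    "F p q (y + y') = F p q y + F p q y'" for y y' p p' q q'
    by (simp_all add: F_def S'_add distrib_left distrib_right fD ssum_fun_add L.left_balanced_sum_add[OF f'])
  have "SL a (\<lambda>x y. SL (S' y) (\<lambda>u v. f u (v * x))) = SL a (\<lambda>x y. SR x (\<lambda>p q. F p q y))"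
  proof -
    have "SL (S' y) (\<lambda>u v. f u (v * x)) = SR x (\<lambda>p q. F p q y)" for x y
      using sum_comult_S'[OF L.left_balanced_sum_shift[OF f, of "S' y"], of x]
      by (simp add: F_def L.left_balanced_sum_mult'[OF f'] mult.assoc)
    then show ?thesis by simp
  qed
  also have "\<dots> = SR a (\<lambda>p w. SL w (\<lambda>q y. F p q y))"
  proof (rule mixed_coassoc_right)
    show "additive3 F"
      by (rule additive3I) (rule F_add)+
    show "F (p * sR r) q y = F p (q * tR r) y" for r p q y
      by (simp add: F_def S'_mult S'_sR mult.assoc SL_mult_tR[OF f', where a = "S' y * q", unfolded mult.assoc])
    show "F p (tL l * q) y = F p q (sL l * y)" for l p q y
      by (simp add: F_def S'_mult S'_sL mult.assoc)
  qed
  also have "\<dots> = SR a (\<lambda>p w. f (tR (\<pi>R w) * S' p) 1)"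
    unfolding F_def
    by (simp add: ssum_additive[OF L.left_balanced_sum_additive[OF f']] S'_left SL_tR[OF f'])
  also have "\<dots> = SR a (\<lambda>p w. f (S' (p * sR (\<pi>R w))) 1)"
    by (simp add: S'_mult S'_sR)
  also have "\<dots> = f (S' a) 1"
    by (rule R.sum_counit_right) (simp add: additive_def S'_add fD)
  finally show ?thesis .
qed

theorem hopf_algebroid: "hopf_algebroid sL tL \<gamma>L \<pi>L S"
  unfolding hopf_algebroid_def
proof (intro conjI allI)
  show "left_bialgebroid sL tL \<gamma>L \<pi>L" by (rule L.left_bialgebroid_axioms)
  show "bij S" by (rule bij_S)
  show "ring_antimap S" by (simp add: ring_antimap_def S_add S_mult S_1)
  show "S \<circ> tL = sL" by (simp add: fun_eq_iff S_of_tL)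
  fix a
  show "tmap (LL sL tL) (\<lambda>(x, y). frag_extend (\<lambda>(u, v). frag_of (u, v * x)) (rep (\<gamma>L (S' y)))) (\<gamma>L a)
      = frag_of (S' a, 1) +o LL sL tL"
    using antipode_identity_S'[OF left_balanced_elem, of a]
    by (simp only: tmap_eq_coset_iff[OF subgroup_LL] qclass_norm)
  show "tmap (LL sL tL) (\<lambda>(x, y). frag_extend (\<lambda>(u, v). frag_of (u * y, v)) (rep (\<gamma>L (S x)))) (\<gamma>L a)
      = frag_of (1, S a) +o LL sL tL"
    using antipode_identity_S[OF left_balanced_elem, of a]
    by (simp only: tmap_eq_coset_iff[OF subgroup_LL] qclass_norm)
qed

end

section \<open>The Galois maps\<close>

lemma kills_qclass:
  assumes "subgroup N"
  shows "kills (\<lambda>p. qclass N (frag_of p)) N"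
  unfolding kills_def
proof
  fix x assume "x \<in> N"
  then have "qclass N x = qclass N 0" using assms by (simp add: qclass_eq_iff)
  then show "frag_sum (\<lambda>p. qclass N (frag_of p)) x = 0"
    using additive.zero[OF additive_qclass, of N]
    unfolding qclass_frag_extend[symmetric] frag_expansion[symmetric] by simp
qed

text \<open>The representative chosen between the two maps is determined up to \<open>N'\<close>,
  which \<open>g\<close> kills, so the composite may be computed on elementary tensors.\<close>

lemma tmap_left_inverse:
  assumes N: "subgroup N" and N': "subgroup N'" and g: "kills (\<lambda>p. qclass N (g p)) N'"
    and gf: "\<And>p. frag_sum (\<lambda>q. qclass N (g q)) (f p) = qclass N (frag_of p)" and t: "t \<in> tensor N"
  shows "tmap N g (tmap N' f t) = t"
proof (rule tensor_eqI[OF N _ t])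
  have "tval (\<lambda>p. qclass N (frag_of p)) (tmap N g (tmap N' f t)) = tval (\<lambda>p. qclass N (g p)) (tmap N' f t)"
    unfolding tval_tmap[OF N kills_qclass[OF N]] qclass_frag_extend[symmetric] frag_expansion[symmetric] ..
  also have "\<dots> = tval (\<lambda>p. qclass N (frag_of p)) t"
    by (simp add: tval_tmap[OF N' g] gf)
  finally show "tval (\<lambda>p. qclass N (frag_of p)) (tmap N g (tmap N' f t)) = tval (\<lambda>p. qclass N (frag_of p)) t" .
qed simp

lemma tmap_bij_betw:
  assumes N: "subgroup N" and N': "subgroup N'"
    and f: "kills (\<lambda>p. qclass N' (f p)) N" and g: "kills (\<lambda>p. qclass N (g p)) N'"
    and gf: "\<And>p. frag_sum (\<lambda>q. qclass N (g q)) (f p) = qclass N (frag_of p)"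
    and fg: "\<And>p. frag_sum (\<lambda>q. qclass N' (f q)) (g p) = qclass N' (frag_of p)"
  shows "bij_betw (tmap N' f) (tensor N) (tensor N')"
  by (rule bij_betw_byWitness[where f' = "tmap N g"])
    (auto simp: tmap_left_inverse[OF N N' g gf] tmap_left_inverse[OF N' N f fg])

section \<open>The domains of the Galois maps, and why the maps are well defined\<close>

definition alpha_balanced :: "('r \<Rightarrow> 'a::{ring,monoid_mult}) \<Rightarrow> ('a \<Rightarrow> 'a \<Rightarrow> 'b::ab_group_add) \<Rightarrow> bool" where
  "alpha_balanced s f \<longleftrightarrow>
     (\<forall>x x' y. f (x + x') y = f x y + f x' y) \<and>
     (\<forall>x y y'. f x (y + y') = f x y + f x y') \<and>
     (\<forall>r x y. f (x * s r) y = f x (s r * y))"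

definition beta_balanced :: "('r \<Rightarrow> 'a::{ring,monoid_mult}) \<Rightarrow> ('a \<Rightarrow> 'a \<Rightarrow> 'b::ab_group_add) \<Rightarrow> bool" where
  "beta_balanced t f \<longleftrightarrow>
     (\<forall>x x' y. f (x + x') y = f x y + f x' y) \<and>
     (\<forall>x y y'. f x (y + y') = f x y + f x y') \<and>
     (\<forall>r x y. f (t r * x) y = f x (y * t r))"

lemma alpha_balanced_iff:
  "alpha_balanced s f \<longleftrightarrow> balanced (right_by_right s) (left_by_left s) f"
  by (auto simp: alpha_balanced_def balanced_def right_by_right_def left_by_left_def)

lemma beta_balanced_iff:
  "beta_balanced t f \<longleftrightarrow> balanced (right_by_left t) (left_by_right t) f"
  by (auto simp: beta_balanced_def balanced_def right_by_left_def left_by_right_def)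

lemma alpha_balancedI:
  assumes "\<And>x x' y. f (x + x') y = f x y + f x' y" "\<And>x y y'. f x (y + y') = f x y + f x y'"
    "\<And>r x y. f (x * s r) y = f x (s r * y)"
  shows "alpha_balanced s f"
  using assms by (simp add: alpha_balanced_def)

lemma beta_balancedI:
  assumes "\<And>x x' y. f (x + x') y = f x y + f x' y" "\<And>x y y'. f x (y + y') = f x y + f x y'"
    "\<And>r x y. f (t r * x) y = f x (y * t r)"
  shows "beta_balanced t f"
  using assms by (simp add: beta_balanced_def)

lemma alpha_balancedD:
  assumes "alpha_balanced s f"
  shows "f (x + x') y = f x y + f x' y" "f x (y + y') = f x y + f x y'" "f (x * s r) y = f x (s r * y)"
  using assms by (auto simp: alpha_balanced_def)

lemma beta_balancedD:
  assumes "beta_balanced t f"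
  shows "f (x + x') y = f x y + f x' y" "f x (y + y') = f x y + f x y'" "f (t r * x) y = f x (y * t r)"
  using assms by (auto simp: beta_balanced_def)

lemma alpha_balanced_additive:
  assumes "alpha_balanced s f"
  shows "additive (\<lambda>x. f x y)" "additive (f x)"
  using alpha_balancedD[OF assms] by (auto simp: additive_def)

lemma beta_balanced_additive:
  assumes "beta_balanced s f"
  shows "additive (\<lambda>x. f x y)" "additive (f x)"
  using beta_balancedD[OF assms] by (auto simp: additive_def)

abbreviation "alpha_tens s \<equiv> tens2 (right_by_right s) (left_by_left s)"
abbreviation "beta_tens t \<equiv> tens2 (right_by_left t) (left_by_right t)"

lemma alpha_balanced_elem: "alpha_balanced s (elem (alpha_tens s))"
  unfolding alpha_balanced_iff by (rule balanced_elem)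

lemma beta_balanced_elem: "beta_balanced t (elem (beta_tens t))"
  unfolding beta_balanced_iff by (rule balanced_elem)

lemma alpha_balanced_kills: "alpha_balanced s f \<Longrightarrow> kills (\<lambda>(x, y). f x y) (alpha_tens s)"
  unfolding alpha_balanced_iff by (rule balanced_kills)

lemma beta_balanced_kills: "beta_balanced t f \<Longrightarrow> kills (\<lambda>(x, y). f x y) (beta_tens t)"
  unfolding beta_balanced_iff by (rule balanced_kills)

context mixed_pair
begin

abbreviation "balA \<equiv> alpha_balanced sR"
abbreviation "balB \<equiv> beta_balanced tR"

lemma balA_galois:
  assumes f: "balL f"
  shows "balA (\<lambda>a b. SL a (\<lambda>u v. f u (v * b)))"
proof -
  note [simp] = left_balancedD[OF f]
  have f': "balL (\<lambda>u v. f u (v * b))" for b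
    by (rule left_balancedI) (simp_all add: distrib_right mult.assoc)
  show ?thesis
    by (rule alpha_balancedI)
      (simp_all add: distrib_left ssum_fun_add L.left_balanced_sum_add[OF f'] SL_mult_sR[OF f'] mult.assoc)
qed

lemma balB_galois:
  assumes f: "balL f"
  shows "balB (\<lambda>a b. SL b (\<lambda>u v. f (u * a) v))"
proof -
  note [simp] = left_balancedD[OF f]
  have f': "balL (\<lambda>u v. f (u * a) v)" for a
    by (rule left_balancedI) (simp_all add: distrib_right mult.assoc)
  show ?thesis
    by (rule beta_balancedI)
      (simp_all add: distrib_left ssum_fun_add L.left_balanced_sum_add[OF f'] SL_mult_tR[OF f'] mult.assoc)
qed

end

section \<open>Inverses of the Galois maps in the presence of an antipode\<close>

context bijective_antipode
begin

text \<open>Mixed coassociativity forms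
  \<open>S(w\<^sub>1) w\<^sub>2 = s\<^sub>R(\<pi>\<^sub>R(w))\<close> for
  \<open>w = a\<^sup>2\<close>; this scalar crosses to the first leg and the counit of
  \<open>\<gamma>R\<close> removes it.\<close>

lemma alpha_left_inverse:
  assumes f: "balA f"
  shows "SL a (\<lambda>u v. SR u (\<lambda>p q. f p (S q * (v * b)))) = f a b"
proof -
  note [simp] = alpha_balancedD[OF f]
  have "SL a (\<lambda>u v. SR u (\<lambda>p q. f p (S q * (v * b)))) = SR a (\<lambda>p w. SL w (\<lambda>q v. f p (S q * (v * b))))"
    by (rule mixed_coassoc_right)
      (simp_all add: additive3_def S_add S_mult_tR S_tL_mult distrib_left distrib_right mult.assoc)
  also have "\<dots> = SR a (\<lambda>p w. f (p * sR (\<pi>R w)) b)"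
    using sum_S_left[of "\<lambda>z. f p (z * b)" for p] by (simp add: additive_def distrib_right mult.assoc)
  also have "\<dots> = f a b"
    by (rule R.sum_counit_right[OF alpha_balanced_additive(1)[OF f]])
  finally show ?thesis .
qed

lemma alpha_right_inverse:
  assumes f: "balL f"
  shows "SR a (\<lambda>p q. SL p (\<lambda>u v. f u (v * (S q * b)))) = f a b"
proof -
  have "balL (\<lambda>u v. f u (v * b))"
    by (rule left_balancedI) (simp_all add: left_balancedD[OF f] distrib_right mult.assoc)
  from sum_comult_S[OF this] show ?thesis by (simp add: mult.assoc)
qed

text \<open>The same scheme with \<open>S\<^sup>-\<^sup>1(w\<^sub>2) w\<^sub>1 =
  t\<^sub>R(\<pi>\<^sub>R(w))\<close> for \<open>w = b\<^sup>1\<close>.\<close>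

lemma beta_left_inverse:
  assumes f: "balB f"
  shows "SL b (\<lambda>u v. SR v (\<lambda>p q. f (S' p * (u * a)) q)) = f a b"
proof -
  note [simp] = beta_balancedD[OF f]
  have "SL b (\<lambda>u v. SR v (\<lambda>p q. f (S' p * (u * a)) q)) = SR b (\<lambda>w q. SL w (\<lambda>u p. f (S' p * (u * a)) q))"
    by (rule mixed_coassoc_left[symmetric])
      (simp_all add: additive3_def S'_add S'_mult S'_sL S'_sR distrib_left distrib_right mult.assoc)
  also have "\<dots> = SR b (\<lambda>w q. f a (q * tR (\<pi>R w)))"
    using sum_S'_left[of "\<lambda>z. f (z * a) q" for q]
    by (simp add: additive_def distrib_right flip: mult.assoc)
  also have "\<dots> = f a b"
    by (rule R.sum_counit_left[OF beta_balanced_additive(2)[OF f]])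
  finally show ?thesis .
qed

lemma beta_right_inverse:
  assumes f: "balL f"
  shows "SR b (\<lambda>p q. SL q (\<lambda>u v. f (u * (S' p * a)) v)) = f a b"
proof -
  have "balL (\<lambda>u v. f (u * a) v)"
    by (rule left_balancedI) (simp_all add: left_balancedD[OF f] distrib_right mult.assoc)
  from sum_comult_S'[OF this] show ?thesis by (simp add: mult.assoc)
qed

lemma balL_alpha_inverse:
  assumes f: "balA f"
  shows "balL (\<lambda>a b. SR a (\<lambda>p q. f p (S q * b)))"
proof -
  note [simp] = alpha_balancedD[OF f]
  have f': "balR (\<lambda>p q. f p (S q * b))" for b
    by (rule right_balancedI) (simp_all add: S_add S_mult_tR distrib_right mult.assoc)
  show ?thesis
    by (rule left_balancedI)
      (simp_all add: distrib_left ssum_fun_add R.right_balanced_sum_add[OF f'] SR_tL_mult[OF f'] S_tL_mult mult.assoc)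
qed

lemma balL_beta_inverse:
  assumes f: "balB f"
  shows "balL (\<lambda>a b. SR b (\<lambda>p q. f (S' p * a) q))"
proof -
  note [simp] = beta_balancedD[OF f]
  have f': "balR (\<lambda>p q. f (S' p * a) q)" for a
    by (rule right_balancedI) (simp_all add: S'_add S'_mult S'_sR distrib_right mult.assoc)
  show ?thesis
    by (rule left_balancedI)
      (simp_all add: distrib_left ssum_fun_add R.right_balanced_sum_add[OF f'] SR_sL_mult[OF f'] S'_mult S'_sL mult.assoc)
qed

lemma bij_galois_alpha: "bij_betw (galois_alpha sL tL \<gamma>L) (tensor (alpha_tens sR)) (tensor (LL sL tL))"
  unfolding galois_alpha_def
proof (rule tmap_bij_betw[where g = "\<lambda>(a, b). frag_extend (\<lambda>(p, q). frag_of (p, S q * b)) (rep (\<gamma>R a))"])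
  show "kills (\<lambda>p. qclass (LL sL tL) (case p of (a, b) \<Rightarrow> frag_extend (\<lambda>(u, v). frag_of (u, v * b)) (rep (\<gamma>L a))))
      (alpha_tens sR)"
    using alpha_balanced_kills[OF balA_galois[OF left_balanced_elem]] by (simp only: qclass_norm)
  show "kills (\<lambda>p. qclass (alpha_tens sR) (case p of (a, b) \<Rightarrow> frag_extend (\<lambda>(p, q). frag_of (p, S q * b)) (rep (\<gamma>R a))))
      (LL sL tL)"
    using left_balanced_kills[OF balL_alpha_inverse[OF alpha_balanced_elem]] by (simp only: qclass_norm)
next
  fix p :: "'a \<times> 'a"
  obtain a b where p: "p = (a, b)" by (cases p)
  show "frag_sum (\<lambda>q. qclass (alpha_tens sR) (case q of (a, b) \<Rightarrow> frag_extend (\<lambda>(p, q). frag_of (p, S q * b)) (rep (\<gamma>R a))))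
      (case p of (a, b) \<Rightarrow> frag_extend (\<lambda>(u, v). frag_of (u, v * b)) (rep (\<gamma>L a)))
      = qclass (alpha_tens sR) (frag_of p)"
    using alpha_left_inverse[OF alpha_balanced_elem, where a = a and b = b] by (simp only: p qclass_norm frag_sum_norm)
  show "frag_sum (\<lambda>q. qclass (LL sL tL) (case q of (a, b) \<Rightarrow> frag_extend (\<lambda>(u, v). frag_of (u, v * b)) (rep (\<gamma>L a))))
      (case p of (a, b) \<Rightarrow> frag_extend (\<lambda>(p, q). frag_of (p, S q * b)) (rep (\<gamma>R a)))
      = qclass (LL sL tL) (frag_of p)"
    using alpha_right_inverse[OF left_balanced_elem, where a = a and b = b] by (simp only: p qclass_norm frag_sum_norm)
qed simp_all

lemma bij_galois_beta: "bij_betw (galois_beta sL tL \<gamma>L) (tensor (beta_tens tR)) (tensor (LL sL tL))"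
  unfolding galois_beta_def
proof (rule tmap_bij_betw[where g = "\<lambda>(a, b). frag_extend (\<lambda>(p, q). frag_of (S' p * a, q)) (rep (\<gamma>R b))"])
  show "kills (\<lambda>p. qclass (LL sL tL) (case p of (a, b) \<Rightarrow> frag_extend (\<lambda>(u, v). frag_of (u * a, v)) (rep (\<gamma>L b))))
      (beta_tens tR)"
    using beta_balanced_kills[OF balB_galois[OF left_balanced_elem]] by (simp only: qclass_norm)
  show "kills (\<lambda>p. qclass (beta_tens tR) (case p of (a, b) \<Rightarrow> frag_extend (\<lambda>(p, q). frag_of (S' p * a, q)) (rep (\<gamma>R b))))
      (LL sL tL)"
    using left_balanced_kills[OF balL_beta_inverse[OF beta_balanced_elem]] by (simp only: qclass_norm)
next
  fix p :: "'a \<times> 'a"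
  obtain a b where p: "p = (a, b)" by (cases p)
  show "frag_sum (\<lambda>q. qclass (beta_tens tR) (case q of (a, b) \<Rightarrow> frag_extend (\<lambda>(p, q). frag_of (S' p * a, q)) (rep (\<gamma>R b))))
      (case p of (a, b) \<Rightarrow> frag_extend (\<lambda>(u, v). frag_of (u * a, v)) (rep (\<gamma>L b)))
      = qclass (beta_tens tR) (frag_of p)"
    using beta_left_inverse[OF beta_balanced_elem, where a = a and b = b] by (simp only: p qclass_norm frag_sum_norm)
  show "frag_sum (\<lambda>q. qclass (LL sL tL) (case q of (a, b) \<Rightarrow> frag_extend (\<lambda>(u, v). frag_of (u * a, v)) (rep (\<gamma>L b))))
      (case p of (a, b) \<Rightarrow> frag_extend (\<lambda>(p, q). frag_of (S' p * a, q)) (rep (\<gamma>R b)))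
      = qclass (LL sL tL) (frag_of p)"
    using beta_right_inverse[OF left_balanced_elem, where a = a and b = b] by (simp only: p qclass_norm frag_sum_norm)
qed simp_all

end

section \<open>Construction of the antipode from bijective Galois maps\<close>

locale galois = mixed_pair sL tL \<gamma>L \<pi>L sR tR \<gamma>R \<pi>R
  for sL tL :: "'l::{ring,monoid_mult} \<Rightarrow> 'a::{ring,monoid_mult}"
    and \<gamma>L \<pi>L and sR tR :: "'r::{ring,monoid_mult} \<Rightarrow> 'a" and \<gamma>R \<pi>R +
  assumes bij_alpha: "bij_betw (galois_alpha sL tL \<gamma>L) (tensor (alpha_tens sR)) (tensor (LL sL tL))"
    and bij_beta: "bij_betw (galois_beta sL tL \<gamma>L) (tensor (beta_tens tR)) (tensor (LL sL tL))"
begin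

text \<open>The translation map of \<alpha>. As \<alpha> commutes with right multiplication on the
  second leg, these values determine its whole inverse. \<open>B\<close> plays this role for
  \<beta>.\<close>

definition A :: "'a \<Rightarrow> (('a \<times> 'a) \<Rightarrow>\<^sub>0 int) set" where
  "A a = inv_into (tensor (alpha_tens sR)) (galois_alpha sL tL \<gamma>L) (frag_of (a, 1) +o LL sL tL)"

definition B :: "'a \<Rightarrow> (('a \<times> 'a) \<Rightarrow>\<^sub>0 int) set" where
  "B a = inv_into (tensor (beta_tens tR)) (galois_beta sL tL \<gamma>L) (frag_of (1, a) +o LL sL tL)"

lemma sum_alpha_A:
  assumes "balL f"
  shows "ssum (A a) (\<lambda>p q. SL p (\<lambda>u v. f u (v * q))) = f a 1"
proof -
  have "galois_alpha sL tL \<gamma>L (A a) = frag_of (a, 1) +o LL sL tL"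
    unfolding A_def by (rule bij_betw_inv_into_right[OF bij_alpha]) simp
  from arg_cong[OF this, of "\<lambda>t. ssum t f"] show ?thesis
    unfolding galois_alpha_def
      tval_tmap[OF subgroup_LL left_balanced_kills[OF assms]]
      tval_coset[OF subgroup_LL left_balanced_kills[OF assms]]
    by (simp only: frag_sum_norm)
qed

lemma sum_beta_B:
  assumes "balL f"
  shows "ssum (B a) (\<lambda>p q. SL q (\<lambda>u v. f (u * p) v)) = f 1 a"
proof -
  have "galois_beta sL tL \<gamma>L (B a) = frag_of (1, a) +o LL sL tL"
    unfolding B_def by (rule bij_betw_inv_into_right[OF bij_beta]) simp
  from arg_cong[OF this, of "\<lambda>t. ssum t f"] show ?thesis
    unfolding galois_beta_def
      tval_tmap[OF subgroup_LL left_balanced_kills[OF assms]]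
      tval_coset[OF subgroup_LL left_balanced_kills[OF assms]]
    by (simp only: frag_sum_norm)
qed

text \<open>Injectivity of \<alpha> on formal sums: equality of the images is tested by
  \<open>elem\<close>, and equal tensors give equal sums under every \<open>balA\<close>
  map.\<close>

lemma alpha_inj:
  assumes f: "balA f"
    and eq: "frag_sum (\<lambda>(a, b). SL a (\<lambda>u v. elem (LL sL tL) u (v * b))) x
      = frag_sum (\<lambda>(a, b). SL a (\<lambda>u v. elem (LL sL tL) u (v * b))) y"
  shows "frag_sum (\<lambda>(a, b). f a b) x = frag_sum (\<lambda>(a, b). f a b) y"
proof -
  let ?N = "alpha_tens sR" and ?g = "\<lambda>p. case p of (a, b) \<Rightarrow> frag_extend (\<lambda>(u, v). frag_of (u, v * b)) (rep (\<gamma>L a))"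
  have k: "kills (\<lambda>p. qclass (LL sL tL) (?g p)) ?N"
    using alpha_balanced_kills[OF balA_galois[OF left_balanced_elem]] by (simp only: qclass_norm)
  have "galois_alpha sL tL \<gamma>L (x +o ?N) = galois_alpha sL tL \<gamma>L (y +o ?N)"
    unfolding galois_alpha_def tmap_eq_iff[OF subgroup_LL] tval_coset[OF subgroup_tens2 k]
    using eq by (simp only: qclass_norm)
  then have "x +o ?N = y +o ?N"
    using bij_alpha by (auto simp: bij_betw_def dest: inj_onD)
  then have "tval (\<lambda>(a, b). f a b) (x +o ?N) = tval (\<lambda>(a, b). f a b) (y +o ?N)" by simp
  then show ?thesis by (simp only: tval_coset[OF subgroup_tens2 alpha_balanced_kills[OF f]])
qed

lemma beta_inj:
  assumes f: "balB f"
    and eq: "frag_sum (\<lambda>(a, b). SL b (\<lambda>u v. elem (LL sL tL) (u * a) v)) x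
      = frag_sum (\<lambda>(a, b). SL b (\<lambda>u v. elem (LL sL tL) (u * a) v)) y"
  shows "frag_sum (\<lambda>(a, b). f a b) x = frag_sum (\<lambda>(a, b). f a b) y"
proof -
  let ?N = "beta_tens tR" and ?g = "\<lambda>p. case p of (a, b) \<Rightarrow> frag_extend (\<lambda>(u, v). frag_of (u * a, v)) (rep (\<gamma>L b))"
  have k: "kills (\<lambda>p. qclass (LL sL tL) (?g p)) ?N"
    using beta_balanced_kills[OF balB_galois[OF left_balanced_elem]] by (simp only: qclass_norm)
  have "galois_beta sL tL \<gamma>L (x +o ?N) = galois_beta sL tL \<gamma>L (y +o ?N)"
    unfolding galois_beta_def tmap_eq_iff[OF subgroup_LL] tval_coset[OF subgroup_tens2 k]
    using eq by (simp only: qclass_norm)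
  then have "x +o ?N = y +o ?N"
    using bij_beta by (auto simp: bij_betw_def dest: inj_onD)
  then have "tval (\<lambda>(a, b). f a b) (x +o ?N) = tval (\<lambda>(a, b). f a b) (y +o ?N)" by simp
  then show ?thesis by (simp only: tval_coset[OF subgroup_tens2 beta_balanced_kills[OF f]])
qed

text \<open>The device for all computations with \<open>A\<close>: a formal sum that \<alpha> maps
  to \<open>c \<otimes> 1\<close> may replace the chosen preimage.\<close>

lemma A_unique:
  assumes f: "balA f" and "frag_sum (\<lambda>(a, b). SL a (\<lambda>u v. elem (LL sL tL) u (v * b))) x = elem (LL sL tL) c 1"
  shows "ssum (A c) f = frag_sum (\<lambda>(a, b). f a b) x"
  using alpha_inj[OF f, of "rep (A c)" x] assms(2) sum_alpha_A[OF left_balanced_elem, of c]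
  by (simp only: tval_ext)

lemma B_unique:
  assumes f: "balB f" and "frag_sum (\<lambda>(a, b). SL b (\<lambda>u v. elem (LL sL tL) (u * a) v)) x = elem (LL sL tL) 1 c"
  shows "ssum (B c) f = frag_sum (\<lambda>(a, b). f a b) x"
  using beta_inj[OF f, of "rep (B c)" x] assms(2) sum_beta_B[OF left_balanced_elem, of c]
  by (simp only: tval_ext)

lemma A_add:
  assumes "balA f"
  shows "ssum (A (a + b)) f = ssum (A a) f + ssum (A b) f"
  using A_unique[OF assms, of "rep (A a) + rep (A b)" "a + b"] sum_alpha_A[OF left_balanced_elem]
  by (simp add: frag_sum_add tval_ext left_balancedD[OF left_balanced_elem])

lemma B_add:
  assumes "balB f"
  shows "ssum (B (a + b)) f = ssum (B a) f + ssum (B b) f"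
  using B_unique[OF assms, of "rep (B a) + rep (B b)" "a + b"] sum_beta_B[OF left_balanced_elem]
  by (simp add: frag_sum_add tval_ext left_balancedD[OF left_balanced_elem])

abbreviation "E \<equiv> elem (LL sL tL)"

lemmas E_D = left_balancedD[OF left_balanced_elem]

lemma balL_elem_mult: "balL (\<lambda>u v. E (u * c) (v * d))"
  by (rule left_balancedI) (simp_all add: E_D distrib_right mult.assoc)

lemma A_tL_mult:
  assumes "balA f"
  shows "ssum (A (tL l * a)) f = ssum (A a) (\<lambda>p q. f p (q * sL l))"
  using A_unique[OF assms, of "frag_extend (\<lambda>(p, q). frag_of (p, q * sL l)) (rep (A a))" "tL l * a"]
    sum_alpha_A[OF balL_elem_mult[of 1 "sL l"], of a]
  by (simp only: frag_sum_norm mult.assoc E_D(3) mult_1_left mult_1_right)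

lemma A_mult_sL:
  assumes "balA f"
  shows "ssum (A (a * sL l)) f = ssum (A a) (\<lambda>p q. f (p * sL l) q)"
proof -
  have "SL (p * sL l) (\<lambda>u v. E u (v * q)) = SL p (\<lambda>u v. E (u * sL l) (v * q))" for p q
    using L.left_balanced_sum_mult_s[OF balL_elem_mult[of 1 q]] by simp
  then show ?thesis
    using A_unique[OF assms, of "frag_extend (\<lambda>(p, q). frag_of (p * sL l, q)) (rep (A a))" "a * sL l"]
      sum_alpha_A[OF balL_elem_mult[of "sL l" 1], of a]
    by (simp only: frag_sum_norm mult_1_left mult_1_right)
qed

text \<open>The preimage of \<open>a t\<^sub>L(l) \<otimes> 1\<close> comes from that of
  \<open>a \<otimes> 1\<close> by the Takeuchi axiom of \<open>\<gamma>L\<close>, which trades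
  \<open>tL l\<close> on the first leg for \<open>sL l\<close> on the second.\<close>

lemma A_mult_tL:
  assumes "balA f"
  shows "ssum (A (a * tL l)) f = ssum (A a) (\<lambda>p q. f p (sL l * q))"
proof -
  have "SL p (\<lambda>u v. E u (v * (sL l * q))) = SL p (\<lambda>u v. E (u * tL l) (v * q))" for p q
    using L.left_balanced_sum_takeuchi[OF balL_elem_mult[of 1 q], where a = p and l = l]
    by (simp add: mult.assoc)
  then show ?thesis
    using A_unique[OF assms, of "frag_extend (\<lambda>(p, q). frag_of (p, sL l * q)) (rep (A a))" "a * tL l"]
      sum_alpha_A[OF balL_elem_mult[of "tL l" 1], of a]
    by (simp only: frag_sum_norm mult_1_left mult_1_right)
qed

lemma A_mult_tR:
  assumes "balA f"
  shows "ssum (A (a * tR r)) f = ssum (A a) (\<lambda>p q. f (p * tR r) q)"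
  by (metis A_mult_sL[OF assms] obtain_tR)

lemma B_sL_mult:
  assumes "balB f"
  shows "ssum (B (sL l * a)) f = ssum (B a) (\<lambda>p q. f (p * tL l) q)"
  using B_unique[OF assms, of "frag_extend (\<lambda>(p, q). frag_of (p * tL l, q)) (rep (B a))" "sL l * a"]
    sum_beta_B[OF balL_elem_mult[of "tL l" 1], of a] E_D(3)[where l = l and x = 1 and y = a]
  by (simp only: frag_sum_norm mult.assoc mult_1_left mult_1_right)

text \<open>Applying \<alpha> to \<open>A(a\<^sub>1) a\<^sub>2\<close> gives
  \<open>a\<^sub>1 \<otimes> a\<^sub>2\<close>, which is also the image of
  \<open>a \<otimes> 1\<close>.\<close>

lemma sum_A_alpha:
  assumes "balA f"
  shows "SL a (\<lambda>x y. ssum (A x) (\<lambda>p q. f p (q * y))) = f a 1"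
proof -
  have "SL a (\<lambda>x y. ssum (A x) (\<lambda>p q. SL p (\<lambda>u v. E u (v * (q * y))))) = SL a (\<lambda>x y. E x (y * 1))"
    using sum_alpha_A[OF balL_elem_mult[where c = 1]] by (simp add: mult.assoc)
  then show ?thesis
    using alpha_inj[OF assms, of "frag_extend (\<lambda>(x, y). frag_extend (\<lambda>(p, q). frag_of (p, q * y)) (rep (A x))) (rep (\<gamma>L a))"
      "frag_of (a, 1)"]
    by (simp only: frag_sum_norm)
qed

lemma sum_B_beta:
  assumes "balB f"
  shows "SL a (\<lambda>x y. ssum (B y) (\<lambda>p q. f (p * x) q)) = f 1 a"
proof -
  have "SL a (\<lambda>x y. ssum (B y) (\<lambda>p q. SL q (\<lambda>u v. E (u * (p * x)) v))) = SL a (\<lambda>x y. E (x * 1) y)"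
    using sum_beta_B[OF balL_elem_mult[where d = 1]] by (simp add: mult.assoc)
  then show ?thesis
    using beta_inj[OF assms, of "frag_extend (\<lambda>(x, y). frag_extend (\<lambda>(p, q). frag_of (p * x, q)) (rep (B y))) (rep (\<gamma>L a))"
      "frag_of (1, a)"]
    by (simp only: frag_sum_norm)
qed

definition S :: "'a \<Rightarrow> 'a" where
  "S a = ssum (A a) (\<lambda>p q. sR (\<pi>R p) * q)"

definition T :: "'a \<Rightarrow> 'a" where
  "T a = ssum (B a) (\<lambda>p q. tR (\<pi>R q) * p)"

lemma balA_S: "balA (\<lambda>p q. sR (\<pi>R p) * q)"
  by (rule alpha_balancedI)
    (simp_all add: R.counit_add R.s_add R.counit_s R.s_mult distrib_left distrib_right mult.assoc)

lemma balB_T: "balB (\<lambda>p q. tR (\<pi>R q) * p)"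
  by (rule beta_balancedI)
    (simp_all add: R.counit_add R.t_add R.counit_t R.t_mult distrib_left distrib_right mult.assoc)

lemma S_add: "S (a + b) = S a + S b"
  unfolding S_def by (rule A_add[OF balA_S])

lemma T_add: "T (a + b) = T a + T b"
  unfolding T_def by (rule B_add[OF balB_T])

lemma S_tL_mult: "S (tL l * a) = S a * sL l"
  unfolding S_def A_tL_mult[OF balA_S] by (simp add: ssum_mult_right mult.assoc)

lemma S_mult_tL: "S (a * tL l) = sL l * S a"
  unfolding S_def A_mult_tL[OF balA_S] by (simp add: ssum_mult_left sR_sL_mult)

lemma S_mult_tR: "S (a * tR r) = sR r * S a"
  unfolding S_def A_mult_tR[OF balA_S]
  by (simp add: ssum_mult_left R.counit_t R.s_mult flip: mult.assoc)

lemma T_sL_mult: "T (sL l * a) = T a * tL l"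
  unfolding T_def B_sL_mult[OF balB_T] by (simp add: ssum_mult_right mult.assoc)

lemma S_left: "SL a (\<lambda>x y. S x * y) = sR (\<pi>R a)"
  using sum_A_alpha[OF balA_S, of a] by (simp add: S_def ssum_mult_right mult.assoc)

lemma T_left: "SL a (\<lambda>x y. T y * x) = tR (\<pi>R a)"
  using sum_B_beta[OF balB_T, of a] by (simp add: T_def ssum_mult_right mult.assoc)

text \<open>The map \<open>\<alpha>\<close> is colinear for \<open>\<gamma>\<^sub>R\<close>, hence so is its inverse.\<close>

lemma sum_S_eq_sum_A:
  assumes g: "balA g"
  shows "SR a (\<lambda>x y. g x (S y)) = ssum (A a) g"
proof -
  note [simp] = alpha_balancedD[OF g]
  define f where "f x p q = g x (sR (\<pi>R p) * q)" for x p q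
  have balA_f: "balA (\<lambda>p q. f x p (q * c))" for x c
    unfolding f_def by (rule alpha_balancedI)
      (simp_all add: R.counit_add R.s_add R.counit_s R.s_mult distrib_left distrib_right mult.assoc)
  \<comment> \<open>The test map \<open>f x\<close> evaluated on the preimage of
    \<open>u \<otimes> v\<close> under \<alpha>.\<close>
  define M where "M x u v = ssum (A u) (\<lambda>p q. f x p (q * v))" for x u v
  have M_add: "M (x + x') u v = M x u v + M x' u v" "M x (u + u') v = M x u v + M x u' v"
    "M x u (v + v') = M x u v + M x u v'" for x x' u u' v v'
    by (simp_all add: M_def A_add[OF balA_f]) (simp_all add: f_def ssum_fun_add distrib_left)
  have M_R: "M (x * sR r) u v = M x (u * tR r) v" for x r u v
    unfolding M_def A_mult_tR[OF balA_f]
    by (simp add: f_def R.counit_t R.s_mult mult.assoc)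
  have M_L: "M x (tL l * u) v = M x u (sL l * v)" for x l u v
    unfolding M_def A_tL_mult[OF balA_f] by (simp add: mult.assoc)
  have balR_M: "balR (\<lambda>x u. M x u v)" for v
    by (rule right_balancedI) (simp_all add: M_add M_R)
  have balL_M: "balL (\<lambda>w v. SR w (\<lambda>x u. M x u v))"
    by (rule left_balancedI)
      (simp_all add: R.right_balanced_sum_add[OF balR_M] SR_tL_mult[OF balR_M] M_add M_L ssum_fun_add)
  have "ssum (A a) g = ssum (A a) (\<lambda>p q. SR p (\<lambda>x y. g (x * sR (\<pi>R y)) q))"
    by (simp add: R.sum_counit_right[OF alpha_balanced_additive(1)[OF g]] del: alpha_balancedD[OF g])
  also have "\<dots> = ssum (A a) (\<lambda>p q. SR p (\<lambda>x y. f x y q))"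
    by (simp add: f_def)
  \<comment> \<open>An application of \<alpha> followed by its inverse is inserted in the leg
    \<open>y\<close>. Mixed coassociativity then turns the sum into a test of \<alpha> on
    \<open>A a\<close>, which is \<open>a \<otimes> 1\<close>.\<close>
  also have "\<dots> = ssum (A a) (\<lambda>p q. SR p (\<lambda>x y. SL y (\<lambda>u v. M x u (v * q))))"
  proof -
    have "f x y q = SL y (\<lambda>u v. M x u (v * q))" for x y q
      using sum_A_alpha[OF balA_f, of x q y] by (simp add: M_def mult.assoc)
    then show ?thesis by simp
  qed
  also have "\<dots> = ssum (A a) (\<lambda>p q. SL p (\<lambda>w v. SR w (\<lambda>x u. M x u (v * q))))"
  proof -
    have "SR p (\<lambda>x y. SL y (\<lambda>u v. M x u (v * q))) = SL p (\<lambda>w v. SR w (\<lambda>x u. M x u (v * q)))" for p q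
      by (rule mixed_coassoc_right[symmetric])
        (simp_all add: additive3_def M_add M_R M_L distrib_right mult.assoc)
    then show ?thesis by simp
  qed
  also have "\<dots> = SR a (\<lambda>x u. M x u 1)"
    by (rule sum_alpha_A[OF balL_M])
  also have "\<dots> = SR a (\<lambda>x y. g x (S y))"
    by (simp add: M_def f_def S_def ssum_additive[OF alpha_balanced_additive(2)[OF g]])
  finally show ?thesis by simp
qed

text \<open>By \<open>sum_S_eq_sum_A\<close> the sum multiplies the two legs of \<open>A a\<close>.
  Writing the first leg as \<open>s\<^sub>L(\<pi>\<^sub>L(p\<^sub>1)) p\<^sub>2\<close> exhibits the
  product as a test of \<alpha> on \<open>A a\<close>.\<close>

lemma S_right: "SR a (\<lambda>x y. x * S y) = sL (\<pi>L a)"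
proof -
  have "SR a (\<lambda>x y. x * S y) = ssum (A a) (\<lambda>p q. p * q)"
    by (rule sum_S_eq_sum_A) (rule alpha_balancedI; simp add: algebra_simps)
  also have "\<dots> = ssum (A a) (\<lambda>p q. SL p (\<lambda>u v. sL (\<pi>L u) * v) * q)"
    using L.counit_left by simp
  also have "\<dots> = ssum (A a) (\<lambda>p q. SL p (\<lambda>u v. sL (\<pi>L u) * (v * q)))"
    by (simp add: ssum_mult_right mult.assoc)
  also have "\<dots> = sL (\<pi>L a) * 1"
    by (rule sum_alpha_A, rule left_balancedI)
      (simp_all add: L.counit_add L.s_add L.counit_t L.s_mult distrib_left distrib_right mult.assoc)
  finally show ?thesis by simp
qed

text \<open>
  The other factor is cancelled by means of \<open>S\<close>: expand \<open>D a = D(a\<^sub>1) s\<^sub>L(\<pi>\<^sub>L(a\<^sub>2))\<close> as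
  \<open>D(a\<^sub>1) a\<^sub>2\<^sup>1 S(a\<^sub>2\<^sup>2)\<close> and apply mixed coassociativity.
\<close>

lemma convolution_eq_0:
  assumes D_add: "\<And>x y. D (x + y) = D x + D y" and D_tL: "\<And>l x. D (tL l * x) = D x * sL l"
    and D_0: "\<And>a. SL a (\<lambda>x y. D x * y) = 0"
  shows "D a = 0"
proof -
  have "D a = SL a (\<lambda>x y. D (tL (\<pi>L y) * x))"
    by (rule L.sum_counit_right[symmetric]) (rule additiveI, rule D_add)
  also have "\<dots> = SL a (\<lambda>x y. SR y (\<lambda>p q. D x * p * S q))"
    by (simp add: D_tL ssum_mult_left mult.assoc flip: S_right)
  also have "\<dots> = SR a (\<lambda>w q. SL w (\<lambda>x p. D x * p * S q))"
    by (rule mixed_coassoc_left[symmetric])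
      (simp_all add: additive3_def D_add D_tL S_add S_mult_tR distrib_left distrib_right mult.assoc)
  also have "\<dots> = 0"
    by (simp add: D_0 ssum_fun_0 flip: ssum_mult_right)
  finally show ?thesis .
qed

text \<open>The mirror image, starting from
  \<open>D a = s\<^sub>L(\<pi>\<^sub>L(a\<^sub>1)) D(a\<^sub>2)\<close> and expanding the scalar
  along \<open>a\<^sub>1\<close>.\<close>

lemma convolution_eq_0':
  assumes D_add: "\<And>x y. D (x + y) = D x + D y" and D_sL: "\<And>l x. D (sL l * x) = sL l * D x"
    and D_0: "\<And>a. SL a (\<lambda>x y. S x * D y) = 0"
  shows "D a = 0"
proof -
  have "D a = SL a (\<lambda>x y. D (sL (\<pi>L x) * y))"
    by (rule L.sum_counit_left[symmetric]) (rule additiveI, rule D_add)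
  also have "\<dots> = SL a (\<lambda>x y. SR x (\<lambda>p q. p * S q * D y))"
    by (simp only: D_sL) (simp only: S_right[symmetric] ssum_mult_right)
  also have "\<dots> = SR a (\<lambda>p w. SL w (\<lambda>q y. p * S q * D y))"
    by (rule mixed_coassoc_right)
      (simp_all add: additive3_def D_add D_sL S_add S_mult_tR S_tL_mult distrib_left distrib_right mult.assoc)
  also have "\<dots> = 0"
    by (simp add: D_0 ssum_fun_0 mult.assoc flip: ssum_mult_left)
  finally show ?thesis .
qed

text \<open>Convolving each side with the identity gives
  \<open>s\<^sub>R(\<pi>\<^sub>R(t\<^sub>R(r)x))\<close> and
  \<open>s\<^sub>R(\<pi>\<^sub>R(s\<^sub>R(r)x))\<close>, equal by the counit axioms;
  \<open>convolution_eq_0\<close> cancels the other factor.\<close>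

lemma S_tR_mult: "S (tR r * a) = S a * sR r"
proof -
  obtain l where l: "sR r = tL l" by (rule obtain_sR)
  obtain k where k: "tR r = sL k" by (rule obtain_tR)
  have balL_S: "balL (\<lambda>x y. S x * y)"
    by (rule left_balancedI) (simp_all add: S_add S_tL_mult distrib_left distrib_right mult.assoc)
  have "S (tR r * a) - S a * sR r = 0"
  proof (rule convolution_eq_0[where D = "\<lambda>x. S (tR r * x) - S x * sR r"])
    fix x
    have "SL x (\<lambda>x y. S (tR r * x) * y) = sR (\<pi>R (tR r * x))"
      using L.left_balanced_sum_s[OF balL_S, of k x] by (simp add: k S_left)
    also have "\<dots> = sR (\<pi>R (sR r * x))"
      by (metis R.counit_source R.counit_target R.counit_s')
    also have "\<dots> = SL x (\<lambda>x y. S x * (sR r * y))"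
      using L.left_balanced_sum_t[OF balL_S, of l x] by (simp add: l S_left)
    finally show "SL x (\<lambda>x y. (S (tR r * x) - S x * sR r) * y) = 0"
      by (simp add: left_diff_distrib ssum_fun_diff mult.assoc)
  next
    show "S (tR r * (tL m * x)) - S (tL m * x) * sR r = (S (tR r * x) - S x * sR r) * sL m" for m x
    proof -
      have "tR r * (tL m * x) = tL m * (tR r * x)" by (simp add: tL_tR flip: mult.assoc)
      then show ?thesis by (simp add: S_tL_mult left_diff_distrib mult.assoc sL_sR)
    qed
  qed (simp add: S_add distrib_left distrib_right)
  then show ?thesis by simp
qed

sublocale antipode sL tL \<gamma>L \<pi>L sR tR \<gamma>R \<pi>R S
proof
  show "S (a + b) = S a + S b" for a b by (rule S_add)
  show "S (tL l * a * tL l') = sL l' * S a * sL l" for l a l'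
    by (simp add: S_tL_mult S_mult_tL mult.assoc)
  show "S (tR r' * a * tR r) = sR r * S a * sR r'" for r' a r
    by (simp add: S_tR_mult S_mult_tR mult.assoc)
  show "SL a (\<lambda>x y. S x * y) = sR (\<pi>R a)" for a by (rule S_left)
  show "SR a (\<lambda>x y. x * S y) = sL (\<pi>L a)" for a by (rule S_right)
qed

text \<open>Antimultiplicativity gives \<open>S(a\<^sub>1) S(T(a\<^sub>2)) = S(T(a\<^sub>2)
  a\<^sub>1) = s\<^sub>R(\<pi>\<^sub>R(a)) = S(a\<^sub>1) a\<^sub>2\<close>, and the left factor is
  cancelled.\<close>

lemma S_T: "S (T a) = a"
proof -
  have "S (T a) - a = 0"
  proof (rule convolution_eq_0'[where D = "\<lambda>x. S (T x) - x"])
    fix x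
    have "SL x (\<lambda>x y. S x * S (T y)) = S (tR (\<pi>R x))"
      by (simp add: additive_ssum[OF additive_S] S_mult flip: T_left)
    also have "\<dots> = SL x (\<lambda>x y. S x * y)"
      by (simp add: S_of_tR S_left)
    finally show "SL x (\<lambda>x y. S x * (S (T y) - y)) = 0"
      by (simp add: right_diff_distrib ssum_fun_diff)
  qed (simp_all add: S_add T_add T_sL_mult S_mult_tL right_diff_distrib)
  then show ?thesis by simp
qed

text \<open>Both \<open>\<pi>R (S a)\<close> and \<open>\<pi>R (sL (\<pi>L a))\<close> equal
  \<open>\<pi>\<^sub>R(a\<^sup>1 S(a\<^sup>2))\<close>; since \<open>sL\<close> takes values in the
  image of \<open>tR\<close>, applying \<open>tR\<close> recovers the scalar.\<close>

lemma tR_counit_S: "tR (\<pi>R (S a)) = sL (\<pi>L a)"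
proof -
  have "additive \<pi>R" by (simp add: additive_def R.counit_add)
  then have "\<pi>R (sL (\<pi>L a)) = SR a (\<lambda>x y. \<pi>R (sR (\<pi>R x) * S y))"
    by (simp add: additive_ssum R.counit_source flip: S_right)
  also have "\<dots> = \<pi>R (S a)"
    by (simp add: ssum_additive[OF \<open>additive \<pi>R\<close>] flip: S_eq_sum_R)
  finally show ?thesis by (metis obtain_sL R.counit_t')
qed

text \<open>\<open>antipode_identity_S\<close> states that \<beta> maps
  \<open>a\<^sub>2 \<otimes> S(a\<^sub>1)\<close> to \<open>1 \<otimes> S(a)\<close>, so this tensor
  computes \<open>B (S a)\<close>.\<close>

lemma T_S: "T (S a) = a"
proof -
  have "SL a (\<lambda>x y. SL (S x) (\<lambda>u v. E (u * y) v)) = E 1 (S a)"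
    by (rule antipode_identity_S[OF left_balanced_elem])
  then have "T (S a) = SL a (\<lambda>x y. tR (\<pi>R (S x)) * y)"
    using B_unique[OF balB_T, of "frag_extend (\<lambda>(x, y). frag_of (y, S x)) (rep (\<gamma>L a))" "S a"]
    by (simp only: T_def frag_sum_norm)
  also have "\<dots> = a"
    using L.counit_left by (simp add: tR_counit_S)
  finally show ?thesis .
qed

sublocale bijective_antipode sL tL \<gamma>L \<pi>L sR tR \<gamma>R \<pi>R S
  by standard (rule o_bij[of T]; simp add: fun_eq_iff S_T T_S)

end

section \<open>The right bialgebroid obtained from an anti-automorphism\<close>

lemma tensor_plus [simp]: "subgroup N \<Longrightarrow> t \<in> tensor N \<Longrightarrow> t' \<in> tensor N \<Longrightarrow> t + t' \<in> tensor N"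
  by (auto simp: tensor_def coset_plus_coset)

lemma RR_eqI:
  assumes "T \<in> tensor (RR s t)" "T' \<in> tensor (RR s t)"
    and "ssum T (elem (RR s t)) = ssum T' (elem (RR s t))"
  shows "T = T'"
  by (rule tensor_eqI[OF subgroup_RR assms(1,2)]) (use assms(3) in \<open>simp add: case_prod_unfold\<close>)

lemma ssum_tmap_RR:
  assumes "right_balanced s t f"
  shows "ssum (tmap (RR s t) h T) f = tval (\<lambda>p. frag_sum (\<lambda>(x, y). f x y) (h p)) T"
  by (rule tval_tmap[OF subgroup_RR right_balanced_kills[OF assms]])

text \<open>The conditions of (ii) apart from the equations for \<open>\<gamma>\<^sub>R\<close>.
  Both the passage from (i) to (ii) and that from (ii) to (iii) take place here.\<close>

locale twisted_antipode = L: left_bialgebroid sL tL \<gamma>L \<pi>L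
  for sL tL :: "'l::{ring,monoid_mult} \<Rightarrow> 'a::{ring,monoid_mult}" and \<gamma>L \<pi>L +
  fixes S :: "'a \<Rightarrow> 'a" and \<mu> :: "'l \<Rightarrow> 'r::{ring,monoid_mult}"
  assumes bij_S: "bij S" and antimap_S: "ring_antimap S"
    and S_tL: "S (tL l) = sL l"
    and S_left: "ssum (\<gamma>L a) (\<lambda>x y. S x * y) = tL (\<pi>L (S a))"
    and bij_theta: "bij (\<pi>L \<circ> S \<circ> sL)"
    and opposite: "base_opposite \<mu>"
begin

abbreviation SL :: "'a \<Rightarrow> ('a \<Rightarrow> 'a \<Rightarrow> 'b::ab_group_add) \<Rightarrow> 'b" where
  "SL a f \<equiv> ssum (\<gamma>L a) f"

abbreviation "balL \<equiv> left_balanced sL tL"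

abbreviation S' where "S' \<equiv> inv S"
abbreviation \<kappa> where "\<kappa> \<equiv> inv \<mu>"

definition \<theta> :: "'l \<Rightarrow> 'l" where
  "\<theta> = \<pi>L \<circ> S \<circ> sL"

definition sR :: "'r \<Rightarrow> 'a" where
  "sR = tL \<circ> inv \<mu>"

definition tR :: "'r \<Rightarrow> 'a" where
  "tR = sL \<circ> inv \<theta> \<circ> inv \<mu>"

abbreviation "balR \<equiv> right_balanced sR tR"

lemma S_S' [simp]: "S (S' a) = a" and S'_S [simp]: "S' (S a) = a"
  using bij_S by (simp_all add: bij_is_surj bij_is_inj surj_f_inv_f)

lemma S'_eqI: "S b = a \<Longrightarrow> S' a = b"
  by auto

lemma \<kappa>_\<mu> [simp]: "\<kappa> (\<mu> l) = l" and \<mu>_\<kappa> [simp]: "\<mu> (\<kappa> r) = r"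
  using opposite by (simp_all add: base_opposite_def bij_is_surj bij_is_inj surj_f_inv_f)

lemma \<mu>_add: "\<mu> (x + y) = \<mu> x + \<mu> y" and \<mu>_mult: "\<mu> (x * y) = \<mu> y * \<mu> x" and \<mu>_1: "\<mu> 1 = 1"
  using opposite by (simp_all add: base_opposite_def ring_antimap_def)

lemma \<kappa>_add: "\<kappa> (x + y) = \<kappa> x + \<kappa> y" and \<kappa>_mult: "\<kappa> (x * y) = \<kappa> y * \<kappa> x" and \<kappa>_1: "\<kappa> 1 = 1"
  by (metis \<kappa>_\<mu> \<mu>_\<kappa> \<mu>_add, metis \<kappa>_\<mu> \<mu>_\<kappa> \<mu>_mult, metis \<kappa>_\<mu> \<mu>_1)

lemma S_add: "S (x + y) = S x + S y" and S_mult: "S (x * y) = S y * S x" and S_1: "S 1 = 1"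
  using antimap_S by (simp_all add: ring_antimap_def)

lemma S'_add: "S' (a + b) = S' a + S' b" and S'_mult: "S' (a * b) = S' b * S' a" and S'_1: "S' 1 = 1"
  by (simp_all add: S'_eqI S_add S_mult S_1)

lemma additive_S: "additive S" and additive_S': "additive S'"
  by (simp_all add: additive_def S_add S'_add)

lemma sR_eq: "sR r = tL (\<kappa> r)"
  by (simp add: sR_def)

lemma S'_sL: "S' (sL l) = tL l"
  by (simp add: S'_eqI S_tL)

text \<open>Evaluate \<open>S_left\<close> at \<open>sL l\<close>, whose comultiplication is
  \<open>sL l \<otimes> 1\<close>.\<close>

lemma S_sL: "S (sL l) = tL (\<theta> l)"
proof -
  have "balL (\<lambda>x y. S x * y)"
    by (rule left_balancedI) (simp_all add: S_add S_mult S_tL distrib_left distrib_right mult.assoc)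
  from L.left_balanced_sum_of_s[OF this, of l] show ?thesis by (simp add: S_left \<theta>_def)
qed

lemma \<theta>_inv [simp]: "\<theta> (inv \<theta> l) = l" and inv_\<theta> [simp]: "inv \<theta> (\<theta> l) = l"
  using bij_theta by (simp_all add: \<theta>_def bij_is_surj bij_is_inj surj_f_inv_f del: comp_apply)

lemma tR_eq: "tR r = sL (inv \<theta> (\<kappa> r))"
  by (simp add: tR_def)

lemma S_tR: "S (tR r) = tL (\<kappa> r)"
  by (simp add: tR_eq S_sL)

lemma S'_tL: "S' (tL l) = tR (\<mu> l)"
  by (simp add: S'_eqI S_tR)

lemma sL_eq_tR: "sL l = tR (\<mu> (\<theta> l))"
  by (simp add: tR_eq)

lemma balRD:
  assumes "balR f"
  shows "f (x + x') y = f x y + f x' y" "f x (y + y') = f x y + f x y'"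
    "f (x * tL l) y = f x (y * tR (\<mu> l))"
  using right_balancedD[OF assms] right_balancedD(3)[OF assms, of x "\<mu> l" y] by (simp_all add: sR_eq)

lemma balRI:
  assumes "\<And>x x' y. f (x + x') y = f x y + f x' y" "\<And>x y y'. f x (y + y') = f x y + f x y'"
    "\<And>l x y. f (x * tL l) y = f x (y * tR (\<mu> l))"
  shows "balR f"
  by (rule right_balancedI) (simp_all add: assms sR_eq)

text \<open>The twist by \<theta> is made for this: \<open>S\<close> sends \<open>sL l\<close> to
  \<open>tL (\<theta> l)\<close>, while \<open>sL l\<close> itself is
  \<open>tR (\<mu> (\<theta> l))\<close>, which is the matching scalar of \<open>R\<close> on the
  other leg.\<close>

lemma balL_S_S:
  assumes "balR f"
  shows "balL (\<lambda>x y. f (S y) (S x))"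
  by (rule left_balancedI) (simp_all add: balRD[OF assms] S_add S_mult S_tL S_sL flip: sL_eq_tR)

lemma balL_S'_S':
  assumes "balR f"
  shows "balL (\<lambda>x y. f (S' y) (S' x))"
  by (rule left_balancedI) (simp_all add: balRD[OF assms] S'_add S'_mult S'_tL S'_sL)

lemma balR_S_S:
  assumes "balL f"
  shows "balR (\<lambda>x y. f (S y) (S x))"
  by (rule balRI) (simp_all add: left_balancedD[OF assms] S_add S_mult S_tL S_tR)

text \<open>Both flips respect the tensor relations, so the inverse of the flip by \<open>S\<close>
  is the flip by \<open>S'\<close>. This eliminates \<open>inv_into\<close>.\<close>

lemma inv_swap_antipode:
  assumes "T \<in> tensor (LL sL tL)"
  shows "inv_into (tensor (RR sR tR)) (swap_antipode (LL sL tL) S) T = swap_antipode (RR sR tR) S' T"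
proof -
  have kS: "kills (\<lambda>p. qclass (LL sL tL) (case p of (x, y) \<Rightarrow> frag_of (S y, S x))) (RR sR tR)"
    using right_balanced_kills[OF balR_S_S[OF left_balanced_elem]] by (simp only: qclass_norm)
  have kS': "kills (\<lambda>p. qclass (RR sR tR) (case p of (x, y) \<Rightarrow> frag_of (S' y, S' x))) (LL sL tL)"
    using left_balanced_kills[OF balL_S'_S'[OF right_balanced_elem]] by (simp only: qclass_norm)
  have 1: "swap_antipode (LL sL tL) S (swap_antipode (RR sR tR) S' T) = T"
    unfolding swap_antipode_def
    by (rule tmap_left_inverse[OF _ _ kS _ assms]) (auto simp: split: prod.splits)
  have "inj_on (swap_antipode (LL sL tL) S) (tensor (RR sR tR))"
    unfolding swap_antipode_def
    by (rule inj_on_inverseI, rule tmap_left_inverse[OF _ _ kS']) (auto split: prod.splits)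
  moreover have "swap_antipode (RR sR tR) S' T \<in> tensor (RR sR tR)"
    by (simp add: swap_antipode_def)
  ultimately show ?thesis using inv_into_f_f 1 by metis
qed

text \<open>\<open>\<gamma>R\<close> and \<open>\<gamma>R'\<close> are the two expressions for
  \<open>\<gamma>\<^sub>R\<close> in (ii). They are kept apart because their equality is a
  hypothesis in one direction and a conclusion in the other.\<close>

definition \<gamma>R :: "'a \<Rightarrow> (('a \<times> 'a) \<Rightarrow>\<^sub>0 int) set" where
  "\<gamma>R a = swap_antipode (RR sR tR) S (\<gamma>L (S' a))"

definition \<gamma>R' :: "'a \<Rightarrow> (('a \<times> 'a) \<Rightarrow>\<^sub>0 int) set" where
  "\<gamma>R' a = swap_antipode (RR sR tR) S' (\<gamma>L (S a))"

definition \<pi>R :: "'a \<Rightarrow> 'r" where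
  "\<pi>R a = \<mu> (\<pi>L (S a))"

lemma sum_\<gamma>R: "balR f \<Longrightarrow> ssum (\<gamma>R a) f = SL (S' a) (\<lambda>x y. f (S y) (S x))"
  unfolding \<gamma>R_def swap_antipode_def ssum_tmap_RR by (simp only: frag_sum_norm)

lemma sum_\<gamma>R': "balR f \<Longrightarrow> ssum (\<gamma>R' a) f = SL (S a) (\<lambda>x y. f (S' y) (S' x))"
  unfolding \<gamma>R'_def swap_antipode_def ssum_tmap_RR by (simp only: frag_sum_norm)

lemma \<gamma>R_in [simp]: "\<gamma>R a \<in> tensor (RR sR tR)" "\<gamma>R' a \<in> tensor (RR sR tR)"
  by (simp_all add: \<gamma>R_def \<gamma>R'_def swap_antipode_def)

abbreviation "E \<equiv> elem (RR sR tR)"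
lemmas E_D = balRD[OF right_balanced_elem]
lemmas sum_E = sum_\<gamma>R'[OF right_balanced_elem]

text \<open>Coassociativity of \<open>\<gamma>L\<close> at \<open>S a\<close>, with the three legs
  reversed and \<open>S'\<close> applied to each.\<close>

lemma coassoc_\<gamma>R':
  assumes f: "additive3 f" "\<And>l x y z. f (x * tL l) y z = f x (y * tR (\<mu> l)) z"
    "\<And>l x y z. f x (y * tL l) z = f x y (z * tR (\<mu> l))"
  shows "ssum (\<gamma>R' a) (\<lambda>x y. ssum (\<gamma>R' x) (\<lambda>u v. f u v y)) = ssum (\<gamma>R' a) (\<lambda>x y. ssum (\<gamma>R' y) (\<lambda>u v. f x u v))"
proof -
  have f_add: "f (x + x') y z = f x y z + f x' y z" "f x (y + y') z = f x y z + f x y' z"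
    "f x y (z + z') = f x y z + f x y z'" for x x' y y' z z'
    using f(1) by (simp_all add: additive3_def)
  have left: "balR (\<lambda>u v. f u v z)" and right: "balR (\<lambda>u v. f z u v)" for z
    by (rule balRI; simp add: f f_add)+
  have "balR (\<lambda>x y. SL (S x) (\<lambda>m n. f (S' n) (S' m) y))"
    by (rule balRI) (simp_all add: S_add S_mult S_tL f f_add S'_mult S'_sL ssum_fun_add
        L.left_balanced_sum_add[OF balL_S'_S'[OF left]] L.left_balanced_sum_s[OF balL_S'_S'[OF left]])
  moreover have "balR (\<lambda>x y. SL (S y) (\<lambda>m n. f x (S' n) (S' m)))"
    by (rule balRI) (simp_all add: S_add S_mult S_tR f f_add S'_mult S'_tL ssum_fun_add
        L.left_balanced_sum_add[OF balL_S'_S'[OF right]] L.left_balanced_sum_t[OF balL_S'_S'[OF right]])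
  ultimately show ?thesis
    using L.left_balanced_sum_coassoc[of "\<lambda>x y z. f (S' z) (S' y) (S' x)" "S a"]
    by (simp add: sum_\<gamma>R' left right additive3_def f f_add S'_add S'_mult S'_tL S'_sL)
qed

lemma right_bialgebroid: "right_bialgebroid sR tR \<gamma>R' \<pi>R"
proof
  show "ring_map sR"
    by (simp add: ring_map_def sR_eq \<kappa>_add \<kappa>_mult \<kappa>_1 L.t_add L.t_mult L.t_1)
  \<comment> \<open>This presents \<open>tR\<close> as a composite of three antihomomorphisms, so
    its multiplicativity follows without that of \<open>inv \<theta>\<close>.\<close>
  have tR_S': "tR r = S' (tL (\<kappa> r))" for r
    by (simp add: S'_tL)
  show "ring_antimap tR"
    by (simp add: ring_antimap_def tR_S' \<kappa>_add \<kappa>_mult \<kappa>_1 L.t_add L.t_mult L.t_1 S'_add S'_mult S'_1 del: S'_tL)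
  show "sR r * tR r' = tR r' * sR r" for r r'
    by (simp add: sR_eq tR_eq L.commute)
  show "\<gamma>R' a \<in> tensor (RR sR tR)" for a
    by simp
  show "\<gamma>R' (a + b) = \<gamma>R' a + \<gamma>R' b" for a b
  proof (rule RR_eqI)
    have "ssum (\<gamma>R' a + \<gamma>R' b) E = ssum (\<gamma>R' a) E + ssum (\<gamma>R' b) E"
      by (rule tval_plus[OF _ right_balanced_kills[OF right_balanced_elem]]) simp_all
    then show "ssum (\<gamma>R' (a + b)) E = ssum (\<gamma>R' a + \<gamma>R' b) E"
      by (simp only: sum_E S_add L.left_balanced_sum_add[OF balL_S'_S'[OF right_balanced_elem]])
  qed simp_all
  show "\<gamma>R' (a * sR r' * tR r) = tmap (RR sR tR) (\<lambda>(x, y). frag_of (x * tR r, y * sR r')) (\<gamma>R' a)" for a r r'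
  proof (rule RR_eqI)
    have c: "x * tL l * tR k = x * tR k * tL l" "x * tR k * sR m = x * sR m * tR k" for x l k m
      by (simp_all add: sR_eq tR_eq L.commute mult.assoc)
    have "balR (\<lambda>x y. E (x * tR r) (y * sR r'))"
      by (rule balRI) (simp_all add: c E_D distrib_right)
    then have "ssum (tmap (RR sR tR) (\<lambda>(x, y). frag_of (x * tR r, y * sR r')) (\<gamma>R' a)) E
        = SL (S a) (\<lambda>x y. E (S' y * tR r) (S' x * sR r'))"
      unfolding ssum_tmap_RR[OF right_balanced_elem] by (simp only: frag_sum_norm sum_\<gamma>R')
    moreover have "S (a * sR r' * tR r) = sL (\<kappa> r') * tL (\<kappa> r) * S a"
      by (simp add: S_mult S_tR sR_eq S_tL L.t_s_mult mult.assoc)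
    ultimately show "ssum (\<gamma>R' (a * sR r' * tR r)) E
        = ssum (tmap (RR sR tR) (\<lambda>(x, y). frag_of (x * tR r, y * sR r')) (\<gamma>R' a)) E"
      by (simp add: sum_E L.left_balanced_sum_bimod[OF balL_S'_S'[OF right_balanced_elem]]
          S'_mult S'_sL S'_tL sR_eq)
  qed simp_all
  show "\<pi>R (a + b) = \<pi>R a + \<pi>R b" for a b
    by (simp add: \<pi>R_def S_add L.counit_add \<mu>_add)
  show "\<pi>R (a * sR r' * tR r) = r * \<pi>R a * r'" for a r r'
    by (simp add: \<pi>R_def S_mult sR_eq S_tL S_tR L.counit_s L.counit_t \<mu>_mult mult.assoc)
  show "tmap_left (RRRR sR tR) \<gamma>R' (\<gamma>R' a) = tmap_right (RRRR sR tR) \<gamma>R' (\<gamma>R' a)" for a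
    unfolding RRRR_def tmap_left_right_eq_iff[OF subgroup_tens3]
  proof (rule coassoc_\<gamma>R')
    let ?f = "elem3 (tens3 (right_by_right sR) (left_by_right tR) (right_by_right sR) (left_by_right tR))"
    have b: "balanced3 (right_by_right sR) (left_by_right tR) (right_by_right sR) (left_by_right tR) ?f"
      by (rule balanced3_elem3)
    then show "additive3 ?f" by (simp add: balanced3_additive3)
    fix l x y z
    have "?f (x * sR (\<mu> l)) y z = ?f x (y * tR (\<mu> l)) z" "?f x (y * sR (\<mu> l)) z = ?f x y (z * tR (\<mu> l))"
      using b by (simp_all only: balanced3_additive3 right_by_right_def left_by_right_def)
    then show "?f (x * tL l) y z = ?f x (y * tR (\<mu> l)) z" "?f x (y * tL l) z = ?f x y (z * tR (\<mu> l))"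
      by (simp_all add: sR_eq)
  qed
  have counit: "\<pi>R (x * tL l) = \<pi>R x * \<mu> l" "\<pi>R (x * tR (\<mu> l)) = \<mu> l * \<pi>R x"
    "\<pi>R (x + y) = \<pi>R x + \<pi>R y" for x y l
    by (simp_all add: \<pi>R_def S_add L.counit_add \<mu>_add S_mult S_tL S_tR L.counit_s L.counit_t \<mu>_mult)
  have tR_mult: "tR (x * y) = tR y * tR x" and tR_add: "tR (x + y) = tR x + tR y" for x y
    using \<open>ring_antimap tR\<close> by (simp_all add: ring_antimap_def)
  show "tval (\<lambda>(x, y). y * tR (\<pi>R x)) (\<gamma>R' a) = a" for a
  proof -
    have "balR (\<lambda>x y. y * tR (\<pi>R x))"
      by (rule balRI) (simp_all add: counit tR_mult tR_add distrib_left distrib_right mult.assoc)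
    then have "tval (\<lambda>(x, y). y * tR (\<pi>R x)) (\<gamma>R' a) = SL (S a) (\<lambda>x y. S' (tL (\<pi>L y) * x))"
      by (simp add: sum_\<gamma>R' \<pi>R_def S'_mult S'_tL)
    then show ?thesis
      by (simp add: L.sum_counit_right[OF additive_S'])
  qed
  show "tval (\<lambda>(x, y). x * sR (\<pi>R y)) (\<gamma>R' a) = a" for a
  proof -
    have "balR (\<lambda>x y. x * sR (\<pi>R y))"
      by (rule balRI) (simp_all add: counit sR_eq \<kappa>_add \<kappa>_mult L.t_add L.t_mult distrib_left distrib_right mult.assoc)
    then have "tval (\<lambda>(x, y). x * sR (\<pi>R y)) (\<gamma>R' a) = SL (S a) (\<lambda>x y. S' (sL (\<pi>L x) * y))"
      by (simp add: sum_\<gamma>R' \<pi>R_def S'_mult S'_sL sR_eq)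
    then show ?thesis
      by (simp add: L.sum_counit_left[OF additive_S'])
  qed
  show "tmap (RR sR tR) (\<lambda>(x, y). frag_of (sR r * x, y)) (\<gamma>R' a)
       = tmap (RR sR tR) (\<lambda>(x, y). frag_of (x, tR r * y)) (\<gamma>R' a)" for r a
  proof -
    have "balR (\<lambda>x y. E (sR r * x) y)" "balR (\<lambda>x y. E x (tR r * y))"
      by (rule balRI; simp add: E_D distrib_left flip: mult.assoc)+
    with L.left_balanced_sum_takeuchi[OF balL_S'_S'[OF right_balanced_elem], where a = "S a" and l = "\<kappa> r"]
    show ?thesis
      unfolding tmap_eq_iff[OF subgroup_RR]
      by (simp only: qclass_norm sum_\<gamma>R') (simp add: S'_mult S'_sL S'_tL sR_eq)
  qed
  show "\<gamma>R' 1 = frag_of (1, 1) +o RR sR tR"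
  proof (rule RR_eqI)
    show "ssum (\<gamma>R' 1) E = ssum (frag_of (1, 1) +o RR sR tR) E"
      unfolding tval_coset[OF subgroup_RR right_balanced_kills[OF right_balanced_elem]]
      by (simp add: sum_E S_1 S'_1 L.left_balanced_sum_1[OF balL_S'_S'[OF right_balanced_elem]])
  qed simp_all
  show "\<gamma>R' (a * b) = tprod (RR sR tR) (\<gamma>R' a) (\<gamma>R' b)" for a b
  proof (rule RR_eqI)
    have b: "balR (\<lambda>u v. E (x * u) (y * v))" for x y
      by (rule balRI) (simp_all add: E_D distrib_left flip: mult.assoc)
    \<comment> \<open>This map is balanced only as a sum over \<open>\<gamma>L (S b)\<close>, by the
      Takeuchi axiom of \<open>\<gamma>L\<close>.\<close>
    have "balR (\<lambda>x y. SL (S b) (\<lambda>m n. E (x * S' n) (y * S' m)))"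
    proof (rule balRI)
      show "SL (S b) (\<lambda>m n. E (x * tL l * S' n) (y * S' m))
          = SL (S b) (\<lambda>m n. E (x * S' n) (y * tR (\<mu> l) * S' m))" for l x y
        using L.left_balanced_sum_takeuchi[OF balL_S'_S'[OF b], where a = "S b" and l = l]
        by (simp add: S'_mult S'_tL S'_sL mult.assoc)
    qed (simp_all add: E_D distrib_right ssum_fun_add)
    then have "ssum (tprod (RR sR tR) (\<gamma>R' a) (\<gamma>R' b)) E
        = SL (S a) (\<lambda>p q. SL (S b) (\<lambda>m n. E (S' q * S' n) (S' p * S' m)))"
      unfolding tprod_def ssum_tmap_RR[OF right_balanced_elem] by (simp only: frag_sum_norm sum_\<gamma>R' b)
    then show "ssum (\<gamma>R' (a * b)) E = ssum (tprod (RR sR tR) (\<gamma>R' a) (\<gamma>R' b)) E"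
      by (simp add: sum_E S_mult L.left_balanced_sum_mult'[OF balL_S'_S'[OF right_balanced_elem]] S'_mult)
  qed (simp_all add: tprod_def)
  show "\<pi>R 1 = 1"
    by (simp add: \<pi>R_def S_1 L.counit_one \<mu>_1)
  show "\<pi>R (sR (\<pi>R a) * b) = \<pi>R (a * b)" for a b
    by (simp add: \<pi>R_def sR_eq S_mult S_tL L.counit_source)
  show "\<pi>R (tR (\<pi>R a) * b) = \<pi>R (a * b)" for a b
    by (simp add: \<pi>R_def S_mult S_tR L.counit_target)
qed

end

section \<open>Equivalence of the four descriptions\<close>

context left_bialgebroid
begin

lemma sum_hopf:
  assumes hopf: "hopf_algebroid s t \<gamma> \<pi> S" and f: "left_balanced s t f"
  shows "ssum (\<gamma> a) (\<lambda>x y. ssum (\<gamma> (S x)) (\<lambda>u v. f (u * y) v)) = f 1 (S a)"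
    and "ssum (\<gamma> a) (\<lambda>x y. ssum (\<gamma> (inv S y)) (\<lambda>u v. f u (v * x))) = f (inv S a) 1"
proof -
  have "tmap (LL s t) (\<lambda>(x, y). frag_extend (\<lambda>(u, v). frag_of (u * y, v)) (rep (\<gamma> (S x)))) (\<gamma> a)
      = frag_of (1, S a) +o LL s t"
    "tmap (LL s t) (\<lambda>(x, y). frag_extend (\<lambda>(u, v). frag_of (u, v * x)) (rep (\<gamma> (inv S y)))) (\<gamma> a)
      = frag_of (inv S a, 1) +o LL s t"
    using hopf unfolding hopf_algebroid_def by blast+
  from this[THEN arg_cong, of "\<lambda>T. ssum T f"]
  show "ssum (\<gamma> a) (\<lambda>x y. ssum (\<gamma> (S x)) (\<lambda>u v. f (u * y) v)) = f 1 (S a)"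
    and "ssum (\<gamma> a) (\<lambda>x y. ssum (\<gamma> (inv S y)) (\<lambda>u v. f u (v * x))) = f (inv S a) 1"
    unfolding tval_tmap[OF subgroup_LL left_balanced_kills[OF f]]
      tval_coset[OF subgroup_LL left_balanced_kills[OF f]]
    by (simp_all only: frag_sum_norm)
qed

text \<open>Apply the counit to one leg of each axiom of (i): to the second leg of the
  \<open>S\<close> axiom and to the first leg of the \<open>inv S\<close> axiom.\<close>

lemma sum_hopf_counit:
  assumes "hopf_algebroid s t \<gamma> \<pi> S"
  shows "ssum (\<gamma> a) (\<lambda>x y. S x * y) = t (\<pi> (S a))"
    and "ssum (\<gamma> a) (\<lambda>x y. inv S y * x) = s (\<pi> (inv S a))"
proof -
  have "left_balanced s t (\<lambda>u v. t (\<pi> v) * u)"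
    by (rule left_balancedI)
      (simp_all add: counit_add t_add counit_s t_mult distrib_left distrib_right mult.assoc)
  from sum_hopf(1)[OF assms this, of a] show "ssum (\<gamma> a) (\<lambda>x y. S x * y) = t (\<pi> (S a))"
    using counit_right by (simp flip: mult.assoc ssum_mult_right)
  have "left_balanced s t (\<lambda>u v. s (\<pi> u) * v)"
    by (rule left_balancedI)
      (simp_all add: counit_add s_add counit_t s_mult distrib_left distrib_right mult.assoc)
  from sum_hopf(2)[OF assms this, of a] show "ssum (\<gamma> a) (\<lambda>x y. inv S y * x) = s (\<pi> (inv S a))"
    using counit_left by (simp flip: mult.assoc ssum_mult_right)
qed

end

section \<open>From (i) to (ii): both mixed coassociativity laws\<close>

locale hopf_antipode = twisted_antipode sL tL \<gamma>L \<pi>L S \<mu>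
  for sL tL :: "'l::{ring,monoid_mult} \<Rightarrow> 'a::{ring,monoid_mult}" and \<gamma>L \<pi>L S
    and \<mu> :: "'l \<Rightarrow> 'r::{ring,monoid_mult}" +
  assumes hopf: "hopf_algebroid sL tL \<gamma>L \<pi>L S"
begin

lemmas sum_hopf_S = L.sum_hopf(1)[OF hopf] and sum_hopf_S' = L.sum_hopf(2)[OF hopf]
lemmas S'_left = L.sum_hopf_counit(2)[OF hopf]

text \<open>On \<open>balR\<close> maps \<open>SR\<close> and \<open>SR'\<close> are the Sweedler
  sums of \<open>\<gamma>R\<close> and \<open>\<gamma>R'\<close>, by \<open>sum_\<gamma>R\<close>
  and \<open>sum_\<gamma>R'\<close>.\<close>

abbreviation SR :: "'a \<Rightarrow> ('a \<Rightarrow> 'a \<Rightarrow> 'b::ab_group_add) \<Rightarrow> 'b" where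
  "SR a f \<equiv> SL (S' a) (\<lambda>x y. f (S y) (S x))"

abbreviation SR' :: "'a \<Rightarrow> ('a \<Rightarrow> 'a \<Rightarrow> 'b::ab_group_add) \<Rightarrow> 'b" where
  "SR' a f \<equiv> SL (S a) (\<lambda>x y. f (S' y) (S' x))"

lemma SR_add: "balR f \<Longrightarrow> SR (a + b) f = SR a f + SR b f"
  by (simp add: S'_add L.left_balanced_sum_add[OF balL_S_S])

lemma SR_sL_mult: "balR f \<Longrightarrow> SR (sL l * a) f = SR a (\<lambda>x y. f (sL l * x) y)"
  by (simp add: S'_mult S'_sL L.left_balanced_sum_mult_t[OF balL_S_S] S_mult S_tL)

lemma SR_tL_mult: "balR f \<Longrightarrow> SR (tL l * a) f = SR a (\<lambda>x y. f x (tL l * y))"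
  by (simp add: S'_mult S'_tL tR_eq L.left_balanced_sum_mult_s[OF balL_S_S] S_mult S_sL)

text \<open>The \<open>S'\<close> axiom of (i), carried to the tensor product over \<open>R\<close>
  by the flip with \<open>S\<close>.\<close>

lemma sum_S_SR:
  assumes f: "balR f"
  shows "SL p (\<lambda>x y. SR y (\<lambda>u v. f (S x * u) v)) = f 1 p"
  using sum_hopf_S'[OF balL_S_S[OF f], of p] by (simp add: S_mult S_1)

lemma sum_SR_S':
  assumes f: "balL f"
  shows "SR b (\<lambda>x y. SL y (\<lambda>u v. f (u * S' x) v)) = f 1 b"
  using sum_hopf_S[OF f, of "S' b"] by simp

text \<open>Insert \<open>1 \<otimes> u = S(u\<^sub>1) u\<^sub>2\<^sup>1 \<otimes>
  u\<^sub>2\<^sup>2\<close>, shift the brackets by coassociativity of \<open>\<gamma>L\<close>, and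
  contract with \<open>sum_SR_S'\<close>.\<close>

lemma mixed_coassoc_right_SR:
  assumes f: "additive3 f" "\<And>l x y z. f (x * tL l) y z = f x (y * tR (\<mu> l)) z"
    "\<And>l x y z. f x (tL l * y) z = f x y (sL l * z)"
  shows "SL b (\<lambda>x y. SR x (\<lambda>u v. f u v y)) = SR b (\<lambda>x y. SL y (\<lambda>u v. f x u v))"
proof -
  have f_add: "f (x + x') y z = f x y z + f x' y z" "f x (y + y') z = f x y z + f x y' z"
    "f x y (z + z') = f x y z + f x y z'" for x x' y y' z z'
    using f(1) by (simp_all add: additive3_def)
  have balR_f: "balR (\<lambda>p q. f (c * p) q v)" for c v
    by (rule balRI) (simp_all add: f f_add distrib_left flip: mult.assoc)
  define G where "G x u w v = SR w (\<lambda>p q. f (x * (S u * p)) q v)" for x u w v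
  have G_add: "G x (u + u') w v = G x u w v + G x u' w v" "G x u (w + w') v = G x u w v + G x u w' v"
    "G x u w (v + v') = G x u w v + G x u w v'" for x u u' w w' v v'
    using SR_add[OF balR_f[of "x * S u" v]]
    by (simp_all add: G_def S_add distrib_left distrib_right f_add ssum_fun_add mult.assoc)
  have G_1: "G x (tL l * u) w v = G x u (sL l * w) v" for x l u w v
    using SR_sL_mult[OF balR_f[of "x * S u" v]] by (simp add: G_def S_mult S_tL mult.assoc)
  have G_2: "G x u (tL l * w) v = G x u w (sL l * v)" for x l u w v
    using SR_tL_mult[OF balR_f[of "x * S u" v]] by (simp add: G_def f mult.assoc)
  have balL_G: "balL (\<lambda>w v. G x u w v)" for x u
    by (rule left_balancedI) (simp_all add: G_add G_2)
  \<comment> \<open>Fixing \<open>x = 1\<close> loses nothing, since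
    \<open>x * S u = S (u * S' x)\<close> moves \<open>x\<close> into the argument
    \<open>u\<close>.\<close>
  define H where "H u w = SL w (\<lambda>w v. G 1 u w v)" for u w
  have balL_H: "balL H"
    by (rule left_balancedI)
      (simp_all add: H_def L.left_balanced_sum_add[OF balL_G] L.left_balanced_sum_s[OF balL_G] G_add G_1 ssum_fun_add)
  have "SL c (\<lambda>u v. f x u v) = SL c (\<lambda>u w. H (u * S' x) w)" for x c
  proof -
    have "f x u v = SL u (\<lambda>u w. G x u w v)" for u v
      using sum_S_SR[OF balR_f[of x v], of u] by (simp add: G_def)
    then have "SL c (\<lambda>u v. f x u v) = SL c (\<lambda>u v. SL u (\<lambda>u w. G x u w v))" by simp
    also have "\<dots> = SL c (\<lambda>u y. SL y (\<lambda>w v. G x u w v))"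
      by (rule L.left_balanced_sum_coassoc) (simp_all add: additive3_def G_add G_1 G_2)
    also have "\<dots> = SL c (\<lambda>u w. H (u * S' x) w)"
      by (simp add: H_def G_def S_mult mult.assoc)
    finally show ?thesis .
  qed
  then have "SR b (\<lambda>x y. SL y (\<lambda>u v. f x u v)) = SR b (\<lambda>x y. SL y (\<lambda>u w. H (u * S' x) w))"
    by simp
  also have "\<dots> = H 1 b"
    by (rule sum_SR_S'[OF balL_H])
  finally show ?thesis
    by (simp add: H_def G_def S_1)
qed

text \<open>The previous identity at \<open>S b\<close>, read through \<open>S\<^sup>-\<^sup>1\<close>.\<close>

lemma mixed_coassoc_right_SR':
  assumes f: "additive3 f" "\<And>l x y z. f (x * tL l) y z = f x (y * tR (\<mu> l)) z"
    "\<And>l x y z. f x (tL l * y) z = f x y (sL l * z)"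
  shows "SL b (\<lambda>x y. SR' x (\<lambda>u v. f u v y)) = SR' b (\<lambda>x y. SL y (\<lambda>u v. f x u v))"
proof -
  have "SL (S b) (\<lambda>x y. SR x (\<lambda>u v. f (S' y) (S' v) (S' u)))
      = SR (S b) (\<lambda>x y. SL y (\<lambda>u v. f (S' v) (S' u) (S' x)))"
    by (rule mixed_coassoc_right_SR[where f = "\<lambda>x y z. f (S' z) (S' y) (S' x)"])
      (use f in \<open>simp_all add: additive3_def S'_add S'_mult S'_tL S'_sL tR_eq\<close>)
  then show ?thesis by simp
qed

text \<open>The mixed law for \<open>\<gamma>R'\<close> reduces the first leg to \<open>S'\<close>
  of an instance of \<open>S'_left\<close>, that is, to
  \<open>t\<^sub>L(\<pi>\<^sub>L(b\<^sub>1))\<close>; the counit does the rest.\<close>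

lemma sum_SR'_S':
  assumes f: "balL f"
  shows "SR' b (\<lambda>x y. SL y (\<lambda>u v. f (u * S' x) v)) = f 1 b"
proof -
  note fD = left_balancedD[OF f]
  have "SR' b (\<lambda>x y. SL y (\<lambda>u v. f (u * S' x) v)) = SL b (\<lambda>x y. SR' x (\<lambda>u v. f (v * S' u) y))"
    by (rule mixed_coassoc_right_SR'[symmetric])
      (simp_all add: additive3_def fD S'_add S'_mult S'_tL distrib_left distrib_right mult.assoc)
  also have "\<dots> = SL b (\<lambda>x y. f (S' (SL (S x) (\<lambda>u v. S' v * u))) y)"
    by (simp add: additive_ssum[OF additive_S'] additive_ssum[OF left_balanced_additive(1)[OF f]] S'_mult)
  also have "\<dots> = SL b (\<lambda>x y. f 1 (sL (\<pi>L x) * y))"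
    using fD(3)[of _ 1] by (simp add: S'_left S'_sL)
  also have "\<dots> = f 1 b"
    by (rule L.sum_counit_left[OF left_balanced_additive(2)[OF f]])
  finally show ?thesis .
qed

text \<open>Both comultiplications invert \<beta>. Expanding \<open>f x y\<close> by
  \<open>sum_S_SR\<close> with \<open>\<gamma>R\<close> and contracting by \<open>sum_SR'_S'\<close>
  with \<open>\<gamma>R'\<close> leaves the sum over \<open>\<gamma>R\<close>.\<close>

lemma SR'_eq_SR:
  assumes f: "balR f"
  shows "SR' a f = SR a f"
proof -
  note fD = balRD[OF f]
  have balR_f: "balR (\<lambda>p q. f (c * p) q)" for c
    by (rule balRI) (simp_all add: fD distrib_left flip: mult.assoc)
  define Q where "Q u w = SR w (\<lambda>p q. f (S u * p) q)" for u w
  have balL_Q: "balL Q"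
    by (rule left_balancedI)
      (simp_all add: Q_def SR_add[OF balR_f] SR_sL_mult[OF balR_f] S_add S_mult S_tL fD distrib_right ssum_fun_add mult.assoc)
  have "f x y = SL y (\<lambda>u w. Q (u * S' x) w)" for x y
    using sum_S_SR[OF balR_f[of x], of y] by (simp add: Q_def S_mult mult.assoc)
  then have "SR' a f = SR' a (\<lambda>x y. SL y (\<lambda>u w. Q (u * S' x) w))" by simp
  also have "\<dots> = Q 1 a"
    by (rule sum_SR'_S'[OF balL_Q])
  finally show ?thesis by (simp add: Q_def S_1)
qed

lemma sum_SR_S:
  assumes f: "balL f"
  shows "SR b (\<lambda>x y. SL x (\<lambda>u v. f u (v * S y))) = f b 1"
proof -
  note fD = left_balancedD[OF f]
  have balL_f: "balL (\<lambda>u v. f u (v * c))" for c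
    by (rule left_balancedI) (simp_all add: fD distrib_right mult.assoc)
  have "balR (\<lambda>x y. SL x (\<lambda>u v. f u (v * S y)))"
    by (rule balRI) (simp_all add: L.left_balanced_sum_add[OF balL_f] L.left_balanced_sum_mult_t[OF balL_f]
        S_add S_mult S_tR fD distrib_left ssum_fun_add mult.assoc)
  from SR'_eq_SR[OF this, of b] show ?thesis
    using sum_hopf_S'[OF f, of "S b"] by simp
qed

lemma sum_SL_SR:
  assumes f: "balR f"
  shows "SL p (\<lambda>x y. SR x (\<lambda>u v. f u (S' y * v))) = f p 1"
proof -
  have "balR (\<lambda>u v. f u (c * v))" for c
    by (rule balRI) (simp_all add: balRD[OF f] distrib_left flip: mult.assoc)
  from SR'_eq_SR[OF this] show ?thesis
    using sum_hopf_S[OF balL_S'_S'[OF f], of p] by (simp add: S'_mult S'_1)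
qed

text \<open>The scheme of \<open>mixed_coassoc_right_SR\<close> for \<alpha>:
  \<open>sum_SL_SR\<close> expands and \<open>sum_SR_S\<close> contracts. Both rest on
  \<open>SR'_eq_SR\<close>.\<close>

lemma mixed_coassoc_left_SR:
  assumes f: "additive3 f" "\<And>l x y z. f (tL l * x) y z = f x (sL l * y) z"
    "\<And>l x y z. f x (y * tL l) z = f x y (z * tR (\<mu> l))"
  shows "SR a (\<lambda>x y. SL x (\<lambda>u v. f u v y)) = SL a (\<lambda>x y. SR y (\<lambda>u v. f x u v))"
proof -
  have f_add: "f (x + x') y z = f x y z + f x' y z" "f x (y + y') z = f x y z + f x y' z"
    "f x y (z + z') = f x y z + f x y z'" for x x' y y' z z'
    using f(1) by (simp_all add: additive3_def)
  have balR_f: "balR (\<lambda>p q. f u p (c * q))" for c u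
    by (rule balRI) (simp_all add: f f_add distrib_left flip: mult.assoc)
  define G where "G y u w v = SR w (\<lambda>p q. f u p (y * (S' v * q)))" for y u w v
  have G_add: "G y (u + u') w v = G y u w v + G y u' w v" "G y u (w + w') v = G y u w v + G y u w' v"
    "G y u w (v + v') = G y u w v + G y u w v'" for y u u' w w' v v'
    using SR_add[OF balR_f[of u "y * S' v"]]
    by (simp_all add: G_def S'_add distrib_left distrib_right f_add ssum_fun_add mult.assoc)
  have G_1: "G y (tL l * u) w v = G y u (sL l * w) v" for y l u w v
    using SR_sL_mult[OF balR_f[of u "y * S' v"]] by (simp add: G_def f mult.assoc)
  have G_2: "G y u (tL l * w) v = G y u w (sL l * v)" for y l u w v
    using SR_tL_mult[OF balR_f[of u "y * S' v"]] by (simp add: G_def S'_mult S'_sL mult.assoc)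
  have balL_G: "balL (\<lambda>u w. G y u w v)" for y v
    by (rule left_balancedI) (simp_all add: G_add G_1)
  define H where "H x v = SL x (\<lambda>u w. G 1 u w v)" for x v
  have balL_H: "balL H"
    by (rule left_balancedI)
      (simp_all add: H_def L.left_balanced_sum_add[OF balL_G] L.left_balanced_sum_t[OF balL_G] G_add G_2 ssum_fun_add)
  have "SL c (\<lambda>u v. f u v y) = SL c (\<lambda>u v. H u (v * S y))" for c y
  proof -
    have "f u v y = SL v (\<lambda>w v. G y u w v)" for u v
      using sum_SL_SR[OF balR_f[of u y], of v] by (simp add: G_def)
    then have "SL c (\<lambda>u v. f u v y) = SL c (\<lambda>u v. SL v (\<lambda>w v. G y u w v))" by simp
    also have "\<dots> = SL c (\<lambda>x v. SL x (\<lambda>u w. G y u w v))"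
      by (rule L.left_balanced_sum_coassoc[symmetric]) (simp_all add: additive3_def G_add G_1 G_2)
    also have "\<dots> = SL c (\<lambda>u v. H u (v * S y))"
      by (simp add: H_def G_def S'_mult mult.assoc)
    finally show ?thesis .
  qed
  then have "SR a (\<lambda>x y. SL x (\<lambda>u v. f u v y)) = SR a (\<lambda>x y. SL x (\<lambda>u v. H u (v * S y)))"
    by simp
  also have "\<dots> = H a 1"
    by (rule sum_SR_S[OF balL_H])
  finally show ?thesis
    by (simp add: H_def G_def S'_1)
qed

lemma \<gamma>R_eq: "\<gamma>R = \<gamma>R'"
proof
  fix a
  show "\<gamma>R a = \<gamma>R' a"
    by (rule RR_eqI[where s = sR and t = tR]) (simp_all only: \<gamma>R_in sum_\<gamma>R[OF right_balanced_elem] sum_\<gamma>R'[OF right_balanced_elem]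
        SR'_eq_SR[OF right_balanced_elem])
qed

lemma comults_compatible: "comults_compatible sL tL \<gamma>L sR tR \<gamma>R"
  unfolding comults_compatible_def fun_eq_iff comp_apply
proof (intro conjI allI)
  fix a
  let ?N = "tens3 (right_by_left tL) (left_by_left sL) (right_by_right sR) (left_by_right tR)"
  have f: "additive3 (elem3 ?N)" "\<And>l x y z. elem3 ?N (tL l * x) y z = elem3 ?N x (sL l * y) z"
    "\<And>r x y z. elem3 ?N x (y * sR r) z = elem3 ?N x y (z * tR r)"
    using balanced3_elem3[of "right_by_left tL" "left_by_left sL" "right_by_right sR" "left_by_right tR"]
    by (simp_all only: balanced3_additive3 right_by_left_def left_by_left_def right_by_right_def left_by_right_def)
  have f_add: "elem3 ?N (x + x') y z = elem3 ?N x y z + elem3 ?N x' y z"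
    "elem3 ?N x (y + y') z = elem3 ?N x y z + elem3 ?N x y' z"
    "elem3 ?N x y (z + z') = elem3 ?N x y z + elem3 ?N x y z'" for x x' y y' z z'
    using f(1) by (simp_all add: additive3_def)
  have f_R: "elem3 ?N x (y * tL l) z = elem3 ?N x y (z * tR (\<mu> l))" for l x y z
    using f(3)[of x y "\<mu> l" z] by (simp add: sR_eq)
  have left: "balL (\<lambda>u v. elem3 ?N u v z)" and right: "balR (\<lambda>u v. elem3 ?N z u v)" for z
    by (rule left_balancedI balRI; simp add: f(2) f_R f_add)+
  have outer: "balR (\<lambda>x y. SL x (\<lambda>u v. elem3 ?N u v y))"
    by (rule balRI) (simp_all add: L.left_balanced_sum_add[OF left] L.left_balanced_sum_mult_t[OF left] f_add f_R ssum_fun_add)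
  show "tmap_left (LLRR sL tL sR tR) \<gamma>L (\<gamma>R a) = tmap_right (LLRR sL tL sR tR) \<gamma>R (\<gamma>L a)"
    unfolding LLRR_def tmap_left_right_eq_iff[OF subgroup_tens3] sum_\<gamma>R[OF outer] sum_\<gamma>R[OF right]
    by (rule mixed_coassoc_left_SR[OF f(1,2) f_R])
next
  fix a
  let ?N = "tens3 (right_by_right sR) (left_by_right tR) (right_by_left tL) (left_by_left sL)"
  have f: "additive3 (elem3 ?N)" "\<And>r x y z. elem3 ?N (x * sR r) y z = elem3 ?N x (y * tR r) z"
    "\<And>l x y z. elem3 ?N x (tL l * y) z = elem3 ?N x y (sL l * z)"
    using balanced3_elem3[of "right_by_right sR" "left_by_right tR" "right_by_left tL" "left_by_left sL"]
    by (simp_all only: balanced3_additive3 right_by_left_def left_by_left_def right_by_right_def left_by_right_def)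
  have f_add: "elem3 ?N (x + x') y z = elem3 ?N x y z + elem3 ?N x' y z"
    "elem3 ?N x (y + y') z = elem3 ?N x y z + elem3 ?N x y' z"
    "elem3 ?N x y (z + z') = elem3 ?N x y z + elem3 ?N x y z'" for x x' y y' z z'
    using f(1) by (simp_all add: additive3_def)
  have f_R: "elem3 ?N (x * tL l) y z = elem3 ?N x (y * tR (\<mu> l)) z" for l x y z
    using f(2)[of x "\<mu> l" y z] by (simp add: sR_eq)
  have left: "balL (\<lambda>u v. elem3 ?N z u v)" and right: "balR (\<lambda>u v. elem3 ?N u v z)" for z
    by (rule left_balancedI balRI; simp add: f(3) f_R f_add)+
  have outer: "balR (\<lambda>x y. SL y (\<lambda>u v. elem3 ?N x u v))"
    by (rule balRI) (simp_all add: L.left_balanced_sum_add[OF left] tR_eq L.left_balanced_sum_mult_s[OF left] f_add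
        f_R ssum_fun_add)
  show "tmap_left (RRLL sL tL sR tR) \<gamma>R (\<gamma>L a) = tmap_right (RRLL sL tL sR tR) \<gamma>L (\<gamma>R a)"
    unfolding RRLL_def tmap_left_right_eq_iff[OF subgroup_tens3] sum_\<gamma>R[OF outer] sum_\<gamma>R[OF right]
    by (rule mixed_coassoc_right_SR[OF f(1) f_R f(3)])
qed

end

section \<open>Assembling the implications\<close>

lemma (in twisted_antipode) \<gamma>R_comp: "\<gamma>R = swap_antipode (RR sR tR) S \<circ> \<gamma>L \<circ> S'"
  by (simp add: fun_eq_iff \<gamma>R_def)

lemma (in twisted_antipode) \<gamma>R'_comp:
  "\<gamma>R' = inv_into (tensor (RR sR tR)) (swap_antipode (LL sL tL) S) \<circ> \<gamma>L \<circ> S"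
  by (simp add: fun_eq_iff \<gamma>R'_def inv_swap_antipode L.comult_in)

lemma (in hopf_antipode) hopf_via_twist: "hopf_via_twist sL tL \<gamma>L \<pi>L \<mu> S"
proof -
  have "S \<circ> tL = sL"
    by (simp add: fun_eq_iff S_tL)
  then show ?thesis
    using L.left_bialgebroid_axioms bij_S antimap_S S_left bij_theta comults_compatible \<gamma>R_eq
    unfolding hopf_via_twist_def Let_def \<gamma>R_comp \<gamma>R'_comp sR_def tR_def \<theta>_def by blast
qed

lemma (in twisted_antipode) hopf_via_pair:
  assumes eq: "\<gamma>R = \<gamma>R'" and compatible: "comults_compatible sL tL \<gamma>L sR tR \<gamma>R"
  shows "hopf_via_pair sL tL \<gamma>L \<pi>L sR tR \<gamma>R \<pi>R S"
proof -
  have "range sL = range tR"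
    using sL_eq_tR tR_eq by (metis image_subset_iff rangeI subset_antisym)
  moreover have "range tL = range sR"
    using sR_eq \<kappa>_\<mu> by (metis image_subset_iff rangeI subset_antisym)
  moreover have "ssum (\<gamma>R a) (\<lambda>x y. x * S y) = sL (\<pi>L a)" for a
  proof -
    have "balR (\<lambda>x y. x * S y)"
      by (rule balRI) (simp_all add: S_add S_mult S_tR distrib_left distrib_right mult.assoc)
    \<comment> \<open>The second equation of (d) is the image under \<open>S\<close> of the first
      one taken at \<open>S' a\<close>.\<close>
    then have "ssum (\<gamma>R a) (\<lambda>x y. x * S y) = S (SL (S' a) (\<lambda>x y. S x * y))"
      by (simp add: sum_\<gamma>R additive_ssum[OF additive_S] S_mult)
    then show ?thesis by (simp add: S_left S_tL)
  qed
  ultimately show ?thesis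
    unfolding hopf_via_pair_def paired_bialgebroids_def
    using right_bialgebroid L.left_bialgebroid_axioms opposite compatible bij_S
    by (auto simp: eq S_add S_mult S_tL S_tR S_left sR_eq \<pi>R_def mult.assoc)
qed

text \<open>What remains to be extracted from (i) is the bijectivity of \<theta>. By the two counit
  identities \<open>S\<close> maps values of \<open>sL\<close> to values of \<open>tL\<close> and
  \<open>inv S\<close> maps them back, so \<open>\<pi>L \<circ> inv S \<circ> tL\<close> is the
  inverse.\<close>

lemma hopf_antipodeI:
  fixes sL tL :: "'l::{ring,monoid_mult} \<Rightarrow> 'a::{ring,monoid_mult}"
    and \<mu> :: "'l \<Rightarrow> 'r::{ring,monoid_mult}"
  assumes h: "hopf_algebroid sL tL \<gamma>L \<pi>L S" and \<mu>: "base_opposite \<mu>"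
  shows "hopf_antipode sL tL \<gamma>L \<pi>L S \<mu>"
proof -
  interpret L: left_bialgebroid sL tL \<gamma>L \<pi>L
    using h by (simp add: hopf_algebroid_def)
  have bij: "bij S" and anti: "ring_antimap S" and S_tL: "S (tL l) = sL l" for l
    using h by (auto simp: hopf_algebroid_def)
  let ?S' = "inv S"
  have S_S': "S (?S' a) = a" and S'_S: "?S' (S a) = a" for a
    using bij by (simp_all add: bij_is_surj bij_is_inj surj_f_inv_f)
  have S_add: "S (x + y) = S x + S y" and S_mult: "S (x * y) = S y * S x" and S_1: "S 1 = 1" for x y
    using anti by (simp_all add: ring_antimap_def)
  have S'_add: "?S' (x + y) = ?S' x + ?S' y" and S'_mult: "?S' (x * y) = ?S' y * ?S' x" for x y
    by (metis S_add S_S' S'_S, metis S_mult S_S' S'_S)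
  have S'_sL: "?S' (sL l) = tL l" for l
    by (metis S_tL S'_S)
  note left = L.sum_hopf_counit(1)[OF h] and left' = L.sum_hopf_counit(2)[OF h]
  have S_sL: "S (sL l) = tL (\<pi>L (S (sL l)))" for l
  proof -
    have "left_balanced sL tL (\<lambda>x y. S x * y)"
      by (rule left_balancedI) (simp_all add: S_add S_mult S_tL distrib_left distrib_right mult.assoc)
    from L.left_balanced_sum_of_s[OF this, of l] show ?thesis by (simp add: left)
  qed
  have S'_tL: "?S' (tL l) = sL (\<pi>L (?S' (tL l)))" for l
  proof -
    have "left_balanced sL tL (\<lambda>x y. ?S' y * x)"
      by (rule left_balancedI) (simp_all add: S'_add S'_mult S'_sL distrib_left distrib_right mult.assoc)
    from L.left_balanced_sum_of_t[OF this, of l] show ?thesis by (simp add: left')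
  qed
  have "bij (\<pi>L \<circ> S \<circ> sL)"
  proof (rule o_bij)
    show "(\<pi>L \<circ> ?S' \<circ> tL) \<circ> (\<pi>L \<circ> S \<circ> sL) = id"
      by (simp add: fun_eq_iff S'_S L.counit_s' flip: S_sL)
    show "(\<pi>L \<circ> S \<circ> sL) \<circ> (\<pi>L \<circ> ?S' \<circ> tL) = id"
      by (simp add: fun_eq_iff S_S' L.counit_t' flip: S'_tL)
  qed
  then show ?thesis
    by unfold_locales (use bij anti S_tL left \<mu> h in auto)
qed

lemma hopf_via_twist_imp_hopf_via_pair:
  fixes sL tL :: "'l::{ring,monoid_mult} \<Rightarrow> 'a::{ring,monoid_mult}"
    and \<mu> :: "'l \<Rightarrow> 'r::{ring,monoid_mult}"
  assumes h: "hopf_via_twist sL tL \<gamma>L \<pi>L \<mu> S" and \<mu>: "base_opposite \<mu>"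
  shows "\<exists>(sR :: 'r \<Rightarrow> 'a) tR \<gamma>R \<pi>R. hopf_via_pair sL tL \<gamma>L \<pi>L sR tR \<gamma>R \<pi>R S"
proof -
  interpret L: left_bialgebroid sL tL \<gamma>L \<pi>L
    using h by (simp add: hopf_via_twist_def)
  interpret twisted_antipode sL tL \<gamma>L \<pi>L S \<mu>
    by unfold_locales (use h \<mu> in \<open>auto simp: hopf_via_twist_def Let_def\<close>)
  have "\<gamma>R = \<gamma>R'" "comults_compatible sL tL \<gamma>L sR tR \<gamma>R"
    using h unfolding hopf_via_twist_def Let_def \<gamma>R_comp \<gamma>R'_comp sR_def tR_def \<theta>_def by blast+
  from hopf_via_pair[OF this] show ?thesis by blast
qed

lemma hopf_via_pair_iff_locale:
  "hopf_via_pair sL tL \<gamma>L \<pi>L sR tR \<gamma>R \<pi>R S \<longleftrightarrow>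
     bijective_antipode sL tL \<gamma>L \<pi>L sR tR \<gamma>R \<pi>R S \<and> (\<exists>\<nu> :: 'l \<Rightarrow> 'r. base_opposite \<nu>)"
  for sL :: "'l::{ring,monoid_mult} \<Rightarrow> 'a::{ring,monoid_mult}" and sR :: "'r::{ring,monoid_mult} \<Rightarrow> 'a"
  unfolding hopf_via_pair_def paired_bialgebroids_def bijective_antipode_def antipode_def mixed_pair_def
    bijective_antipode_axioms_def antipode_axioms_def mixed_pair_axioms_def
  by blast

lemma galois_pair_iff_locale:
  "galois_pair sL tL \<gamma>L \<pi>L sR tR \<gamma>R \<pi>R \<longleftrightarrow>
     galois sL tL \<gamma>L \<pi>L sR tR \<gamma>R \<pi>R \<and> (\<exists>\<nu> :: 'l \<Rightarrow> 'r. base_opposite \<nu>)"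
  for sL :: "'l::{ring,monoid_mult} \<Rightarrow> 'a::{ring,monoid_mult}" and sR :: "'r::{ring,monoid_mult} \<Rightarrow> 'a"
  unfolding galois_pair_def paired_bialgebroids_def galois_def galois_axioms_def mixed_pair_def
    mixed_pair_axioms_def
  by blast

lemma hopf_via_pair_iff_galois_pair:
  "(\<exists>S. hopf_via_pair sL tL \<gamma>L \<pi>L sR tR \<gamma>R \<pi>R S) \<longleftrightarrow> galois_pair sL tL \<gamma>L \<pi>L sR tR \<gamma>R \<pi>R"
proof
  assume "\<exists>S. hopf_via_pair sL tL \<gamma>L \<pi>L sR tR \<gamma>R \<pi>R S"
  then obtain S where h: "hopf_via_pair sL tL \<gamma>L \<pi>L sR tR \<gamma>R \<pi>R S" by blast
  then interpret bijective_antipode sL tL \<gamma>L \<pi>L sR tR \<gamma>R \<pi>R S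
    by (simp add: hopf_via_pair_iff_locale)
  show "galois_pair sL tL \<gamma>L \<pi>L sR tR \<gamma>R \<pi>R"
    using h bij_galois_alpha bij_galois_beta by (simp add: galois_pair_def hopf_via_pair_def)
next
  assume g: "galois_pair sL tL \<gamma>L \<pi>L sR tR \<gamma>R \<pi>R"
  then interpret galois sL tL \<gamma>L \<pi>L sR tR \<gamma>R \<pi>R
    by (simp add: galois_pair_iff_locale)
  show "\<exists>S. hopf_via_pair sL tL \<gamma>L \<pi>L sR tR \<gamma>R \<pi>R S"
    using g bijective_antipode_axioms unfolding hopf_via_pair_iff_locale galois_pair_iff_locale by blast
qed

text \<open>(i), (ii) and (iii) are compared for a fixed \<open>S\<close>, with the right
  bialgebroid of (iii) existentially quantified; (iii) and (iv) are compared for a fixed right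
  bialgebroid, with \<open>S\<close> existentially quantified.\<close>

theorem proposition4p2:
  fixes sL tL :: "'l::{ring,monoid_mult} \<Rightarrow> 'a::{ring,monoid_mult}"
    and \<gamma>L :: "'a \<Rightarrow> (('a \<times> 'a) \<Rightarrow>\<^sub>0 int) set"
    and \<pi>L :: "'a \<Rightarrow> 'l"
    and \<mu> :: "'l \<Rightarrow> 'r::{ring,monoid_mult}"
  assumes "base_opposite \<mu>"
  shows
    "(\<forall>S. hopf_algebroid sL tL \<gamma>L \<pi>L S \<longleftrightarrow> hopf_via_twist sL tL \<gamma>L \<pi>L \<mu> S) \<and>
     (\<forall>S. hopf_algebroid sL tL \<gamma>L \<pi>L S \<longleftrightarrow>
          (\<exists>(sR :: 'r \<Rightarrow> 'a) tR \<gamma>R \<pi>R. hopf_via_pair sL tL \<gamma>L \<pi>L sR tR \<gamma>R \<pi>R S)) \<and>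
     (\<forall>(sR :: 'r \<Rightarrow> 'a) tR \<gamma>R \<pi>R.
          (\<exists>S. hopf_via_pair sL tL \<gamma>L \<pi>L sR tR \<gamma>R \<pi>R S) \<longleftrightarrow>
          galois_pair sL tL \<gamma>L \<pi>L sR tR \<gamma>R \<pi>R)"
proof -
  have i_ii: "hopf_via_twist sL tL \<gamma>L \<pi>L \<mu> S" if "hopf_algebroid sL tL \<gamma>L \<pi>L S" for S
    using hopf_antipode.hopf_via_twist[OF hopf_antipodeI[OF that assms]] .
  have ii_iii: "\<exists>(sR :: 'r \<Rightarrow> 'a) tR \<gamma>R \<pi>R. hopf_via_pair sL tL \<gamma>L \<pi>L sR tR \<gamma>R \<pi>R S"
    if "hopf_via_twist sL tL \<gamma>L \<pi>L \<mu> S" for S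
    using hopf_via_twist_imp_hopf_via_pair[OF that assms] .
  have iii_i: "hopf_algebroid sL tL \<gamma>L \<pi>L S"
    if "hopf_via_pair sL tL \<gamma>L \<pi>L sR tR \<gamma>R \<pi>R S" for S and sR :: "'r \<Rightarrow> 'a" and tR \<gamma>R \<pi>R
    using that bijective_antipode.hopf_algebroid by (auto simp: hopf_via_pair_iff_locale)
  show ?thesis
    using i_ii ii_iii iii_i by (intro conjI allI hopf_via_pair_iff_galois_pair) blast+
qed

end
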